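(* Let $U/U_0$, $\mathcal{A}$, $a_1,\dots,a_r$, $b\in\mathcal{A}$, the odd integer $j>1$, $f\in L_-^{\tau,\sigma}(G)$, and the resulting functions $Q_{c,n}$ be as described in the context. Let $c\in\mathcal{A}$ and let $n$ be a positive integer. Then $$(Q_{c,n},a_i)_{x_k}=(Q_{c,n},a_k)_{x_i},\qquad 1\le i\neq k\le r.$$ In particular, for each fixed $t$, the form $$\phi_{c,n}:=\sum_{i=1}^r (Q_{c,n},a_i)\,dx_i$$ is a closed $1$-form in the variables $x=(x_1,\dots,x_r)\in\mathbb{R}^r$ (on the open set where $Q_{c,n}$ is defined).
   Context: $G$ is a complex semi-simple Lie group with Lie algebra $\mathcal{G}$; $\tau$ is an involution of $G$ with complex conjugate linear differential at $e$; $\sigma$ is an involution of $G$ with complex linear differential at $e$; $\tau\sigma=\sigma\tau$. $U$ is the fixed point set of $\tau$, with Lie algebra $\mathcal{U}$; $U_0$ is the subgroup of $U$ fixed by $\sigma$; $\mathcal{U}_0,\mathcal{U}_1$ are the $\pm1$ eigenspaces of $d\sigma_e$ on $\mathcal{U}$; $U/U_0$ has rank $r$. $(\ ,\ )$ is a fixed ad-invariant non-degenerate bilinear form on $\mathcal{U}$. $a\in\mathcal{U}_1$ is regular if $\{y\in\mathcal{U}_1:[a,y]=0\}$ is a maximal abelian subspace of $\mathcal{U}_1$ whose $\mathrm{Ad}(U_0)$-saturation (the union of its images under $\mathrm{Ad}(U_0)$) is open in $\mathcal{U}_1$. $\mathcal{A}$ is a maximal abelian subspace of $\mathcal{U}_1$,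 and $a_1,\dots,a_r$ is a basis of $\mathcal{A}$ consisting of regular elements. Loop groups: fix a small $\epsilon>0$ and let $\mathcal{O}_\epsilon=\{\lambda\in\mathbb{C}: |\lambda|>1/\epsilon\}\cup\{\infty\}\subset S^2=\mathbb{C}\cup\{\infty\}$. $L(G)$ is the group of holomorphic maps $\mathcal{O}_\epsilon\setminus\{\infty\}\to G$; $L_+(G)$ is the subgroup of those that extend holomorphically to $\mathbb{C}$; $L_-(G)$ is the subgroup of those that extend holomorphically to $\mathcal{O}_\epsilon$ with value $e$ at $\infty$. $L^{\tau,\sigma}(G)$ and $L_\pm^{\tau,\sigma}(G)$ are the subgroups of those $g$ in $L(G)$, $L_\pm(G)$ satisfying $\tau(g(\bar\lambda))=g(\lambda)$ and $\sigma(g(\lambda))=g(-\lambda)$. By the Birkhoff factorization theorem, multiplication $L_+^{\tau,\sigma}(G)\times L_-^{\tau,\sigma}(G)\to L^{\tau,\sigma}(G)$ is injective with open dense image. Construction of $Q_{c,n}$: let $b\in\mathcal{A}$, let $j>1$ be an odd integer, and put $e^A(x,t)(\lambda)=\exp\big((a_1x_1+\cdots+a_rx_r)\lambda+b\lambda^jt\big)$ for $(x,t)\in\mathbb{R}^r\times\mathbb{R}$. Given $f\in L_-^{\tau,\sigma}(G)$, there is an open neighborhood of $(0,0)$ in $\mathbb{R}^r\times\mathbb{R}$ on which one can factor uniquely and smoothly $$f^{-1}e^A(x,t)=E(x,t)\,m(x,t)^{-1},\qquad E(x,t)\in L_+^{\tau,\sigma}(G),\quad m(x,t)\in L_-^{\tau,\sigma}(G).$$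 For $c\in\mathcal{A}$, the functions $Q_{c,n}(x,t)$ are the coefficients of the Taylor series at $\lambda=\infty$: $$m(x,t)^{-1}\,c\,m(x,t)=Q_{c,0}+Q_{c,1}\lambda^{-1}+Q_{c,2}\lambda^{-2}+\cdots,$$ where $m^{-1}cm$ means $\mathrm{Ad}(m^{-1})c$. By the reality conditions the $Q_{c,n}$ are $\mathcal{U}$-valued. Subscripts $x_i$ denote partial derivatives. *)

theory Defs
  imports "HOL-Analysis.Analysis" "HOL-Algebra.Group"
begin

section \<open>Smooth and holomorphic maps between open subsets of normed spaces\<close>

text \<open>These notions are only used for sets \<open>S\<close> that are open in the ambient space.\<close>

primrec Ck_on :: "nat \<Rightarrow> ('a::real_normed_vector \<Rightarrow> 'b::real_normed_vector) \<Rightarrow> 'a set \<Rightarrow> bool" where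
  "Ck_on 0 f S \<longleftrightarrow> continuous_on S f"
| "Ck_on (Suc k) f S \<longleftrightarrow> (\<forall>x\<in>S. f differentiable (at x)) \<and>
     (\<forall>v. Ck_on k (\<lambda>x. frechet_derivative f (at x) v) S)"

definition smooth_on ::
    "'a set \<Rightarrow> ('a::real_normed_vector \<Rightarrow> 'b::real_normed_vector) \<Rightarrow> bool" where
  "smooth_on S f \<longleftrightarrow> (\<forall>k. Ck_on k f S)"

text \<open>Holomorphic maps of several variables: smooth maps satisfying the Cauchy--Riemann equations,
  that is, with complex linear derivatives. \<open>Ja\<close> and \<open>Jb\<close> are multiplication by the imaginary unit
  on the source and on the target.\<close>

definition holomorphic_wrt ::
    "('a \<Rightarrow> 'a) \<Rightarrow> ('b \<Rightarrow> 'b) \<Rightarrow> 'a set \<Rightarrow> ('a::real_normed_vector \<Rightarrow> 'b::real_normed_vector) \<Rightarrow> bool" where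
  "holomorphic_wrt Ja Jb S f \<longleftrightarrow> smooth_on S f \<and>
     (\<forall>x\<in>S. \<forall>v. frechet_derivative f (at x) (Ja v) = Jb (frechet_derivative f (at x) v))"

abbreviation J_vec :: "complex^'n \<Rightarrow> complex^'n" where
  "J_vec v \<equiv> \<i> *s v"


section \<open>Complex Lie groups\<close>

text \<open>A group together with a topology and an atlas of charts, a chart being a pair of its domain and
  its coordinate map; \<open>'n\<close> indexes the complex coordinates.\<close>

record ('g, 'n) lie_data = "'g monoid" +
  lie_top :: "'g topology"
  lie_atlas :: "('g set \<times> ('g \<Rightarrow> complex^'n)) set"

definition complex_manifold :: "('g, 'n::finite) lie_data \<Rightarrow> bool" where
  "complex_manifold G \<longleftrightarrow>
     topspace (lie_top G) = carrier G \<and>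
     Hausdorff_space (lie_top G) \<and> second_countable (lie_top G) \<and>
     (\<Union>(U, \<phi>)\<in>lie_atlas G. U) = carrier G \<and>
     (\<forall>(U, \<phi>)\<in>lie_atlas G. openin (lie_top G) U \<and> open (\<phi> ` U) \<and>
        homeomorphic_map (subtopology (lie_top G) U) (top_of_set (\<phi> ` U)) \<phi>) \<and>
     (\<forall>(U, \<phi>)\<in>lie_atlas G. \<forall>(V, \<psi>)\<in>lie_atlas G.
        holomorphic_wrt J_vec J_vec (\<phi> ` (U \<inter> V)) (\<lambda>z. \<psi> (inv_into U \<phi> z)))"

definition complex_lie_group :: "('g, 'n::finite) lie_data \<Rightarrow> bool" where
  "complex_lie_group G \<longleftrightarrow> group G \<and> complex_manifold G \<and>
     continuous_map (prod_topology (lie_top G) (lie_top G)) (lie_top G) (\<lambda>(x, y). x \<otimes>\<^bsub>G\<^esub> y) \<and>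
     (\<forall>(U, \<phi>)\<in>lie_atlas G. \<forall>(V, \<psi>)\<in>lie_atlas G. \<forall>(W, \<theta>)\<in>lie_atlas G.
        holomorphic_wrt (map_prod J_vec J_vec) J_vec
          {(\<phi> x, \<psi> y) | x y. x \<in> U \<and> y \<in> V \<and> x \<otimes>\<^bsub>G\<^esub> y \<in> W}
          (\<lambda>(p, q). \<theta> (inv_into U \<phi> p \<otimes>\<^bsub>G\<^esub> inv_into V \<psi> q))) \<and>
     continuous_map (lie_top G) (lie_top G) (\<lambda>x. inv\<^bsub>G\<^esub> x) \<and>
     (\<forall>(U, \<phi>)\<in>lie_atlas G. \<forall>(V, \<psi>)\<in>lie_atlas G.
        holomorphic_wrt J_vec J_vec (\<phi> ` {x\<in>U. inv\<^bsub>G\<^esub> x \<in> V})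
          (\<lambda>p. \<psi> (inv\<^bsub>G\<^esub> (inv_into U \<phi> p))))"

definition smooth_self_map :: "('g, 'n::finite) lie_data \<Rightarrow> ('g \<Rightarrow> 'g) \<Rightarrow> bool" where
  "smooth_self_map G F \<longleftrightarrow> continuous_map (lie_top G) (lie_top G) F \<and>
     (\<forall>(U, \<phi>)\<in>lie_atlas G. \<forall>(V, \<psi>)\<in>lie_atlas G.
        smooth_on (\<phi> ` {x\<in>U. F x \<in> V}) (\<lambda>p. \<psi> (F (inv_into U \<phi> p))))"

definition smooth_into ::
    "('g, 'n::finite) lie_data \<Rightarrow> 'a::real_normed_vector set \<Rightarrow> ('a \<Rightarrow> 'g) \<Rightarrow> bool" where
  "smooth_into G S F \<longleftrightarrow> continuous_map (top_of_set S) (lie_top G) F \<and>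
     (\<forall>(U, \<phi>)\<in>lie_atlas G. smooth_on {x\<in>S. F x \<in> U} (\<lambda>x. \<phi> (F x)))"

definition holomorphic_into ::
    "('g, 'n::finite) lie_data \<Rightarrow> complex set \<Rightarrow> (complex \<Rightarrow> 'g) \<Rightarrow> bool" where
  "holomorphic_into G S F \<longleftrightarrow> continuous_map (top_of_set S) (lie_top G) F \<and>
     (\<forall>(U, \<phi>)\<in>lie_atlas G. \<forall>i. (\<lambda>z. \<phi> (F z) $ i) holomorphic_on {z\<in>S. F z \<in> U})"


section \<open>The Lie algebra, the adjoint representation and the exponential map\<close>

text \<open>The tangent space at the identity is identified with \<open>complex^'n\<close> by one fixed chart around
  the identity.\<close>

definition chart_at_one :: "('g, 'n::finite) lie_data \<Rightarrow> 'g set \<times> ('g \<Rightarrow> complex^'n)" where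
  "chart_at_one G = (SOME c. c \<in> lie_atlas G \<and> \<one>\<^bsub>G\<^esub> \<in> fst c)"

definition coord :: "('g, 'n::finite) lie_data \<Rightarrow> 'g \<Rightarrow> complex^'n" where
  "coord G = snd (chart_at_one G)"

definition coord_inv :: "('g, 'n::finite) lie_data \<Rightarrow> complex^'n \<Rightarrow> 'g" where
  "coord_inv G = inv_into (fst (chart_at_one G)) (coord G)"

text \<open>The differential at the identity of a map that fixes the identity.\<close>

definition diff_at_one ::
    "('g, 'n::finite) lie_data \<Rightarrow> ('g \<Rightarrow> 'g) \<Rightarrow> complex^'n \<Rightarrow> complex^'n" where
  "diff_at_one G F = frechet_derivative (\<lambda>p. coord G (F (coord_inv G p))) (at (coord G \<one>\<^bsub>G\<^esub>))"

definition Ad :: "('g, 'n::finite) lie_data \<Rightarrow> 'g \<Rightarrow> complex^'n \<Rightarrow> complex^'n" where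
  "Ad G g = diff_at_one G (\<lambda>x. g \<otimes>\<^bsub>G\<^esub> x \<otimes>\<^bsub>G\<^esub> inv\<^bsub>G\<^esub> g)"

text \<open>The bracket is \<open>[u, v] = ad u v\<close>, where \<open>ad\<close> is the differential of \<open>Ad\<close> at the identity.\<close>

definition lie_bracket ::
    "('g, 'n::finite) lie_data \<Rightarrow> complex^'n \<Rightarrow> complex^'n \<Rightarrow> complex^'n" where
  "lie_bracket G u v =
     frechet_derivative (\<lambda>p. Ad G (coord_inv G p) v) (at (coord G \<one>\<^bsub>G\<^esub>)) u"

definition one_parameter_subgroup :: "('g, 'n::finite) lie_data \<Rightarrow> (real \<Rightarrow> 'g) \<Rightarrow> bool" where
  "one_parameter_subgroup G \<gamma> \<longleftrightarrow> smooth_into G UNIV \<gamma> \<and> (\<forall>s t. \<gamma> (s + t) = \<gamma> s \<otimes>\<^bsub>G\<^esub> \<gamma> t)"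

definition lie_exp :: "('g, 'n::finite) lie_data \<Rightarrow> complex^'n \<Rightarrow> 'g" where
  "lie_exp G v = (THE \<gamma>. one_parameter_subgroup G \<gamma> \<and>
     ((\<lambda>s. coord G (\<gamma> s)) has_vector_derivative v) (at 0)) 1"

definition lie_algebra_of :: "('g, 'n::finite) lie_data \<Rightarrow> 'g set \<Rightarrow> (complex^'n) set" where
  "lie_algebra_of G H = {v. \<forall>s::real. lie_exp G (s *\<^sub>R v) \<in> H}"

definition lie_ideal :: "('g, 'n::finite) lie_data \<Rightarrow> (complex^'n) set \<Rightarrow> bool" where
  "lie_ideal G I \<longleftrightarrow> vec.subspace I \<and> (\<forall>x. \<forall>y\<in>I. lie_bracket G x y \<in> I)"

definition derived_algebra :: "('g, 'n::finite) lie_data \<Rightarrow> (complex^'n) set \<Rightarrow> (complex^'n) set" where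
  "derived_algebra G I = vec.span {lie_bracket G x y | x y. x \<in> I \<and> y \<in> I}"

definition solvable_algebra :: "('g, 'n::finite) lie_data \<Rightarrow> (complex^'n) set \<Rightarrow> bool" where
  "solvable_algebra G I \<longleftrightarrow> (\<exists>k. (derived_algebra G ^^ k) I = {0})"

definition semisimple_complex_lie_group :: "('g, 'n::finite) lie_data \<Rightarrow> bool" where
  "semisimple_complex_lie_group G \<longleftrightarrow> complex_lie_group G \<and>
     (\<forall>I. lie_ideal G I \<and> solvable_algebra G I \<longrightarrow> I = {0})"


section \<open>The involutions and the symmetric space\<close>

definition lie_involution :: "('g, 'n::finite) lie_data \<Rightarrow> ('g \<Rightarrow> 'g) \<Rightarrow> bool" where
  "lie_involution G F \<longleftrightarrow> F \<in> hom G G \<and> smooth_self_map G F \<and> (\<forall>g\<in>carrier G. F (F g) = g)"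

definition admissible_involutions ::
    "('g, 'n::finite) lie_data \<Rightarrow> ('g \<Rightarrow> 'g) \<Rightarrow> ('g \<Rightarrow> 'g) \<Rightarrow> bool" where
  "admissible_involutions G \<tau> \<sigma> \<longleftrightarrow> lie_involution G \<tau> \<and> lie_involution G \<sigma> \<and>
     (\<forall>z v. diff_at_one G \<tau> (z *s v) = cnj z *s diff_at_one G \<tau> v) \<and>
     (\<forall>z v. diff_at_one G \<sigma> (z *s v) = z *s diff_at_one G \<sigma> v) \<and>
     (\<forall>g\<in>carrier G. \<tau> (\<sigma> g) = \<sigma> (\<tau> g))"

definition grp_U :: "('g, 'n::finite) lie_data \<Rightarrow> ('g \<Rightarrow> 'g) \<Rightarrow> 'g set" where
  "grp_U G \<tau> = {g\<in>carrier G. \<tau> g = g}"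

definition grp_U0 :: "('g, 'n::finite) lie_data \<Rightarrow> ('g \<Rightarrow> 'g) \<Rightarrow> ('g \<Rightarrow> 'g) \<Rightarrow> 'g set" where
  "grp_U0 G \<tau> \<sigma> = {g\<in>grp_U G \<tau>. \<sigma> g = g}"

definition alg_U :: "('g, 'n::finite) lie_data \<Rightarrow> ('g \<Rightarrow> 'g) \<Rightarrow> (complex^'n) set" where
  "alg_U G \<tau> = lie_algebra_of G (grp_U G \<tau>)"

definition alg_U1 ::
    "('g, 'n::finite) lie_data \<Rightarrow> ('g \<Rightarrow> 'g) \<Rightarrow> ('g \<Rightarrow> 'g) \<Rightarrow> (complex^'n) set" where
  "alg_U1 G \<tau> \<sigma> = {v\<in>alg_U G \<tau>. diff_at_one G \<sigma> v = - v}"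

text \<open>Subspaces of \<open>alg_U\<close> are real subspaces.\<close>

definition abelian_subspace ::
    "('g, 'n::finite) lie_data \<Rightarrow> (complex^'n) set \<Rightarrow> (complex^'n) set \<Rightarrow> bool" where
  "abelian_subspace G V M \<longleftrightarrow> subspace M \<and> M \<subseteq> V \<and> (\<forall>x\<in>M. \<forall>y\<in>M. lie_bracket G x y = 0)"

definition maximal_abelian ::
    "('g, 'n::finite) lie_data \<Rightarrow> (complex^'n) set \<Rightarrow> (complex^'n) set \<Rightarrow> bool" where
  "maximal_abelian G V M \<longleftrightarrow> abelian_subspace G V M \<and>
     (\<forall>M'. abelian_subspace G V M' \<and> M \<subseteq> M' \<longrightarrow> M' = M)"

definition regular_element ::
    "('g, 'n::finite) lie_data \<Rightarrow> ('g \<Rightarrow> 'g) \<Rightarrow> ('g \<Rightarrow> 'g) \<Rightarrow> complex^'n \<Rightarrow> bool" where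
  "regular_element G \<tau> \<sigma> a \<longleftrightarrow> a \<in> alg_U1 G \<tau> \<sigma> \<and>
     (let C = {y\<in>alg_U1 G \<tau> \<sigma>. lie_bracket G a y = 0} in
        maximal_abelian G (alg_U1 G \<tau> \<sigma>) C \<and>
        openin (top_of_set (alg_U1 G \<tau> \<sigma>)) (\<Union>g\<in>grp_U0 G \<tau> \<sigma>. Ad G g ` C))"

definition invariant_form ::
    "('g, 'n::finite) lie_data \<Rightarrow> (complex^'n) set \<Rightarrow> (complex^'n \<Rightarrow> complex^'n \<Rightarrow> real) \<Rightarrow> bool" where
  "invariant_form G V B \<longleftrightarrow>
     (\<forall>u\<in>V. \<forall>v\<in>V. \<forall>w\<in>V. B (u + v) w = B u w + B v w \<and> B w (u + v) = B w u + B w v) \<and>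
     (\<forall>s. \<forall>u\<in>V. \<forall>v\<in>V. B (s *\<^sub>R u) v = s * B u v \<and> B u (s *\<^sub>R v) = s * B u v) \<and>
     (\<forall>u\<in>V. (\<forall>v\<in>V. B u v = 0) \<longrightarrow> u = 0) \<and> (\<forall>v\<in>V. (\<forall>u\<in>V. B u v = 0) \<longrightarrow> v = 0) \<and>
     (\<forall>u\<in>V. \<forall>v\<in>V. \<forall>w\<in>V. B (lie_bracket G w u) v + B u (lie_bracket G w v) = 0)"


section \<open>Loop groups\<close>

text \<open>A loop is a function \<open>complex \<Rightarrow> 'g\<close> of which only the values on \<open>punctured_nbhd \<epsilon>\<close> matter.
  An element of \<open>L\<^sub>+\<close> is represented by its extension to the whole plane, which is unique
  by the identity theorem.\<close>

definition punctured_nbhd :: "real \<Rightarrow> complex set" where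
  "punctured_nbhd \<epsilon> = {l. cmod l > 1 / \<epsilon>}"

text \<open>The loop in the coordinate \<open>w = 1 / \<lambda>\<close> at \<open>\<infinity>\<close>, which takes \<open>punctured_nbhd \<epsilon>\<close> together with
  \<open>\<infinity>\<close> to \<open>ball 0 \<epsilon>\<close>; the value at \<open>\<infinity>\<close> is the identity.\<close>

definition at_inf :: "('g, 'n::finite) lie_data \<Rightarrow> (complex \<Rightarrow> 'g) \<Rightarrow> complex \<Rightarrow> 'g" where
  "at_inf G g w = (if w = 0 then \<one>\<^bsub>G\<^esub> else g (inverse w))"

definition loops :: "('g, 'n::finite) lie_data \<Rightarrow> real \<Rightarrow> (complex \<Rightarrow> 'g) set" where
  "loops G \<epsilon> = {g. holomorphic_into G (punctured_nbhd \<epsilon>) g}"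

definition loops_plus :: "('g, 'n::finite) lie_data \<Rightarrow> real \<Rightarrow> (complex \<Rightarrow> 'g) set" where
  "loops_plus G \<epsilon> = {g\<in>loops G \<epsilon>. holomorphic_into G UNIV g}"

definition loops_minus :: "('g, 'n::finite) lie_data \<Rightarrow> real \<Rightarrow> (complex \<Rightarrow> 'g) set" where
  "loops_minus G \<epsilon> = {g\<in>loops G \<epsilon>. holomorphic_into G (ball 0 \<epsilon>) (at_inf G g)}"

definition real_loops :: "('g \<Rightarrow> 'g) \<Rightarrow> ('g \<Rightarrow> 'g) \<Rightarrow> real \<Rightarrow> (complex \<Rightarrow> 'g) set" where
  "real_loops \<tau> \<sigma> \<epsilon> = {g. \<forall>l\<in>punctured_nbhd \<epsilon>. \<tau> (g (cnj l)) = g l \<and> \<sigma> (g l) = g (- l)}"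

definition vacuum_frame ::
    "('g, 'n::finite) lie_data \<Rightarrow> ('r::finite \<Rightarrow> complex^'n) \<Rightarrow> complex^'n \<Rightarrow> nat
       \<Rightarrow> (real^'r) \<times> real \<Rightarrow> complex \<Rightarrow> 'g" where
  "vacuum_frame G a b j = (\<lambda>(x, t) l.
     lie_exp G (l *s (\<Sum>i\<in>UNIV. x $ i *\<^sub>R a i) + (l ^ j * complex_of_real t) *s b))"

text \<open>A smooth factorization \<open>f\<^sup>-\<^sup>1 e\<^sup>A = E m\<^sup>-\<^sup>1\<close> over \<open>W\<close>. A map from \<open>W\<close> into one of the loop groups is
  smooth if it is jointly smooth in the point of \<open>W\<close> and the loop parameter, which runs over the
  whole plane for \<open>L\<^sub>+\<close> and over the full neighbourhood of \<open>\<infinity>\<close> for \<open>L\<^sub>-\<close>.\<close>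

definition smooth_factorization ::
    "('g, 'n::finite) lie_data \<Rightarrow> ('g \<Rightarrow> 'g) \<Rightarrow> ('g \<Rightarrow> 'g) \<Rightarrow> real \<Rightarrow> (complex \<Rightarrow> 'g)
       \<Rightarrow> ((real^'r::finite) \<times> real \<Rightarrow> complex \<Rightarrow> 'g) \<Rightarrow> ((real^'r) \<times> real) set
       \<Rightarrow> ((real^'r) \<times> real \<Rightarrow> complex \<Rightarrow> 'g) \<Rightarrow> ((real^'r) \<times> real \<Rightarrow> complex \<Rightarrow> 'g) \<Rightarrow> bool" where
  "smooth_factorization G \<tau> \<sigma> \<epsilon> f eA W E m \<longleftrightarrow>
     (\<forall>p\<in>W. E p \<in> loops_plus G \<epsilon> \<inter> real_loops \<tau> \<sigma> \<epsilon> \<and>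
            m p \<in> loops_minus G \<epsilon> \<inter> real_loops \<tau> \<sigma> \<epsilon> \<and>
            (\<forall>l\<in>punctured_nbhd \<epsilon>. inv\<^bsub>G\<^esub> (f l) \<otimes>\<^bsub>G\<^esub> eA p l = E p l \<otimes>\<^bsub>G\<^esub> inv\<^bsub>G\<^esub> (m p l))) \<and>
     smooth_into G (W \<times> UNIV) (\<lambda>(p, l). E p l) \<and>
     smooth_into G (W \<times> ball 0 \<epsilon>) (\<lambda>(p, w). at_inf G (m p) w)"

text \<open>The coefficient of \<open>\<lambda>\<close> to the power \<open>-n\<close> in the Taylor series at \<open>\<infinity>\<close> of \<open>Ad (g\<^sup>-\<^sup>1) c\<close>, for a loop
  \<open>g\<close> in \<open>L\<^sub>-\<close>.\<close>

definition Q_coeff ::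
    "('g, 'n::finite) lie_data \<Rightarrow> (complex \<Rightarrow> 'g) \<Rightarrow> complex^'n \<Rightarrow> nat \<Rightarrow> complex^'n" where
  "Q_coeff G g c n =
     (\<chi> i. (deriv ^^ n) (\<lambda>w. Ad G (inv\<^bsub>G\<^esub> (at_inf G g w)) c $ i) 0 / fact n)"


section \<open>Closed one-forms\<close>

text \<open>A one-form assigns to a point a linear functional on the tangent space \<open>real^'r\<close>.\<close>

definition ext_deriv ::
    "(real^'r::finite \<Rightarrow> real^'r \<Rightarrow> real) \<Rightarrow> real^'r \<Rightarrow> real^'r \<Rightarrow> real^'r \<Rightarrow> real" where
  "ext_deriv \<phi> x u v =
     frechet_derivative (\<lambda>y. \<phi> y v) (at x) u - frechet_derivative (\<lambda>y. \<phi> y u) (at x) v"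

definition closed_one_form :: "(real^'r::finite) set \<Rightarrow> (real^'r \<Rightarrow> real^'r \<Rightarrow> real) \<Rightarrow> bool" where
  "closed_one_form S \<phi> \<longleftrightarrow> (\<forall>x\<in>S. linear (\<phi> x)) \<and> (\<forall>v. smooth_on S (\<lambda>x. \<phi> x v)) \<and>
     (\<forall>x\<in>S. \<forall>u v. ext_deriv \<phi> x u v = 0)"

end

theory Submission
  imports Defs "HOL-Complex_Analysis.Complex_Analysis"
begin

text \<open>
  Write \<open>\<partial>\<^sub>k\<close> for the derivative with respect to \<open>x\<^sub>k\<close>. Since the elements of \<open>\<A>\<close> commute,
  \<open>e\<^sup>A(x + s e\<^sub>k) = e\<^sup>A(x) exp (s \<lambda> a\<^sub>k)\<close>, so the logarithmic derivative of \<open>E = f\<^sup>-\<^sup>1 e\<^sup>A m\<close> is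
  \<open>E\<^sup>-\<^sup>1 \<partial>\<^sub>k E = \<lambda> Ad (m\<^sup>-\<^sup>1) a\<^sub>k + m\<^sup>-\<^sup>1 \<partial>\<^sub>k m\<close>. The left side is entire in \<open>\<lambda>\<close>, and \<open>m\<^sup>-\<^sup>1 \<partial>\<^sub>k m\<close> vanishes at
  \<open>\<infinity>\<close>; by Liouville's theorem \<open>E\<^sup>-\<^sup>1 \<partial>\<^sub>k E = \<lambda> a\<^sub>k + u\<^sub>k\<close>, where \<open>u\<^sub>k\<close> is the first Taylor coefficient of
  \<open>Ad (m\<^sup>-\<^sup>1) a\<^sub>k\<close> at \<open>\<infinity>\<close> (\<open>nu_E_bracket\<close>). Differentiating \<open>Ad (m\<^sup>-\<^sup>1) c\<close> and using \<open>[a\<^sub>k, c] = 0\<close> gives the Lax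
  equation \<open>\<partial>\<^sub>k (Ad (m\<^sup>-\<^sup>1) c) = - [\<lambda> a\<^sub>k + u\<^sub>k, Ad (m\<^sup>-\<^sup>1) c]\<close>, that is
  \<open>\<partial>\<^sub>k Q\<^sub>n = - [a\<^sub>k, Q\<^sub>n\<^sub>+\<^sub>1] - [u\<^sub>k, Q\<^sub>n]\<close> for the Taylor coefficients (\<open>Q_coeff_derivative\<close>). Pairing with
  \<open>a\<^sub>i\<close>, invariance of the form turns the first term into \<open>(Q\<^sub>n\<^sub>+\<^sub>1, [a\<^sub>k, a\<^sub>i]) = 0\<close> and the second one into
  \<open>(Q\<^sub>n, [u\<^sub>k, a\<^sub>i])\<close>. This is symmetric in \<open>i\<close> and \<open>k\<close>, because the coefficient of order one of
  \<open>[Ad (m\<^sup>-\<^sup>1) a\<^sub>i, Ad (m\<^sup>-\<^sup>1) a\<^sub>k] = 0\<close> is \<open>[u\<^sub>i, a\<^sub>k] + [a\<^sub>i, u\<^sub>k]\<close> (\<open>Q_coeff_one_symmetric\<close>).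

  The group is an abstract complex manifold, so products such as \<open>E\<^sup>-\<^sup>1 \<partial>\<^sub>k E\<close> need a meaning. They are
  given one by \<open>log_deriv\<close>, the derivative at \<open>x\<close> of \<open>F(x)\<^sup>-\<^sup>1 F(y)\<close> in the chart at the identity. Its rules for
  products, inverses and homomorphisms and its effect on \<open>Ad F\<close> replace matrix calculus, and a map into
  the group is determined by its logarithmic derivative and one value (\<open>log_deriv_determines\<close>). From this
  principle come the one-parameter subgroups, the exponential law for commuting elements, the
  antisymmetry of the bracket and the description of \<open>\<U>\<close> as the fixed space of \<open>d\<tau>\<close>. Existence of
  one-parameter subgroups rests on Picard's theorem for the left invariant vector fields.

  Holomorphy in \<open>\<lambda>\<close> is proved for the entries of \<open>Ad E\<close> and \<open>Ad (m\<^sup>-\<^sup>1)\<close>. Uniform convergence of difference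
  quotients shows that differentiation with respect to \<open>x\<^sub>k\<close> preserves it and commutes with taking Taylor
  coefficients (\<open>holomorphic_parameter_derivative\<close>).
\<close>

section \<open>Calculus of smooth maps\<close>

lemma Ck_on_subset: "Ck_on k f S \<Longrightarrow> T \<subseteq> S \<Longrightarrow> Ck_on k f T"
  by (induction k arbitrary: f) (auto intro: continuous_on_subset)

lemma Ck_on_cong_open:
  assumes "open S" "\<And>x. x \<in> S \<Longrightarrow> f x = g x" "Ck_on k f S"
  shows "Ck_on k g S"
  using assms(2,3)
proof (induction k arbitrary: f g)
  case 0
  then show ?case by (simp cong: continuous_on_cong)
next
  case (Suc k)
  have ev: "\<forall>\<^sub>F y in nhds x. f y = g y" if "x \<in> S" for x
    using eventually_nhds_in_open[OF \<open>open S\<close> that] Suc.prems(1) by (auto elim: eventually_mono)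
  have D: "(g has_derivative frechet_derivative f (at x)) (at x)" if x: "x \<in> S" for x
  proof -
    have "(f has_derivative frechet_derivative f (at x)) (at x)"
      using Suc.prems(2) x by (simp add: frechet_derivative_works)
    then show ?thesis
      by (rule has_derivative_transform_within_open[OF _ \<open>open S\<close> x]) (auto simp: Suc.prems)
  qed
  have F: "frechet_derivative f (at x) v = frechet_derivative g (at x) v" if "x \<in> S" for x v
    using frechet_derivative_at[OF D[OF that]] by simp
  show ?case
    using Suc.IH[OF F] Suc.prems(2) D by (auto simp: differentiable_def)
qed

lemma Ck_on_local:
  assumes "\<And>x. x \<in> S \<Longrightarrow> \<exists>T. open T \<and> x \<in> T \<and> Ck_on k f T"
  shows "Ck_on k f S"
  using assms
proof (induction k arbitrary: f)
  case 0
  then show ?case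
    by (metis Ck_on.simps(1) continuous_at_imp_continuous_on continuous_on_eq_continuous_at)
next
  case (Suc k)
  have "\<exists>T. open T \<and> x \<in> T \<and> Ck_on k (\<lambda>x. frechet_derivative f (at x) v) T" if "x \<in> S" for x v
    using Suc.prems[OF that] by auto
  then have "Ck_on k (\<lambda>x. frechet_derivative f (at x) v) S" for v
    by (rule Suc.IH)
  moreover have "f differentiable (at x)" if "x \<in> S" for x
    using Suc.prems[OF that] by auto
  ultimately show ?case by simp
qed

lemma Ck_on_Suc_imp: "Ck_on (Suc k) f S \<Longrightarrow> Ck_on k f S"
proof (induction k arbitrary: f)
  case 0
  then show ?case
    by (auto intro!: continuous_at_imp_continuous_on differentiable_imp_continuous_within)
next
  case (Suc k)
  then show ?case using Ck_on.simps(2) by blast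
qed

lemma Ck_on_const: "Ck_on k (\<lambda>x. c) S"
proof (induction k arbitrary: c)
  case (Suc k)
  have "frechet_derivative (\<lambda>x::'a. c) (at x) v = 0" for x and v :: 'a
    by (simp add: frechet_derivative_const)
  then show ?case using Suc by simp
qed auto

text \<open>The recursion for \<open>Ck_on\<close> speaks of \<open>frechet_derivative\<close>; here any family of derivatives may take its
  place, so that the closure properties below follow the rules for \<open>has_derivative\<close>.\<close>

lemma Ck_on_SucI:
  assumes "open S" and D: "\<And>x. x \<in> S \<Longrightarrow> (f has_derivative D x) (at x)"
    and "\<And>v. Ck_on k (\<lambda>x. D x v) S"
  shows "Ck_on (Suc k) f S"
proof -
  have "D x v = frechet_derivative f (at x) v" if "x \<in> S" for x v
    by (simp add: frechet_derivative_at[OF D[OF that], symmetric])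
  then have "Ck_on k (\<lambda>x. frechet_derivative f (at x) v) S" for v
    by (rule Ck_on_cong_open[OF \<open>open S\<close> _ assms(3)])
  moreover have "f differentiable (at x)" if "x \<in> S" for x
    using D[OF that] by (auto simp: differentiable_def)
  ultimately show ?thesis by simp
qed

lemma Ck_on_SucD:
  assumes "Ck_on (Suc k) f S"
  shows "x \<in> S \<Longrightarrow> (f has_derivative frechet_derivative f (at x)) (at x)"
    and "Ck_on k (\<lambda>x. frechet_derivative f (at x) v) S"
  using assms by (simp_all add: frechet_derivative_works)

lemma Ck_on_bounded_linear:
  assumes "open S" "bounded_linear L" "Ck_on k f S"
  shows "Ck_on k (\<lambda>x. L (f x)) S"
  using assms(3)
proof (induction k arbitrary: f)
  case 0
  then show ?case
    using assms(2) by (simp add: bounded_linear.continuous_on)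
next
  case (Suc k)
  show ?case
  proof (rule Ck_on_SucI[OF \<open>open S\<close>])
    show "((\<lambda>x. L (f x)) has_derivative (\<lambda>v. L (frechet_derivative f (at x) v))) (at x)" if "x \<in> S" for x
      by (rule bounded_linear.has_derivative[OF assms(2) Ck_on_SucD(1)[OF Suc.prems that]])
    show "Ck_on k (\<lambda>x. L (frechet_derivative f (at x) v)) S" for v
      by (rule Suc.IH[OF Ck_on_SucD(2)[OF Suc.prems]])
  qed
qed

lemma Ck_on_add:
  assumes "open S" "Ck_on k f S" "Ck_on k g S"
  shows "Ck_on k (\<lambda>x. f x + g x) S"
  using assms(2,3)
proof (induction k arbitrary: f g)
  case 0
  then show ?case by (simp add: continuous_on_add)
next
  case (Suc k)
  show ?case
  proof (rule Ck_on_SucI[OF \<open>open S\<close>])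
    show "((\<lambda>x. f x + g x) has_derivative (\<lambda>v. frechet_derivative f (at x) v + frechet_derivative g (at x) v)) (at x)" if "x \<in> S" for x
      by (intro has_derivative_add Ck_on_SucD(1)[OF Suc.prems(1) that] Ck_on_SucD(1)[OF Suc.prems(2) that])
    show "Ck_on k (\<lambda>x. frechet_derivative f (at x) v + frechet_derivative g (at x) v) S" for v
      by (intro Suc.IH Ck_on_SucD(2)[OF Suc.prems(1)] Ck_on_SucD(2)[OF Suc.prems(2)])
  qed
qed

lemma Ck_on_sum:
  assumes "open S" "\<And>i. i \<in> I \<Longrightarrow> Ck_on k (f i) S"
  shows "Ck_on k (\<lambda>x. \<Sum>i\<in>I. f i x) S"
  using assms(2)
proof (induction I rule: infinite_finite_induct)
  case (insert i I)
  then show ?case using Ck_on_add[OF \<open>open S\<close>, of k "f i" "\<lambda>x. \<Sum>i\<in>I. f i x"] by simp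
qed (simp_all add: Ck_on_const)

lemma Ck_on_scaleR:
  fixes f :: "'a::real_normed_vector \<Rightarrow> real"
  assumes "open S" "Ck_on k f S" "Ck_on k g S"
  shows "Ck_on k (\<lambda>x. f x *\<^sub>R g x) S"
  using assms(2,3)
proof (induction k arbitrary: f g)
  case 0
  then show ?case by (simp add: continuous_on_scaleR)
next
  case (Suc k)
  show ?case
  proof (rule Ck_on_SucI[OF \<open>open S\<close>])
    show "((\<lambda>x. f x *\<^sub>R g x) has_derivative (\<lambda>v. f x *\<^sub>R frechet_derivative g (at x) v + frechet_derivative f (at x) v *\<^sub>R g x)) (at x)" if "x \<in> S" for x
      by (intro has_derivative_scaleR Ck_on_SucD(1)[OF Suc.prems(1) that] Ck_on_SucD(1)[OF Suc.prems(2) that])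
    show "Ck_on k (\<lambda>x. f x *\<^sub>R frechet_derivative g (at x) v + frechet_derivative f (at x) v *\<^sub>R g x) S" for v
      by (intro Ck_on_add \<open>open S\<close> Suc.IH Ck_on_SucD(2)[OF Suc.prems(1)] Ck_on_SucD(2)[OF Suc.prems(2)] Ck_on_Suc_imp[OF Suc.prems(1)] Ck_on_Suc_imp[OF Suc.prems(2)])
  qed
qed

lemma Ck_on_compose:
  fixes f :: "'a::real_normed_vector \<Rightarrow> 'b::euclidean_space" and g :: "'b \<Rightarrow> 'c::real_normed_vector"
  assumes S: "open S" and T: "open T" and sub: "\<And>x. x \<in> S \<Longrightarrow> f x \<in> T"
    and "Ck_on k f S" "Ck_on k g T"
  shows "Ck_on k (\<lambda>x. g (f x)) S"
  using assms(4,5)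
proof (induction k arbitrary: g)
  case 0
  then show ?case using sub by (auto intro: continuous_on_compose2[of T g S f])
next
  case (Suc k)
  define df dg where "df x = frechet_derivative f (at x)" and "dg y = frechet_derivative g (at y)" for x y
  note fD = Ck_on_SucD[OF Suc.prems(1), folded df_def]
  note gD = Ck_on_SucD[OF Suc.prems(2), folded dg_def]
  \<comment> \<open>Expanding along a basis turns the chain rule into a finite sum of products of functions of class \<open>Ck\<close>.\<close>
  have expand: "dg (f x) (df x v) = (\<Sum>b\<in>Basis. (df x v \<bullet> b) *\<^sub>R dg (f x) b)" if x: "x \<in> S" for x v
  proof -
    have "dg (f x) (df x v) = dg (f x) (\<Sum>b\<in>Basis. (df x v \<bullet> b) *\<^sub>R b)"
      by (simp add: euclidean_representation)
    also have "\<dots> = (\<Sum>b\<in>Basis. (df x v \<bullet> b) *\<^sub>R dg (f x) b)"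
      using has_derivative_linear[OF gD(1)[OF sub[OF x]]] by (simp add: linear_sum linear_cmul)
    finally show ?thesis .
  qed
  show ?case
  proof (rule Ck_on_SucI[OF S])
    show "((\<lambda>x. g (f x)) has_derivative (\<lambda>v. \<Sum>b\<in>Basis. (df x v \<bullet> b) *\<^sub>R dg (f x) b)) (at x)" if "x \<in> S" for x
      using has_derivative_compose[OF fD(1)[OF that] gD(1)[OF sub[OF that]]]
      by (simp add: expand[OF that])
    show "Ck_on k (\<lambda>x. \<Sum>b\<in>Basis. (df x v \<bullet> b) *\<^sub>R dg (f x) b) S" for v
      by (intro Ck_on_sum Ck_on_scaleR S Ck_on_bounded_linear[OF S bounded_linear_inner_left] fD(2) gD(2)
          Suc.IH Ck_on_Suc_imp[OF Suc.prems(1)])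
  qed
qed

lemma Ck_on_Pair:
  assumes "open S" "Ck_on k f S" "Ck_on k g S"
  shows "Ck_on k (\<lambda>x. (f x, g x)) S"
proof -
  have "bounded_linear (\<lambda>u::'b. (u, 0::'c))" "bounded_linear (\<lambda>u::'c. (0::'b, u))"
    by (auto intro!: bounded_linear_Pair bounded_linear_ident bounded_linear_zero)
  from Ck_on_add[OF assms(1) Ck_on_bounded_linear[OF assms(1) this(1) assms(2)]
      Ck_on_bounded_linear[OF assms(1) this(2) assms(3)]]
  show ?thesis by simp
qed

lemma Ck_on_linear: "open S \<Longrightarrow> bounded_linear L \<Longrightarrow> Ck_on k L S"
proof (induction k)
  case 0
  then show ?case by (auto intro: bounded_linear.continuous_on[OF _ continuous_on_id])
next
  case (Suc k)
  have D: "(L has_derivative L) (at x)" for x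
    using Suc.prems(2) by (rule bounded_linear_imp_has_derivative)
  show ?case
    by (rule Ck_on_SucI[OF Suc.prems(1) D]) (rule Ck_on_const)
qed

lemma smooth_on_subset: "smooth_on S f \<Longrightarrow> T \<subseteq> S \<Longrightarrow> smooth_on T f"
  by (auto simp: smooth_on_def intro: Ck_on_subset)

lemma smooth_on_cong_open: "open S \<Longrightarrow> (\<And>x. x \<in> S \<Longrightarrow> f x = g x) \<Longrightarrow> smooth_on S f \<Longrightarrow> smooth_on S g"
  unfolding smooth_on_def using Ck_on_cong_open by metis

lemma smooth_on_local:
  assumes "\<And>x. x \<in> S \<Longrightarrow> \<exists>T. open T \<and> x \<in> T \<and> smooth_on T f"
  shows "smooth_on S f"
  using assms unfolding smooth_on_def by (metis Ck_on_local)

lemma smooth_on_const: "smooth_on S (\<lambda>x. c)"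
  by (simp add: smooth_on_def Ck_on_const)

lemma smooth_on_bounded_linear: "open S \<Longrightarrow> bounded_linear L \<Longrightarrow> smooth_on S f \<Longrightarrow> smooth_on S (\<lambda>x. L (f x))"
  by (simp add: smooth_on_def Ck_on_bounded_linear)

lemma smooth_on_linear: "open S \<Longrightarrow> bounded_linear L \<Longrightarrow> smooth_on S L"
  by (simp add: smooth_on_def Ck_on_linear)

lemma smooth_on_ident: "open S \<Longrightarrow> smooth_on S (\<lambda>x. x)"
  by (simp add: smooth_on_linear bounded_linear_ident)

lemma smooth_on_add: "open S \<Longrightarrow> smooth_on S f \<Longrightarrow> smooth_on S g \<Longrightarrow> smooth_on S (\<lambda>x. f x + g x)"
  by (simp add: smooth_on_def Ck_on_add)

lemma smooth_on_sum: "open S \<Longrightarrow> (\<And>i. i \<in> I \<Longrightarrow> smooth_on S (f i)) \<Longrightarrow> smooth_on S (\<lambda>x. \<Sum>i\<in>I. f i x)"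
  by (simp add: smooth_on_def Ck_on_sum)

lemma smooth_on_Pair: "open S \<Longrightarrow> smooth_on S f \<Longrightarrow> smooth_on S g \<Longrightarrow> smooth_on S (\<lambda>x. (f x, g x))"
  by (simp add: smooth_on_def Ck_on_Pair)

lemma smooth_on_compose:
  fixes f :: "'a::real_normed_vector \<Rightarrow> 'b::euclidean_space" and g :: "'b \<Rightarrow> 'c::real_normed_vector"
  assumes "open S" "open T" "\<And>x. x \<in> S \<Longrightarrow> f x \<in> T" "smooth_on S f" "smooth_on T g"
  shows "smooth_on S (\<lambda>x. g (f x))"
  using assms unfolding smooth_on_def by (blast intro: Ck_on_compose)

lemma smooth_on_has_derivative:
  "smooth_on S f \<Longrightarrow> x \<in> S \<Longrightarrow> (f has_derivative frechet_derivative f (at x)) (at x)"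
  using Ck_on.simps(2)[of 0 f S] unfolding smooth_on_def by (auto simp: frechet_derivative_works)

lemma smooth_on_continuous_on: "smooth_on S f \<Longrightarrow> continuous_on S f"
  using Ck_on.simps(1) unfolding smooth_on_def by blast

lemma smooth_on_frechet_derivative: "smooth_on S f \<Longrightarrow> smooth_on S (\<lambda>x. frechet_derivative f (at x) v)"
  unfolding smooth_on_def using Ck_on.simps(2) by blast

lemma frechet_derivative_eqI: "(f has_derivative D) (at x) \<Longrightarrow> frechet_derivative f (at x) = D"
  using frechet_derivative_at by metis

section \<open>Smooth and holomorphic maps into a complex Lie group\<close>

text \<open>Smoothness together with the Cauchy--Riemann equations in every chart of the target. \<open>J\<close> is
  multiplication by the imaginary unit on the source: \<open>J_vec\<close> on coordinate space and \<open>(*) \<i>\<close> on the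
  complex plane.\<close>

definition holomorphic_map_into ::
    "('g, 'n::finite) lie_data \<Rightarrow> ('a \<Rightarrow> 'a) \<Rightarrow> 'a::real_normed_vector set \<Rightarrow> ('a \<Rightarrow> 'g) \<Rightarrow> bool" where
  "holomorphic_map_into G J S F \<longleftrightarrow> smooth_into G S F \<and>
     (\<forall>(V, \<psi>)\<in>lie_atlas G. \<forall>x\<in>S. F x \<in> V \<longrightarrow> (\<forall>v.
        frechet_derivative (\<lambda>y. \<psi> (F y)) (at x) (J v)
          = J_vec (frechet_derivative (\<lambda>y. \<psi> (F y)) (at x) v)))"

locale lie_grp =
  fixes G :: "('g, 'n::finite) lie_data" (structure)
  assumes complex_lie_group: "complex_lie_group G"

sublocale lie_grp \<subseteq> group G
  using complex_lie_group by (simp add: complex_lie_group_def)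

context lie_grp
begin

lemma complex_manifold: "complex_manifold G"
  using complex_lie_group by (simp add: complex_lie_group_def)

lemma topspace_eq: "topspace (lie_top G) = carrier G"
  using complex_manifold by (simp add: complex_manifold_def)

lemma chart:
  assumes "(V, \<psi>) \<in> lie_atlas G"
  shows chart_openin: "openin (lie_top G) V"
    and chart_open_image: "open (\<psi> ` V)"
    and chart_homeomorphic: "homeomorphic_map (subtopology (lie_top G) V) (top_of_set (\<psi> ` V)) \<psi>"
    and chart_carrier: "V \<subseteq> carrier G"
    and chart_inj: "inj_on \<psi> V"
proof -
  show V: "openin (lie_top G) V" and "open (\<psi> ` V)"
    and h: "homeomorphic_map (subtopology (lie_top G) V) (top_of_set (\<psi> ` V)) \<psi>"
    using complex_manifold assms by (auto simp: complex_manifold_def)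
  show c: "V \<subseteq> carrier G"
    using V openin_subset topspace_eq by blast
  show "inj_on \<psi> V"
    using homeomorphic_imp_injective_map[OF h] c by (simp add: topspace_eq Int_absorb1)
qed

lemma chart_inv_into [simp]:
  "(V, \<psi>) \<in> lie_atlas G \<Longrightarrow> g \<in> V \<Longrightarrow> inv_into V \<psi> (\<psi> g) = g"
  by (simp add: chart_inj)

lemma chart_exists:
  assumes "g \<in> carrier G"
  obtains V \<psi> where "(V, \<psi>) \<in> lie_atlas G" "g \<in> V"
  using complex_manifold assms unfolding complex_manifold_def by blast

lemma chart_image_open:
  assumes "(V, \<psi>) \<in> lie_atlas G" "openin (lie_top G) W" "W \<subseteq> V"
  shows "open (\<psi> ` W)"
proof -
  have "openin (subtopology (lie_top G) V) W"
    using assms by (auto simp: openin_subtopology)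
  then have "openin (top_of_set (\<psi> ` V)) (\<psi> ` W)"
    using chart_homeomorphic[OF assms(1)] homeomorphic_imp_open_map open_map_def by blast
  then show ?thesis
    using chart_open_image[OF assms(1)] openin_open_trans by blast
qed

lemma smooth_into_carrier: "smooth_into G S F \<Longrightarrow> x \<in> S \<Longrightarrow> F x \<in> carrier G"
  unfolding smooth_into_def continuous_map_def by (auto simp: topspace_eq)

lemma smooth_into_open_preimage:
  assumes "smooth_into G S F" "open S" "openin (lie_top G) V"
  shows "open {x\<in>S. F x \<in> V}"
proof -
  have "openin (top_of_set S) {x \<in> topspace (top_of_set S). F x \<in> V}"
    using assms by (intro openin_continuous_map_preimage) (auto simp: smooth_into_def)
  then show ?thesis using assms(2) by (simp add: openin_open_trans)
qed

lemma smooth_into_chart: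
  "smooth_into G S F \<Longrightarrow> (V, \<psi>) \<in> lie_atlas G \<Longrightarrow> smooth_on {x\<in>S. F x \<in> V} (\<lambda>x. \<psi> (F x))"
  unfolding smooth_into_def by blast

lemma transition_smooth:
  assumes "(V, \<psi>) \<in> lie_atlas G" "(V', \<psi>') \<in> lie_atlas G"
  shows "smooth_on (\<psi> ` (V \<inter> V')) (\<lambda>z. \<psi>' (inv_into V \<psi> z))"
    and "z \<in> \<psi> ` (V \<inter> V') \<Longrightarrow> frechet_derivative (\<lambda>z. \<psi>' (inv_into V \<psi> z)) (at z) (J_vec v)
       = J_vec (frechet_derivative (\<lambda>z. \<psi>' (inv_into V \<psi> z)) (at z) v)"
proof -
  have "\<forall>c\<in>lie_atlas G. \<forall>d\<in>lie_atlas G. holomorphic_wrt J_vec J_vec (snd c ` (fst c \<inter> fst d))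
      (\<lambda>z. snd d (inv_into (fst c) (snd c) z))"
    using complex_manifold unfolding complex_manifold_def case_prod_unfold by (elim conjE)
  from bspec[OF bspec[OF this assms(1)] assms(2)]
  have h: "holomorphic_wrt J_vec J_vec (\<psi> ` (V \<inter> V')) (\<lambda>z. \<psi>' (inv_into V \<psi> z))"
    by simp
  show "smooth_on (\<psi> ` (V \<inter> V')) (\<lambda>z. \<psi>' (inv_into V \<psi> z))"
    using h unfolding holomorphic_wrt_def by (elim conjE)
  show "frechet_derivative (\<lambda>z. \<psi>' (inv_into V \<psi> z)) (at z) (J_vec v)
       = J_vec (frechet_derivative (\<lambda>z. \<psi>' (inv_into V \<psi> z)) (at z) v)"
    if "z \<in> \<psi> ` (V \<inter> V')"
    using h that unfolding holomorphic_wrt_def by blast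
qed

text \<open>One chart around each value is enough, because the transition maps are smooth.\<close>

lemma smooth_intoI_local:
  assumes S: "open S"
    and loc: "\<And>x. x \<in> S \<Longrightarrow> \<exists>V \<psi> T. (V, \<psi>) \<in> lie_atlas G \<and> open T \<and> x \<in> T \<and> T \<subseteq> S \<and> F ` T \<subseteq> V
              \<and> smooth_on T (\<lambda>y. \<psi> (F y))"
  shows "smooth_into G S F"
proof -
  have op: "open {x\<in>S. F x \<in> Y}" if Y: "openin (lie_top G) Y" for Y
  proof (subst open_subopen, safe)
    fix x assume x: "x \<in> S" "F x \<in> Y"
    obtain V \<psi> T where T: "(V, \<psi>) \<in> lie_atlas G" "open T" "x \<in> T" "T \<subseteq> S" "F ` T \<subseteq> V"
      "smooth_on T (\<lambda>y. \<psi> (F y))" using loc[OF x(1)] by (elim exE conjE)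
    have "open (\<psi> ` (V \<inter> Y))"
      using chart_image_open[OF T(1)] Y chart_openin[OF T(1)] by blast
    then have "open (T \<inter> (\<lambda>y. \<psi> (F y)) -` (\<psi> ` (V \<inter> Y)))"
      using continuous_open_preimage[OF smooth_on_continuous_on[OF T(6)] T(2)] by blast
    moreover have "T \<inter> (\<lambda>y. \<psi> (F y)) -` (\<psi> ` (V \<inter> Y)) \<subseteq> {x\<in>S. F x \<in> Y}"
      using T(4,5) chart_inj[OF T(1)] by (auto simp: inj_on_def)
    moreover have "x \<in> T \<inter> (\<lambda>y. \<psi> (F y)) -` (\<psi> ` (V \<inter> Y))"
      using x T(3,5) by auto
    ultimately show "\<exists>T. open T \<and> x \<in> T \<and> T \<subseteq> {x\<in>S. F x \<in> Y}"
      by (intro exI conjI)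
  qed
  have car: "F x \<in> carrier G" if "x \<in> S" for x
  proof -
    from loc[OF that] obtain V \<psi> T where "(V, \<psi>) \<in> lie_atlas G" "x \<in> T" "F ` T \<subseteq> V" by (elim exE conjE)
    then show ?thesis using chart_carrier[of V \<psi>] by auto
  qed
  have "continuous_map (top_of_set S) (lie_top G) F"
    unfolding continuous_map_def using car op S
    by (auto simp: topspace_eq openin_open_eq)
  moreover have "smooth_on {x\<in>S. F x \<in> V'} (\<lambda>x. \<psi>' (F x))" if V': "(V', \<psi>') \<in> lie_atlas G" for V' \<psi>'
  proof (rule smooth_on_local, safe)
    fix x assume x: "x \<in> S" "F x \<in> V'"
    obtain V \<psi> T where T: "(V, \<psi>) \<in> lie_atlas G" "open T" "x \<in> T" "T \<subseteq> S" "F ` T \<subseteq> V"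
      "smooth_on T (\<lambda>y. \<psi> (F y))" using loc[OF x(1)] by (elim exE conjE)
    define T' where "T' = T \<inter> {x\<in>S. F x \<in> V'}"
    have T': "open T'" unfolding T'_def using T(2) op chart_openin[OF V'] by blast
    have "openin (lie_top G) (V \<inter> V')" using chart_openin[OF V'] chart_openin[OF T(1)] by blast
    then have "open (\<psi> ` (V \<inter> V'))" using chart_image_open[OF T(1)] by blast
    from smooth_on_compose[OF T' this _ smooth_on_subset[OF T(6)] transition_smooth(1)[OF T(1) V']]
    have "smooth_on T' (\<lambda>y. \<psi>' (inv_into V \<psi> (\<psi> (F y))))"
      using T(5) unfolding T'_def by blast
    then have "smooth_on T' (\<lambda>y. \<psi>' (F y))"
      by (rule smooth_on_cong_open[OF T', rotated]) (use T in \<open>auto simp: T'_def image_subset_iff\<close>)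
    then show "\<exists>T. open T \<and> x \<in> T \<and> smooth_on T (\<lambda>x. \<psi>' (F x))"
      using T' x T(3) unfolding T'_def by blast
  qed
  ultimately show ?thesis unfolding smooth_into_def by blast
qed

lemma smooth_into_compose:
  fixes f :: "'a::real_normed_vector \<Rightarrow> 'b::euclidean_space"
  assumes "smooth_into G T F" "open S" "open T" "smooth_on S f" "f ` S \<subseteq> T"
  shows "smooth_into G S (\<lambda>x. F (f x))"
proof (rule smooth_intoI_local[OF assms(2)])
  fix x assume x: "x \<in> S"
  obtain V \<psi> where V: "(V, \<psi>) \<in> lie_atlas G" "F (f x) \<in> V"
    using chart_exists smooth_into_carrier[OF assms(1)] x assms(5) by (metis image_subset_iff)
  define T' where "T' = {y\<in>T. F y \<in> V}"
  have T': "open T'" unfolding T'_def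
    using assms smooth_into_open_preimage[OF _ _ chart_openin] V by blast
  have o: "open (S \<inter> f -` T')"
    using continuous_open_preimage[OF smooth_on_continuous_on[OF assms(4)] assms(2) T'] .
  have "smooth_on (S \<inter> f -` T') (\<lambda>x. \<psi> (F (f x)))"
    using smooth_into_chart[OF assms(1) V(1)]
    by (intro smooth_on_compose[OF o T' _ smooth_on_subset[OF assms(4)]]) (auto simp: T'_def)
  then show "\<exists>V \<psi> U. (V, \<psi>) \<in> lie_atlas G \<and> open U \<and> x \<in> U \<and> U \<subseteq> S \<and> (\<lambda>x. F (f x)) ` U \<subseteq> V
              \<and> smooth_on U (\<lambda>y. \<psi> (F (f y)))"
    using V x assms(5) o
    by (intro exI[of _ V] exI[of _ \<psi>] exI[of _ "S \<inter> f -` T'"]) (auto simp: T'_def)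
qed

lemma smooth_into_const:
  assumes "c \<in> carrier G" "open S"
  shows "smooth_into G S (\<lambda>_. c)"
proof (rule smooth_intoI_local[OF assms(2)])
  fix x assume "x \<in> S"
  obtain V \<psi> where V: "(V, \<psi>) \<in> lie_atlas G" "c \<in> V"
    using chart_exists[OF assms(1)] by blast
  then show "\<exists>V \<psi> U. (V, \<psi>) \<in> lie_atlas G \<and> open U \<and> x \<in> U \<and> U \<subseteq> S \<and> (\<lambda>x. c) ` U \<subseteq> V
              \<and> smooth_on U (\<lambda>y. \<psi> c)"
    using assms \<open>x \<in> S\<close> smooth_on_const by blast
qed

lemma smooth_into_inv_chart:
  assumes "(V, \<psi>) \<in> lie_atlas G"
  shows "smooth_into G (\<psi> ` V) (inv_into V \<psi>)"
proof (rule smooth_intoI_local[OF chart_open_image[OF assms]])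
  fix x assume x: "x \<in> \<psi> ` V"
  have "smooth_on (\<psi> ` V) (\<lambda>y. \<psi> (inv_into V \<psi> y))"
    by (rule smooth_on_cong_open[OF chart_open_image[OF assms] _ smooth_on_ident[OF chart_open_image[OF assms]]])
       (simp add: f_inv_into_f)
  then show "\<exists>V' \<psi>' T. (V', \<psi>') \<in> lie_atlas G \<and> open T \<and> x \<in> T \<and> T \<subseteq> \<psi> ` V \<and> inv_into V \<psi> ` T \<subseteq> V'
              \<and> smooth_on T (\<lambda>y. \<psi>' (inv_into V \<psi> y))"
    using assms x chart_open_image[OF assms] chart_inj[OF assms]
    by (intro exI[of _ V] exI[of _ \<psi>] exI[of _ "\<psi> ` V"]) auto
qed

text \<open>Multiplication in charts. Its domain is open by continuity, which is what the chain rule needs.\<close>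

lemma chart_mult:
  assumes A: "(V1, \<psi>1) \<in> lie_atlas G" "(V2, \<psi>2) \<in> lie_atlas G" "(V3, \<psi>3) \<in> lie_atlas G"
  defines "\<Omega> \<equiv> {(\<psi>1 x, \<psi>2 y) | x y. x \<in> V1 \<and> y \<in> V2 \<and> x \<otimes> y \<in> V3}"
  shows chart_mult_open: "open \<Omega>"
    and chart_mult_holomorphic: "holomorphic_wrt (map_prod J_vec J_vec) J_vec \<Omega>
          (\<lambda>(p, q). \<psi>3 (inv_into V1 \<psi>1 p \<otimes> inv_into V2 \<psi>2 q))"
proof -
  show "holomorphic_wrt (map_prod J_vec J_vec) J_vec \<Omega>
          (\<lambda>(p, q). \<psi>3 (inv_into V1 \<psi>1 p \<otimes> inv_into V2 \<psi>2 q))"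
  proof -
    have "\<forall>b\<in>lie_atlas G. \<forall>c\<in>lie_atlas G. \<forall>d\<in>lie_atlas G.
        holomorphic_wrt (map_prod J_vec J_vec) J_vec
          {(snd b x, snd c y) | x y. x \<in> fst b \<and> y \<in> fst c \<and> x \<otimes> y \<in> fst d}
          (\<lambda>z. snd d (inv_into (fst b) (snd b) (fst z) \<otimes> inv_into (fst c) (snd c) (snd z)))"
      using complex_lie_group unfolding complex_lie_group_def case_prod_unfold by (elim conjE)
    from bspec[OF bspec[OF bspec[OF this A(1)] A(2)] A(3)]
    show ?thesis by (simp add: \<Omega>_def case_prod_unfold)
  qed
  define S where "S = \<psi>1 ` V1 \<times> \<psi>2 ` V2"
  have S: "open S" unfolding S_def by (intro open_Times chart_open_image A)
  have c: "continuous_map (top_of_set (\<psi> ` V)) (lie_top G) (inv_into V \<psi>)" if "(V, \<psi>) \<in> lie_atlas G" for V \<psi>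
    using smooth_into_inv_chart[OF that] by (simp add: smooth_into_def)
  have "continuous_map (top_of_set S) (top_of_set (\<psi>1 ` V1)) fst"
    "continuous_map (top_of_set S) (top_of_set (\<psi>2 ` V2)) snd"
    by (auto simp: S_def intro!: continuous_intros)
  from continuous_map_compose[OF this(1) c[OF A(1)]] continuous_map_compose[OF this(2) c[OF A(2)]]
  have "continuous_map (top_of_set S) (prod_topology (lie_top G) (lie_top G))
        (\<lambda>z. (inv_into V1 \<psi>1 (fst z), inv_into V2 \<psi>2 (snd z)))"
    by (simp add: continuous_map_paired o_def)
  moreover have "continuous_map (prod_topology (lie_top G) (lie_top G)) (lie_top G) (\<lambda>(x, y). x \<otimes> y)"
    using complex_lie_group by (simp add: complex_lie_group_def)
  ultimately have "continuous_map (top_of_set S) (lie_top G)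
        ((\<lambda>(x, y). x \<otimes> y) \<circ> (\<lambda>z. (inv_into V1 \<psi>1 (fst z), inv_into V2 \<psi>2 (snd z))))"
    by (rule continuous_map_compose)
  then have "continuous_map (top_of_set S) (lie_top G)
        (\<lambda>z. inv_into V1 \<psi>1 (fst z) \<otimes> inv_into V2 \<psi>2 (snd z))"
    by (simp add: o_def)
  from openin_continuous_map_preimage[OF this chart_openin[OF A(3)]]
  have "openin (top_of_set S) {z\<in>S. inv_into V1 \<psi>1 (fst z) \<otimes> inv_into V2 \<psi>2 (snd z) \<in> V3}"
    by simp
  moreover have "{z\<in>S. inv_into V1 \<psi>1 (fst z) \<otimes> inv_into V2 \<psi>2 (snd z) \<in> V3} = \<Omega>"
    unfolding S_def \<Omega>_def using A by (force simp: chart_inj)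
  ultimately show "open \<Omega>" using S openin_open_trans by metis
qed

text \<open>The chain rule for a product read in charts. The formula for the derivative also carries the
  Cauchy--Riemann equations from the factors to the product.\<close>

lemma smooth_into_mult_aux:
  assumes S: "open S" and F: "smooth_into G S F" and H: "smooth_into G S H" and x: "x \<in> S"
    and A: "(V1, \<psi>1) \<in> lie_atlas G" "(V2, \<psi>2) \<in> lie_atlas G" "(V3, \<psi>3) \<in> lie_atlas G"
    and xV: "F x \<in> V1" "H x \<in> V2" "F x \<otimes> H x \<in> V3"
  defines "M \<equiv> \<lambda>z. \<psi>3 (inv_into V1 \<psi>1 (fst z) \<otimes> inv_into V2 \<psi>2 (snd z))"
  obtains T where "open T" "x \<in> T" "T \<subseteq> S" "(\<lambda>y. F y \<otimes> H y) ` T \<subseteq> V3"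
    "smooth_on T (\<lambda>y. \<psi>3 (F y \<otimes> H y))"
    "frechet_derivative (\<lambda>y. \<psi>3 (F y \<otimes> H y)) (at x) v =
       frechet_derivative M (at (\<psi>1 (F x), \<psi>2 (H x)))
         (frechet_derivative (\<lambda>y. \<psi>1 (F y)) (at x) v, frechet_derivative (\<lambda>y. \<psi>2 (H y)) (at x) v)"
proof -
  let ?\<Omega> = "{(\<psi>1 x, \<psi>2 y) | x y. x \<in> V1 \<and> y \<in> V2 \<and> x \<otimes> y \<in> V3}"
  define P where "P y = (\<psi>1 (F y), \<psi>2 (H y))" for y
  define T0 where "T0 = {y\<in>S. F y \<in> V1} \<inter> {y\<in>S. H y \<in> V2}"
  have T0: "open T0" unfolding T0_def
    using smooth_into_open_preimage[OF F S chart_openin[OF A(1)]]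
      smooth_into_open_preimage[OF H S chart_openin[OF A(2)]] by blast
  have s1: "smooth_on T0 (\<lambda>y. \<psi>1 (F y))" and s2: "smooth_on T0 (\<lambda>y. \<psi>2 (H y))"
    unfolding T0_def using smooth_on_subset[OF smooth_into_chart[OF F A(1)]]
      smooth_on_subset[OF smooth_into_chart[OF H A(2)]] by auto
  have P: "smooth_on T0 P" unfolding P_def by (rule smooth_on_Pair[OF T0 s1 s2])
  define T where "T = T0 \<inter> P -` ?\<Omega>"
  have T: "open T" unfolding T_def
    using continuous_open_preimage[OF smooth_on_continuous_on[OF P] T0 chart_mult_open[OF A]] .
  have PT: "smooth_on T P" by (rule smooth_on_subset[OF P]) (auto simp: T_def)
  have M: "smooth_on ?\<Omega> M"
    using chart_mult_holomorphic[OF A] by (simp add: M_def holomorphic_wrt_def case_prod_unfold)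
  have xT: "x \<in> T" using x xV unfolding T_def T0_def P_def by auto
  have eq: "M (P y) = \<psi>3 (F y \<otimes> H y)" if "y \<in> T" for y
    using that A unfolding M_def P_def T_def T0_def by simp
  have sub: "T \<subseteq> S" unfolding T_def T0_def by blast
  have V3: "(\<lambda>y. F y \<otimes> H y) ` T \<subseteq> V3"
    using chart_inj[OF A(1)] chart_inj[OF A(2)] unfolding T_def P_def T0_def
    by (auto simp: inj_on_def)
  have MP: "smooth_on T (\<lambda>y. M (P y))"
    by (rule smooth_on_compose[OF T chart_mult_open[OF A] _ PT M]) (auto simp: T_def)
  have sm: "smooth_on T (\<lambda>y. \<psi>3 (F y \<otimes> H y))"
    by (rule smooth_on_cong_open[OF T _ MP]) (simp add: eq)
  have xO: "P x \<in> ?\<Omega>" using xT by (simp add: T_def)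
  have d: "((\<lambda>y. M (P y)) has_derivative (\<lambda>v. frechet_derivative M (at (P x)) (frechet_derivative P (at x) v))) (at x)"
    by (rule has_derivative_compose[OF smooth_on_has_derivative[OF PT xT] smooth_on_has_derivative[OF M xO]])
  have "x \<in> T0" using xT by (simp add: T_def)
  from has_derivative_Pair[OF smooth_on_has_derivative[OF s1 this] smooth_on_has_derivative[OF s2 this]]
  have dP: "frechet_derivative P (at x) = (\<lambda>v. (frechet_derivative (\<lambda>y. \<psi>1 (F y)) (at x) v, frechet_derivative (\<lambda>y. \<psi>2 (H y)) (at x) v))"
    unfolding P_def by (rule frechet_derivative_eqI)
  have "((\<lambda>y. \<psi>3 (F y \<otimes> H y)) has_derivative (\<lambda>v. frechet_derivative M (at (P x)) (frechet_derivative P (at x) v))) (at x)"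
    by (rule has_derivative_transform_within_open[OF d T xT]) (simp add: eq)
  from frechet_derivative_eqI[OF this] dP
  have "frechet_derivative (\<lambda>y. \<psi>3 (F y \<otimes> H y)) (at x) v =
       frechet_derivative M (at (\<psi>1 (F x), \<psi>2 (H x)))
         (frechet_derivative (\<lambda>y. \<psi>1 (F y)) (at x) v, frechet_derivative (\<lambda>y. \<psi>2 (H y)) (at x) v)"
    by (simp add: P_def)
  then show ?thesis using that T xT sub V3 sm by blast
qed

lemma smooth_into_mult:
  assumes "open S" "smooth_into G S F" "smooth_into G S H"
  shows "smooth_into G S (\<lambda>y. F y \<otimes> H y)"
proof (rule smooth_intoI_local[OF assms(1)])
  fix x assume x: "x \<in> S"
  have c: "F x \<in> carrier G" "H x \<in> carrier G"
    using smooth_into_carrier[OF assms(2) x] smooth_into_carrier[OF assms(3) x] .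
  obtain V1 \<psi>1 where 1: "(V1, \<psi>1) \<in> lie_atlas G" "F x \<in> V1" using chart_exists[OF c(1)] .
  obtain V2 \<psi>2 where 2: "(V2, \<psi>2) \<in> lie_atlas G" "H x \<in> V2" using chart_exists[OF c(2)] .
  obtain V3 \<psi>3 where 3: "(V3, \<psi>3) \<in> lie_atlas G" "F x \<otimes> H x \<in> V3"
    using chart_exists[OF m_closed[OF c]] .
  obtain T where "open T" "x \<in> T" "T \<subseteq> S" "(\<lambda>y. F y \<otimes> H y) ` T \<subseteq> V3"
    "smooth_on T (\<lambda>y. \<psi>3 (F y \<otimes> H y))"
    using smooth_into_mult_aux[OF assms x 1(1) 2(1) 3(1) 1(2) 2(2) 3(2)] .
  then show "\<exists>V \<psi> T. (V, \<psi>) \<in> lie_atlas G \<and> open T \<and> x \<in> T \<and> T \<subseteq> S \<and> (\<lambda>y. F y \<otimes> H y) ` T \<subseteq> V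
              \<and> smooth_on T (\<lambda>y. \<psi> (F y \<otimes> H y))"
    using 3(1) by (intro exI conjI)
qed

lemma holomorphic_map_into_mult:
  assumes "open S" "holomorphic_map_into G J S F" "holomorphic_map_into G J S H"
  shows "holomorphic_map_into G J S (\<lambda>y. F y \<otimes> H y)"
  unfolding holomorphic_map_into_def
proof (safe)
  have F: "smooth_into G S F" and H: "smooth_into G S H"
    using assms by (simp_all add: holomorphic_map_into_def)
  show "smooth_into G S (\<lambda>y. F y \<otimes> H y)" by (rule smooth_into_mult[OF assms(1) F H])
  fix V3 \<psi>3 x v assume A3: "(V3, \<psi>3) \<in> lie_atlas G" and x: "x \<in> S" and x3: "F x \<otimes> H x \<in> V3"
  obtain V1 \<psi>1 where A1: "(V1, \<psi>1) \<in> lie_atlas G" "F x \<in> V1"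
    using chart_exists[OF smooth_into_carrier[OF F x]] .
  obtain V2 \<psi>2 where A2: "(V2, \<psi>2) \<in> lie_atlas G" "H x \<in> V2"
    using chart_exists[OF smooth_into_carrier[OF H x]] .
  note A = A1(1) A2(1) A1(2) A2(2)
  let ?\<Omega> = "{(\<psi>1 x, \<psi>2 y) | x y. x \<in> V1 \<and> y \<in> V2 \<and> x \<otimes> y \<in> V3}"
  have "(\<psi>1 (F x), \<psi>2 (H x)) \<in> ?\<Omega>" using A x3 by blast
  then have M: "frechet_derivative (\<lambda>z. \<psi>3 (inv_into V1 \<psi>1 (fst z) \<otimes> inv_into V2 \<psi>2 (snd z))) (at (\<psi>1 (F x), \<psi>2 (H x))) (map_prod J_vec J_vec w)
     = J_vec (frechet_derivative (\<lambda>z. \<psi>3 (inv_into V1 \<psi>1 (fst z) \<otimes> inv_into V2 \<psi>2 (snd z))) (at (\<psi>1 (F x), \<psi>2 (H x))) w)" for w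
    using chart_mult_holomorphic[OF A(1,2) A3] unfolding holomorphic_wrt_def case_prod_unfold
    by (elim conjE) blast
  have D: "frechet_derivative (\<lambda>y. \<psi>3 (F y \<otimes> H y)) (at x) v =
       frechet_derivative (\<lambda>z. \<psi>3 (inv_into V1 \<psi>1 (fst z) \<otimes> inv_into V2 \<psi>2 (snd z))) (at (\<psi>1 (F x), \<psi>2 (H x)))
         (frechet_derivative (\<lambda>y. \<psi>1 (F y)) (at x) v, frechet_derivative (\<lambda>y. \<psi>2 (H y)) (at x) v)" for v
    by (rule smooth_into_mult_aux[OF assms(1) F H x A(1,2) A3 A(3,4) x3, of v])
  have J1: "frechet_derivative (\<lambda>y. \<psi>1 (F y)) (at x) (J v) = J_vec (frechet_derivative (\<lambda>y. \<psi>1 (F y)) (at x) v)"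
    and J2: "frechet_derivative (\<lambda>y. \<psi>2 (H y)) (at x) (J v) = J_vec (frechet_derivative (\<lambda>y. \<psi>2 (H y)) (at x) v)"
    using assms(2,3) A x unfolding holomorphic_map_into_def by blast+
  show "frechet_derivative (\<lambda>y. \<psi>3 (F y \<otimes> H y)) (at x) (J v)
          = J_vec (frechet_derivative (\<lambda>y. \<psi>3 (F y \<otimes> H y)) (at x) v)"
    unfolding D J1 J2 M[symmetric] by simp
qed

lemma holomorphic_map_into_const:
  assumes "c \<in> carrier G" "open S"
  shows "holomorphic_map_into G J S (\<lambda>_. c)"
proof -
  have "J_vec (0 :: complex^'n) = 0" by (simp add: vec_eq_iff)
  then show ?thesis
    unfolding holomorphic_map_into_def case_prod_unfold frechet_derivative_const
    using smooth_into_const[OF assms] by presburger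
qed

lemma holomorphic_map_into_inv_chart:
  assumes "(V, \<psi>) \<in> lie_atlas G"
  shows "holomorphic_map_into G J_vec (\<psi> ` V) (inv_into V \<psi>)"
  unfolding holomorphic_map_into_def
proof (safe)
  show "smooth_into G (\<psi> ` V) (inv_into V \<psi>)" by (rule smooth_into_inv_chart[OF assms])
  fix V' \<psi>' x v assume a: "(V', \<psi>') \<in> lie_atlas G" "inv_into V \<psi> (\<psi> x) \<in> V'" "x \<in> V"
  then show "frechet_derivative (\<lambda>y. \<psi>' (inv_into V \<psi> y)) (at (\<psi> x)) (J_vec v) =
       J_vec (frechet_derivative (\<lambda>y. \<psi>' (inv_into V \<psi> y)) (at (\<psi> x)) v)"
    using assms by (intro transition_smooth(2)) auto
qed

lemma smooth_into_self_map:
  assumes "smooth_self_map G \<theta>" and S: "open S" and F: "smooth_into G S F"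
  shows "smooth_into G S (\<lambda>y. \<theta> (F y))"
proof (rule smooth_intoI_local[OF S])
  fix x assume x: "x \<in> S"
  have c: "continuous_map (lie_top G) (lie_top G) \<theta>"
    using assms by (simp add: smooth_self_map_def)
  have "F x \<in> carrier G" using smooth_into_carrier F x by blast
  moreover from this have "\<theta> (F x) \<in> carrier G"
    using c by (auto simp: continuous_map_def topspace_eq)
  ultimately obtain V1 \<psi>1 V2 \<psi>2 where A: "(V1, \<psi>1) \<in> lie_atlas G" "(V2, \<psi>2) \<in> lie_atlas G" 
      "F x \<in> V1" "\<theta> (F x) \<in> V2"
    by (elim chart_exists)
  have W: "openin (lie_top G) {y\<in>carrier G. \<theta> y \<in> V2}"
    using openin_continuous_map_preimage[OF c chart_openin[OF A(2)]] by (simp add: topspace_eq)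
  have "{y\<in>V1. \<theta> y \<in> V2} = V1 \<inter> {y\<in>carrier G. \<theta> y \<in> V2}"
    using chart_carrier[OF A(1)] by blast
  then have W1: "openin (lie_top G) {y\<in>V1. \<theta> y \<in> V2}"
    using W chart_openin[OF A(1)] by (metis openin_Int)
  then have o: "open (\<psi>1 ` {y\<in>V1. \<theta> y \<in> V2})"
    using chart_image_open[OF A(1)] by blast
  have h: "smooth_on (\<psi>1 ` {y\<in>V1. \<theta> y \<in> V2}) (\<lambda>p. \<psi>2 (\<theta> (inv_into V1 \<psi>1 p)))"
  proof -
    have "\<forall>b\<in>lie_atlas G. \<forall>c\<in>lie_atlas G.
        smooth_on (snd b ` {x\<in>fst b. \<theta> x \<in> fst c}) (\<lambda>p. snd c (\<theta> (inv_into (fst b) (snd b) p)))"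
      using assms(1) unfolding smooth_self_map_def case_prod_unfold by (elim conjE)
    from bspec[OF bspec[OF this A(1)] A(2)]
    show ?thesis by simp
  qed
  define T where "T = {y\<in>S. F y \<in> {y\<in>V1. \<theta> y \<in> V2}}"
  have T: "open T" unfolding T_def using smooth_into_open_preimage[OF F S W1] .
  have "smooth_on T (\<lambda>y. \<psi>2 (\<theta> (inv_into V1 \<psi>1 (\<psi>1 (F y)))))"
    by (rule smooth_on_compose[OF T o _ smooth_on_subset[OF smooth_into_chart[OF F A(1)]] h]) (auto simp: T_def)
  then have "smooth_on T (\<lambda>y. \<psi>2 (\<theta> (F y)))"
    by (rule smooth_on_cong_open[OF T, rotated]) (use A in \<open>auto simp: T_def\<close>)
  then show "\<exists>V \<psi> T. (V, \<psi>) \<in> lie_atlas G \<and> open T \<and> x \<in> T \<and> T \<subseteq> S \<and> (\<lambda>y. \<theta> (F y)) ` T \<subseteq> V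
              \<and> smooth_on T (\<lambda>y. \<psi> (\<theta> (F y)))"
    using T A x by (intro exI[of _ V2] exI[of _ \<psi>2] exI[of _ T]) (auto simp: T_def)
qed

lemma smooth_into_inv:
  assumes "open S" "smooth_into G S F"
  shows "smooth_into G S (\<lambda>y. inv F y)"
proof (rule smooth_into_self_map[OF _ assms])
  have "smooth_on (\<psi> ` {x\<in>V. inv x \<in> V'}) (\<lambda>p. \<psi>' (inv (inv_into V \<psi> p)))"
    if "(V, \<psi>) \<in> lie_atlas G" "(V', \<psi>') \<in> lie_atlas G" for V \<psi> V' \<psi>'
  proof -
    have "\<forall>b\<in>lie_atlas G. \<forall>c\<in>lie_atlas G.
        holomorphic_wrt J_vec J_vec (snd b ` {x\<in>fst b. inv x \<in> fst c})
          (\<lambda>p. snd c (inv (inv_into (fst b) (snd b) p)))"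
      using complex_lie_group unfolding complex_lie_group_def case_prod_unfold by (elim conjE)
    from bspec[OF bspec[OF this that(1)] that(2)] show ?thesis by (simp add: holomorphic_wrt_def)
  qed
  moreover have "continuous_map (lie_top G) (lie_top G) (\<lambda>x. inv x)"
    using complex_lie_group by (simp add: complex_lie_group_def)
  ultimately show "smooth_self_map G (\<lambda>x. inv x)"
    unfolding smooth_self_map_def by blast
qed

end

section \<open>Logarithmic derivatives and the adjoint representation\<close>

text \<open>\<open>D\<close> is the pullback by \<open>F\<close> of the left invariant Maurer--Cartan form at \<open>x\<close>, usually written
  \<open>F\<^sup>-\<^sup>1 dF\<close>: the derivative of the increment \<open>F(x)\<^sup>-\<^sup>1 F(y)\<close> in the chart at the identity. The increment
  has to stay in that chart for \<open>y\<close> close to \<open>x\<close>, where alone its coordinates mean something.\<close>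

definition log_deriv ::
    "('g, 'n::finite) lie_data \<Rightarrow> ('a::real_normed_vector \<Rightarrow> 'g) \<Rightarrow> ('a \<Rightarrow> complex^'n) \<Rightarrow> 'a \<Rightarrow> bool" where
  "log_deriv G F D x \<longleftrightarrow> F x \<in> carrier G \<and>
     (\<forall>\<^sub>F y in nhds x. F y \<in> carrier G \<and> inv\<^bsub>G\<^esub> F x \<otimes>\<^bsub>G\<^esub> F y \<in> fst (chart_at_one G)) \<and>
     ((\<lambda>y. coord G (inv\<^bsub>G\<^esub> F x \<otimes>\<^bsub>G\<^esub> F y)) has_derivative D) (at x)"

lemma has_derivative_transform_nhds:
  assumes "(f has_derivative D) (at x)" "\<forall>\<^sub>F y in nhds x. f y = g y"
  shows "(g has_derivative D) (at x)"
proof (rule has_derivative_transform_eventually[OF assms(1)])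
  show "\<forall>\<^sub>F y in at x. f y = g y" using assms(2) by (simp add: eventually_nhds_conv_at)
  show "f x = g x" using assms(2) by (rule eventually_nhds_x_imp_x)
qed simp

context lie_grp
begin

abbreviation dom_e :: "'g set" where "dom_e \<equiv> fst (chart_at_one G)"
abbreviation coord_e :: "complex^'n" where "coord_e \<equiv> coord G \<one>"
abbreviation img_e :: "(complex^'n) set" where "img_e \<equiv> coord G ` dom_e"

lemma chart_at_one: "(dom_e, coord G) \<in> lie_atlas G" and one_in_dom_e: "\<one> \<in> dom_e"
proof -
  obtain V \<psi> where "(V, \<psi>) \<in> lie_atlas G" "\<one> \<in> V" using chart_exists[OF one_closed] .
  then have "\<exists>c. c \<in> lie_atlas G \<and> \<one> \<in> fst c" by (intro exI[of _ "(V, \<psi>)"]) simp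
  from someI_ex[OF this] show "(dom_e, coord G) \<in> lie_atlas G" "\<one> \<in> dom_e"
    by (simp_all add: chart_at_one_def coord_def)
qed

lemma coord_inv_coord: "g \<in> dom_e \<Longrightarrow> coord_inv G (coord G g) = g"
  unfolding coord_inv_def by (rule chart_inv_into[OF chart_at_one])

lemma coord_coord_inv: "p \<in> img_e \<Longrightarrow> coord G (coord_inv G p) = p"
  unfolding coord_inv_def by (rule f_inv_into_f)

lemma coord_inv_dom_e: "p \<in> img_e \<Longrightarrow> coord_inv G p \<in> dom_e"
  unfolding coord_inv_def by (rule inv_into_into)

lemma dom_e_carrier: "dom_e \<subseteq> carrier G"
  by (rule chart_carrier[OF chart_at_one])

lemma coord_inv_carrier: "p \<in> img_e \<Longrightarrow> coord_inv G p \<in> carrier G"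
  using coord_inv_dom_e dom_e_carrier by blast

lemma coord_inv_coord_e: "coord_inv G coord_e = \<one>"
  by (rule coord_inv_coord[OF one_in_dom_e])

lemma open_img_e: "open img_e"
  by (rule chart_open_image[OF chart_at_one])

lemma coord_e_in: "coord_e \<in> img_e"
  using one_in_dom_e by (rule imageI)

lemma holomorphic_coord_inv: "holomorphic_map_into G J_vec img_e (coord_inv G)"
  using holomorphic_map_into_inv_chart[OF chart_at_one] by (simp add: coord_inv_def)

lemma smooth_into_coord_inv: "smooth_into G img_e (coord_inv G)"
  using holomorphic_coord_inv by (simp add: holomorphic_map_into_def)

lemma smooth_into_dom_e:
  assumes "smooth_into G T K" "open T" "z \<in> T" "K z = \<one>"
  shows "\<forall>\<^sub>F y in nhds z. y \<in> T \<and> K y \<in> dom_e"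
    and "((\<lambda>y. coord G (K y)) has_derivative frechet_derivative (\<lambda>y. coord G (K y)) (at z)) (at z)"
proof -
  have o: "open {y\<in>T. K y \<in> dom_e}"
    by (rule smooth_into_open_preimage[OF assms(1,2) chart_openin[OF chart_at_one]])
  have z: "z \<in> {y\<in>T. K y \<in> dom_e}" using assms one_in_dom_e by simp
  show "\<forall>\<^sub>F y in nhds z. y \<in> T \<and> K y \<in> dom_e"
    using eventually_nhds_in_open[OF o z] by simp
  show "((\<lambda>y. coord G (K y)) has_derivative frechet_derivative (\<lambda>y. coord G (K y)) (at z)) (at z)"
    by (rule smooth_on_has_derivative[OF smooth_into_chart[OF assms(1) chart_at_one] z])
qed

lemma eventually_img_e: "\<forall>\<^sub>F p in nhds coord_e. p \<in> img_e"
  by (rule eventually_nhds_in_open[OF open_img_e coord_e_in])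

text \<open>The derivative at the identity of each member of a smooth family is a partial derivative of the
  whole family, hence smooth in the parameter. Both the smoothness of \<open>Ad\<close> and that of left invariant
  vector fields are instances.\<close>

lemma smooth_fibre_derivative:
  fixes K :: "'a::euclidean_space \<times> (complex^'n) \<Rightarrow> 'g"
  assumes K: "smooth_into G (S \<times> img_e) K" and S: "open S" and dom: "\<And>x. x \<in> S \<Longrightarrow> K (x, coord_e) \<in> dom_e"
  defines "D \<equiv> \<lambda>x. frechet_derivative (\<lambda>q. coord G (K (x, q))) (at coord_e)"
  shows "x \<in> S \<Longrightarrow> ((\<lambda>q. coord G (K (x, q))) has_derivative D x) (at coord_e)"
    and "smooth_on S (\<lambda>x. D x v)"
proof -
  have T: "open (S \<times> img_e)" by (intro open_Times open_img_e S)
  define \<Omega> where "\<Omega> = {z\<in>S \<times> img_e. K z \<in> dom_e}"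
  have \<Omega>: "open \<Omega>" unfolding \<Omega>_def by (rule smooth_into_open_preimage[OF K T chart_openin[OF chart_at_one]])
  have sm: "smooth_on \<Omega> (\<lambda>z. coord G (K z))"
    unfolding \<Omega>_def by (rule smooth_into_chart[OF K chart_at_one])
  have in\<Omega>: "(x, coord_e) \<in> \<Omega>" if "x \<in> S" for x
    using that coord_e_in dom[OF that] by (simp add: \<Omega>_def)
  have der: "((\<lambda>q. coord G (K (x, q))) has_derivative
      (\<lambda>u. frechet_derivative (\<lambda>z. coord G (K z)) (at (x, coord_e)) (0, u))) (at coord_e)" if "x \<in> S" for x
    by (rule has_derivative_compose[where f = "\<lambda>q. (x, q)", OF _ smooth_on_has_derivative[OF sm in\<Omega>[OF that]]])
       (auto intro!: derivative_eq_intros)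
  have D: "D x = (\<lambda>u. frechet_derivative (\<lambda>z. coord G (K z)) (at (x, coord_e)) (0, u))" if "x \<in> S" for x
    unfolding D_def by (rule frechet_derivative_eqI[OF der[OF that]])
  show "x \<in> S \<Longrightarrow> ((\<lambda>q. coord G (K (x, q))) has_derivative D x) (at coord_e)"
    using der D by simp
  have "smooth_on S (\<lambda>x. (x, coord_e))"
    by (intro smooth_on_Pair S smooth_on_ident smooth_on_const)
  then have "smooth_on S (\<lambda>x. frechet_derivative (\<lambda>z. coord G (K z)) (at (x, coord_e)) (0, v))"
    using smooth_on_compose[where f = "\<lambda>x. (x, coord_e)", OF S \<Omega> in\<Omega> _ smooth_on_frechet_derivative[OF sm]]
    by blast
  then show "smooth_on S (\<lambda>x. D x v)" by (rule smooth_on_cong_open[OF S, rotated]) (simp add: D)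
qed

text \<open>Logarithmic derivatives are computed by writing the increment as a smooth map \<open>K\<close> into the group
  after a differentiable map \<open>\<alpha>\<close> between vector spaces.\<close>

lemma log_derivI:
  assumes F: "F x \<in> carrier G"
    and ev: "\<forall>\<^sub>F y in nhds x. F y \<in> carrier G \<and> inv F x \<otimes> F y = K (\<alpha> y)"
    and K: "smooth_into G T K" "open T" "\<alpha> x \<in> T"
    and \<alpha>: "(\<alpha> has_derivative A) (at x)"
    and D: "((\<lambda>z. coord G (K z)) has_derivative D) (at (\<alpha> x))"
  shows "log_deriv G F (\<lambda>h. D (A h)) x"
proof -
  have 1: "K (\<alpha> x) = \<one>" using eventually_nhds_x_imp_x[OF ev] F by (simp add: l_inv)
  have "isCont \<alpha> x" using \<alpha> by (rule has_derivative_continuous)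
  then have "filterlim \<alpha> (nhds (\<alpha> x)) (nhds x)"
    by (simp add: continuous_at tendsto_at_iff_tendsto_nhds)
  then have "\<forall>\<^sub>F y in nhds x. \<alpha> y \<in> T \<and> K (\<alpha> y) \<in> dom_e"
    using eventually_compose_filterlim[OF smooth_into_dom_e(1)[OF K 1]] by blast
  then have "\<forall>\<^sub>F y in nhds x. F y \<in> carrier G \<and> inv F x \<otimes> F y \<in> dom_e"
    using ev by eventually_elim simp
  moreover have "((\<lambda>y. coord G (inv F x \<otimes> F y)) has_derivative (\<lambda>h. D (A h))) (at x)"
    by (rule has_derivative_transform_nhds[OF has_derivative_compose[OF \<alpha> D]])
       (use ev in \<open>eventually_elim, simp\<close>)
  ultimately show ?thesis using F unfolding log_deriv_def by blast
qed

lemma log_deriv_carrier: "log_deriv G F D x \<Longrightarrow> F x \<in> carrier G"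
  by (simp add: log_deriv_def)

text \<open>The coordinates \<open>\<kappa>\<close> of the increment determine \<open>F\<close> near \<open>x\<close>.\<close>

lemma log_deriv_expand:
  assumes "log_deriv G F D x"
  defines "\<kappa> \<equiv> \<lambda>y. coord G (inv F x \<otimes> F y)"
  shows "(\<kappa> has_derivative D) (at x)" "\<kappa> x = coord_e"
    "\<forall>\<^sub>F y in nhds x. F y \<in> carrier G \<and> \<kappa> y \<in> img_e \<and> inv F x \<otimes> F y = coord_inv G (\<kappa> y)
       \<and> F y = F x \<otimes> coord_inv G (\<kappa> y)"
proof -
  have F: "F x \<in> carrier G" using assms by (simp add: log_deriv_def)
  show "(\<kappa> has_derivative D) (at x)" using assms by (simp add: log_deriv_def)
  show "\<kappa> x = coord_e" using F by (simp add: \<kappa>_def l_inv)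
  have "\<forall>\<^sub>F y in nhds x. F y \<in> carrier G \<and> inv F x \<otimes> F y \<in> dom_e"
    using assms by (simp add: log_deriv_def)
  then show "\<forall>\<^sub>F y in nhds x. F y \<in> carrier G \<and> \<kappa> y \<in> img_e \<and> inv F x \<otimes> F y = coord_inv G (\<kappa> y)
       \<and> F y = F x \<otimes> coord_inv G (\<kappa> y)"
  proof eventually_elim
    case (elim y)
    then have "coord_inv G (\<kappa> y) = inv F x \<otimes> F y" by (simp add: \<kappa>_def coord_inv_coord)
    moreover have "F x \<otimes> (inv F x \<otimes> F y) = F y" using F elim by (simp add: m_assoc[symmetric] r_inv)
    ultimately show ?case using elim by (simp add: \<kappa>_def)
  qed
qed

lemma log_deriv_unique: "log_deriv G F D x \<Longrightarrow> log_deriv G F D' x \<Longrightarrow> D = D'"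
  unfolding log_deriv_def by (blast intro: has_derivative_unique)

lemma log_deriv_cong:
  assumes "log_deriv G F D x" "\<forall>\<^sub>F y in nhds x. F y = H y"
  shows "log_deriv G H D x"
proof -
  have x: "F x = H x" using eventually_nhds_x_imp_x[OF assms(2)] .
  have "((\<lambda>y. coord G (inv H x \<otimes> H y)) has_derivative D) (at x)"
  proof (rule has_derivative_transform_nhds)
    show "((\<lambda>y. coord G (inv F x \<otimes> F y)) has_derivative D) (at x)"
      using assms(1) by (simp add: log_deriv_def)
    show "\<forall>\<^sub>F y in nhds x. coord G (inv F x \<otimes> F y) = coord G (inv H x \<otimes> H y)"
      using assms(2) by eventually_elim (simp add: x)
  qed
  moreover have "\<forall>\<^sub>F y in nhds x. H y \<in> carrier G \<and> inv H x \<otimes> H y \<in> dom_e"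
  proof -
    have "\<forall>\<^sub>F y in nhds x. F y \<in> carrier G \<and> inv F x \<otimes> F y \<in> dom_e"
      using assms(1) by (simp add: log_deriv_def)
    then show ?thesis using assms(2) by eventually_elim (simp add: x)
  qed
  ultimately show ?thesis using assms(1) x by (simp add: log_deriv_def)
qed

lemma log_deriv_compose:
  assumes F: "log_deriv G F D (f x)" and f: "(f has_derivative A) (at x)"
  shows "log_deriv G (\<lambda>y. F (f y)) (\<lambda>h. D (A h)) x"
proof -
  have "isCont f x" using f by (rule has_derivative_continuous)
  then have l: "filterlim f (nhds (f x)) (nhds x)"
    by (simp add: continuous_at tendsto_at_iff_tendsto_nhds)
  have "\<forall>\<^sub>F y in nhds (f x). F y \<in> carrier G \<and> inv F (f x) \<otimes> F y \<in> dom_e"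
    using F by (simp add: log_deriv_def)
  then have "\<forall>\<^sub>F y in nhds x. F (f y) \<in> carrier G \<and> inv F (f x) \<otimes> F (f y) \<in> dom_e"
    using eventually_compose_filterlim[OF _ l] by blast
  moreover have "((\<lambda>y. coord G (inv F (f x) \<otimes> F (f y))) has_derivative (\<lambda>h. D (A h))) (at x)"
    using has_derivative_compose[OF f, of "\<lambda>z. coord G (inv F (f x) \<otimes> F z)"] F
    by (simp add: log_deriv_def)
  ultimately show ?thesis using F by (simp add: log_deriv_def)
qed

lemma log_deriv_const: "g \<in> carrier G \<Longrightarrow> log_deriv G (\<lambda>_. g) (\<lambda>_. 0) x"
  by (simp add: log_deriv_def l_inv one_in_dom_e)

lemma smooth_into_log_deriv:
  assumes "smooth_into G S F" "open S" "x \<in> S"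
  shows "\<exists>D. log_deriv G F D x"
proof -
  have F: "F x \<in> carrier G" using smooth_into_carrier assms by blast
  have K: "smooth_into G S (\<lambda>y. inv F x \<otimes> F y)"
    by (intro smooth_into_mult smooth_into_const assms inv_closed F)
  have "\<forall>\<^sub>F y in nhds x. F y \<in> carrier G \<and> inv F x \<otimes> F y = inv F x \<otimes> F y"
    using eventually_nhds_in_open[OF assms(2,3)]
    by eventually_elim (simp add: smooth_into_carrier[OF assms(1)])
  from log_derivI[OF F this K assms(2,3) has_derivative_ident smooth_into_dom_e(2)[OF K assms(2,3)]] F
  show ?thesis by (auto simp: l_inv)
qed

lemma holomorphic_map_into_log_deriv:
  assumes "holomorphic_map_into G J S F" "open S" "x \<in> S" "log_deriv G F D x"
  shows "D (J v) = J_vec (D v)"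
proof -
  have F: "F x \<in> carrier G" using assms(4) by (simp add: log_deriv_def)
  have K: "holomorphic_map_into G J S (\<lambda>y. inv F x \<otimes> F y)"
    by (intro holomorphic_map_into_mult holomorphic_map_into_const assms inv_closed F)
  have "inv F x \<otimes> F x \<in> dom_e" using F by (simp add: l_inv one_in_dom_e)
  then have "frechet_derivative (\<lambda>y. coord G (inv F x \<otimes> F y)) (at x) (J v) =
     J_vec (frechet_derivative (\<lambda>y. coord G (inv F x \<otimes> F y)) (at x) v)"
    using K assms(3) chart_at_one unfolding holomorphic_map_into_def by blast
  moreover have "frechet_derivative (\<lambda>y. coord G (inv F x \<otimes> F y)) (at x) = D"
    using assms(4) by (intro frechet_derivative_eqI) (simp add: log_deriv_def)
  ultimately show ?thesis by simp
qed

lemma smooth_into_conj: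
  assumes "g \<in> carrier G"
  shows "smooth_into G img_e (\<lambda>p. g \<otimes> coord_inv G p \<otimes> inv g)"
  by (intro smooth_into_mult smooth_into_const smooth_into_coord_inv open_img_e inv_closed assms)

lemma Ad_has_derivative:
  assumes "g \<in> carrier G"
  shows "((\<lambda>p. coord G (g \<otimes> coord_inv G p \<otimes> inv g)) has_derivative Ad G g) (at coord_e)"
  using smooth_into_dom_e(2)[OF smooth_into_conj[OF assms] open_img_e coord_e_in] assms
  by (simp add: Ad_def diff_at_one_def coord_inv_coord_e r_inv)

lemma log_deriv_coord_inv: "log_deriv G (coord_inv G) (\<lambda>u. u) coord_e"
proof -
  have "\<forall>\<^sub>F p in nhds coord_e. coord_inv G p \<in> carrier G \<and> inv (coord_inv G coord_e) \<otimes> coord_inv G p = coord_inv G p"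
    using eventually_img_e by eventually_elim (simp add: coord_inv_carrier coord_inv_coord_e)
  moreover have "((\<lambda>p. coord G (coord_inv G p)) has_derivative (\<lambda>u. u)) (at coord_e)"
    by (rule has_derivative_transform_within_open[OF has_derivative_ident open_img_e coord_e_in])
       (simp add: coord_coord_inv)
  ultimately show ?thesis
    using log_derivI[of "coord_inv G" coord_e "coord_inv G" "\<lambda>p. p" img_e "\<lambda>u. u" "\<lambda>u. u"]
    by (simp add: smooth_into_coord_inv open_img_e coord_e_in coord_inv_coord_e)
qed

text \<open>The increment of a product is the increment of \<open>F\<close>, conjugated by \<open>H(x)\<^sup>-\<^sup>1\<close>, times the increment
  of \<open>H\<close>; and the derivative of multiplication at the identity is addition.\<close>

lemma log_deriv_mult:
  assumes F: "log_deriv G F D x" and H: "log_deriv G H D' x"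
  shows "log_deriv G (\<lambda>y. F y \<otimes> H y) (\<lambda>h. Ad G (inv H x) (D h) + D' h) x"
proof -
  define \<alpha> where "\<alpha> y = coord G (inv F x \<otimes> F y)" for y
  define \<beta> where "\<beta> y = coord G (inv H x \<otimes> H y)" for y
  note e\<alpha> = log_deriv_expand[OF F, folded \<alpha>_def] and e\<beta> = log_deriv_expand[OF H, folded \<beta>_def]
  have Fx: "F x \<in> carrier G" and Hx: "H x \<in> carrier G" using F H by (simp_all add: log_deriv_def)
  define K where "K z = inv H x \<otimes> coord_inv G (fst z) \<otimes> H x \<otimes> coord_inv G (snd z)" for z
  let ?T = "img_e \<times> img_e"
  have T: "open ?T" by (intro open_Times open_img_e)
  have "smooth_into G ?T (\<lambda>z. coord_inv G (fst z))" "smooth_into G ?T (\<lambda>z. coord_inv G (snd z))"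
    by (rule smooth_into_compose[OF smooth_into_coord_inv T open_img_e],
        auto intro!: smooth_on_linear T bounded_linear_fst bounded_linear_snd)+
  then have K: "smooth_into G ?T K"
    unfolding K_def by (intro smooth_into_mult smooth_into_const T inv_closed Hx)
  let ?z = "(coord_e, coord_e)"
  have z: "?z \<in> ?T" using coord_e_in by simp
  have K1: "K ?z = \<one>" using Hx by (simp add: K_def coord_inv_coord_e l_inv)
  define L where "L = frechet_derivative (\<lambda>z. coord G (K z)) (at ?z)"
  have L: "((\<lambda>z. coord G (K z)) has_derivative L) (at ?z)"
    unfolding L_def by (rule smooth_into_dom_e(2)[OF K T z K1])
  have "((\<lambda>p. coord G (K (p, coord_e))) has_derivative (\<lambda>u. L (u, 0))) (at coord_e)"
    by (rule has_derivative_compose[where f = "\<lambda>p. (p, coord_e)", OF _ L]) (auto intro!: derivative_eq_intros)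
  moreover have "((\<lambda>p. coord G (K (p, coord_e))) has_derivative Ad G (inv H x)) (at coord_e)"
    by (rule has_derivative_transform_within_open[OF Ad_has_derivative[OF inv_closed[OF Hx]] open_img_e coord_e_in])
       (simp add: K_def coord_inv_coord_e Hx coord_inv_carrier)
  ultimately have L1: "L (u, 0) = Ad G (inv H x) u" for u
    using has_derivative_unique by metis
  have "((\<lambda>p. coord G (K (coord_e, p))) has_derivative (\<lambda>u. L (0, u))) (at coord_e)"
    by (rule has_derivative_compose[where f = "\<lambda>p. (coord_e, p)", OF _ L]) (auto intro!: derivative_eq_intros)
  moreover have "((\<lambda>p. coord G (K (coord_e, p))) has_derivative (\<lambda>u. u)) (at coord_e)"
    by (rule has_derivative_transform_within_open[OF has_derivative_ident open_img_e coord_e_in])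
       (simp add: K_def coord_inv_coord_e Hx coord_inv_carrier l_inv coord_coord_inv)
  ultimately have L2: "L (0, u) = u" for u
    using has_derivative_unique by metis
  have LL: "L (u, v) = Ad G (inv H x) u + v" for u v
    using linear_add[OF has_derivative_linear[OF L], of "(u, 0)" "(0, v)"] by (simp add: L1 L2)
  have "log_deriv G (\<lambda>y. F y \<otimes> H y) (\<lambda>h. L (D h, D' h)) x"
  proof (rule log_derivI[where K = K and T = ?T and \<alpha> = "\<lambda>y. (\<alpha> y, \<beta> y)"])
    show "F x \<otimes> H x \<in> carrier G" using Fx Hx by simp
    show "\<forall>\<^sub>F y in nhds x. F y \<otimes> H y \<in> carrier G \<and> inv (F x \<otimes> H x) \<otimes> (F y \<otimes> H y) = K (\<alpha> y, \<beta> y)"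
      using e\<alpha>(3) e\<beta>(3)
    proof eventually_elim
      case (elim y)
      have c: "coord_inv G (\<alpha> y) \<in> carrier G" "coord_inv G (\<beta> y) \<in> carrier G"
        using elim coord_inv_carrier by blast+
      have "inv (F x \<otimes> H x) \<otimes> (F y \<otimes> H y) = inv H x \<otimes> (inv F x \<otimes> F y) \<otimes> H y"
        using Fx Hx conjunct1[OF elim(1)] conjunct1[OF elim(2)] by (simp add: inv_mult_group m_assoc)
      also have "\<dots> = inv H x \<otimes> coord_inv G (\<alpha> y) \<otimes> (H x \<otimes> coord_inv G (\<beta> y))"
        using conjunct1[OF conjunct2[OF conjunct2[OF elim(1)]]] conjunct2[OF conjunct2[OF conjunct2[OF elim(2)]]]
        by simp
      also have "\<dots> = K (\<alpha> y, \<beta> y)"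
        using c Hx by (simp add: K_def m_assoc)
      finally show ?case using conjunct1[OF elim(1)] conjunct1[OF elim(2)] by simp
    qed
    show "smooth_into G ?T K" "open ?T" by (rule K, rule T)
    show "(\<alpha> x, \<beta> x) \<in> ?T" using e\<alpha>(2) e\<beta>(2) coord_e_in by simp
    show "((\<lambda>y. (\<alpha> y, \<beta> y)) has_derivative (\<lambda>h. (D h, D' h))) (at x)"
      by (rule has_derivative_Pair[OF e\<alpha>(1) e\<beta>(1)])
    show "((\<lambda>z. coord G (K z)) has_derivative L) (at (\<alpha> x, \<beta> x))"
      using L e\<alpha>(2) e\<beta>(2) by simp
  qed
  then show ?thesis by (simp add: LL)
qed

lemma bounded_linear_Ad: "g \<in> carrier G \<Longrightarrow> bounded_linear (Ad G g)"
  using Ad_has_derivative by (rule has_derivative_bounded_linear)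

lemma Ad_linear:
  assumes "g \<in> carrier G"
  shows "Ad G g 0 = 0" "Ad G g (u + v) = Ad G g u + Ad G g v" "Ad G g (- u) = - Ad G g u"
    "Ad G g (s *\<^sub>R u) = s *\<^sub>R Ad G g u"
  using bounded_linear_Ad[OF assms] bounded_linear.linear linear_0 linear_add linear_neg linear_cmul by blast+

lemma log_deriv_mult_left:
  assumes "g \<in> carrier G" "log_deriv G F D x"
  shows "log_deriv G (\<lambda>y. g \<otimes> F y) D x"
  using log_deriv_mult[OF log_deriv_const[OF assms(1)] assms(2)] assms(2)
  by (simp add: Ad_linear log_deriv_def)

lemma log_deriv_mult_right:
  assumes "g \<in> carrier G" "log_deriv G F D x"
  shows "log_deriv G (\<lambda>y. F y \<otimes> g) (\<lambda>h. Ad G (inv g) (D h)) x"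
  using log_deriv_mult[OF assms(2) log_deriv_const[OF assms(1)]] by simp

lemma log_deriv_conj:
  assumes "g \<in> carrier G" "log_deriv G F D x"
  shows "log_deriv G (\<lambda>y. g \<otimes> F y \<otimes> inv g) (\<lambda>h. Ad G g (D h)) x"
  using log_deriv_mult_right[OF inv_closed[OF assms(1)] log_deriv_mult_left[OF assms]] assms(1)
  by simp

text \<open>Both sides are the logarithmic derivative at the identity of conjugation by \<open>g \<otimes> k\<close>.\<close>

lemma Ad_mult:
  assumes "g \<in> carrier G" "k \<in> carrier G"
  shows "Ad G (g \<otimes> k) v = Ad G g (Ad G k v)"
proof -
  have "log_deriv G (\<lambda>p. g \<otimes> (k \<otimes> coord_inv G p \<otimes> inv k) \<otimes> inv g) (\<lambda>h. Ad G g (Ad G k h)) coord_e"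
    by (intro log_deriv_conj assms log_deriv_coord_inv)
  moreover have "\<forall>\<^sub>F p in nhds coord_e. g \<otimes> (k \<otimes> coord_inv G p \<otimes> inv k) \<otimes> inv g = (g \<otimes> k) \<otimes> coord_inv G p \<otimes> inv (g \<otimes> k)"
    using eventually_img_e by eventually_elim (use assms in \<open>simp add: coord_inv_carrier inv_mult_group m_assoc\<close>)
  ultimately have "log_deriv G (\<lambda>p. (g \<otimes> k) \<otimes> coord_inv G p \<otimes> inv (g \<otimes> k)) (\<lambda>h. Ad G g (Ad G k h)) coord_e"
    by (rule log_deriv_cong)
  moreover have "log_deriv G (\<lambda>p. (g \<otimes> k) \<otimes> coord_inv G p \<otimes> inv (g \<otimes> k)) (\<lambda>h. Ad G (g \<otimes> k) h) coord_e"
    by (intro log_deriv_conj assms m_closed log_deriv_coord_inv)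
  ultimately show ?thesis using log_deriv_unique by metis
qed

lemma Ad_one: "Ad G \<one> v = v"
proof -
  have "log_deriv G (\<lambda>p. \<one> \<otimes> coord_inv G p \<otimes> inv \<one>) (\<lambda>h. Ad G \<one> h) coord_e"
    by (intro log_deriv_conj one_closed log_deriv_coord_inv)
  moreover have "\<forall>\<^sub>F p in nhds coord_e. \<one> \<otimes> coord_inv G p \<otimes> inv \<one> = coord_inv G p"
    using eventually_img_e by eventually_elim (simp add: coord_inv_carrier)
  ultimately have "log_deriv G (coord_inv G) (\<lambda>h. Ad G \<one> h) coord_e"
    by (rule log_deriv_cong)
  then show ?thesis using log_deriv_unique log_deriv_coord_inv by metis
qed

lemma Ad_inv:
  assumes "g \<in> carrier G"
  shows "Ad G g (Ad G (inv g) v) = v" "Ad G (inv g) (Ad G g v) = v"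
  using assms by (simp_all add: Ad_mult[symmetric] Ad_one r_inv l_inv)

text \<open>Conjugation is holomorphic, being a product of holomorphic maps.\<close>

lemma Ad_scale:
  assumes "g \<in> carrier G"
  shows "Ad G g (z *s v) = z *s Ad G g v"
proof -
  have "holomorphic_map_into G J_vec img_e (\<lambda>p. g \<otimes> coord_inv G p \<otimes> inv g)"
    by (intro holomorphic_map_into_mult holomorphic_map_into_const holomorphic_coord_inv open_img_e inv_closed assms)
  from holomorphic_map_into_log_deriv[OF this open_img_e coord_e_in log_deriv_conj[OF assms log_deriv_coord_inv]]
  have J: "Ad G g (\<i> *s v) = \<i> *s Ad G g v" for v by simp
  have dec: "z *s w = Re z *\<^sub>R w + Im z *\<^sub>R (\<i> *s w)" for w :: "complex^'n"
    by (simp add: vec_eq_iff complex_eq_iff)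
  show ?thesis
    by (simp add: dec[of v] dec[of "Ad G g v"] Ad_linear assms J)
qed

lemma Ad_smooth:
  fixes F :: "'a::euclidean_space \<Rightarrow> 'g"
  assumes F: "smooth_into G S F" and S: "open S"
  shows "smooth_on S (\<lambda>x. Ad G (F x) v)"
proof -
  let ?T = "S \<times> img_e"
  have T: "open ?T" by (intro open_Times open_img_e S)
  define K where "K z = F (fst z) \<otimes> coord_inv G (snd z) \<otimes> inv F (fst z)" for z
  have F1: "smooth_into G ?T (\<lambda>z. F (fst z))"
    by (rule smooth_into_compose[OF F T S]) (auto intro!: smooth_on_linear T bounded_linear_fst)
  have "smooth_into G ?T (\<lambda>z. coord_inv G (snd z))"
    by (rule smooth_into_compose[OF smooth_into_coord_inv T open_img_e])
       (auto intro!: smooth_on_linear T bounded_linear_snd)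
  then have K: "smooth_into G ?T K"
    unfolding K_def by (intro smooth_into_mult smooth_into_inv T F1)
  have "K (x, coord_e) \<in> dom_e" if "x \<in> S" for x
    using smooth_into_carrier[OF F that] by (simp add: K_def coord_inv_coord_e r_inv one_in_dom_e)
  from smooth_fibre_derivative(2)[OF K S this, of v]
  show ?thesis by (simp add: K_def Ad_def diff_at_one_def)
qed

lemma lie_bracket_has_derivative:
  "((\<lambda>p. Ad G (coord_inv G p) v) has_derivative (\<lambda>u. lie_bracket G u v)) (at coord_e)"
  unfolding lie_bracket_def
  by (rule smooth_on_has_derivative[OF Ad_smooth[OF smooth_into_coord_inv open_img_e] coord_e_in])

text \<open>Split off \<open>F(x)\<close> from \<open>F(y)\<close>: what remains is \<open>Ad\<close> of the increment, and the bracket is by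
  definition the derivative of \<open>Ad\<close> at the identity.\<close>

lemma log_deriv_Ad:
  assumes F: "log_deriv G F D x"
  shows "((\<lambda>y. Ad G (F y) v) has_derivative (\<lambda>h. Ad G (F x) (lie_bracket G (D h) v))) (at x)"
proof -
  have Fx: "F x \<in> carrier G" using F by (simp add: log_deriv_def)
  define \<kappa> where "\<kappa> y = coord G (inv F x \<otimes> F y)" for y
  note e = log_deriv_expand[OF F, folded \<kappa>_def]
  have "((\<lambda>y. Ad G (F x) (Ad G (coord_inv G (\<kappa> y)) v)) has_derivative (\<lambda>h. Ad G (F x) (lie_bracket G (D h) v))) (at x)"
    by (intro bounded_linear.has_derivative[OF bounded_linear_Ad[OF Fx]]
        has_derivative_compose[OF e(1)]) (simp add: e(2) lie_bracket_has_derivative)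
  moreover have ev: "\<forall>\<^sub>F y in nhds x. Ad G (F x) (Ad G (coord_inv G (\<kappa> y)) v) = Ad G (F y) v"
    using e(3)
  proof eventually_elim
    case (elim y)
    have "Ad G (F y) v = Ad G (F x \<otimes> coord_inv G (\<kappa> y)) v" using elim by simp
    then show ?case using elim Fx by (simp add: Ad_mult coord_inv_carrier)
  qed
  ultimately show ?thesis
    by (rule has_derivative_transform_nhds)
qed

lemma lie_bracket_linear_left: "bounded_linear (\<lambda>u. lie_bracket G u v)"
  using lie_bracket_has_derivative by (rule has_derivative_bounded_linear)

lemma lie_bracket_right:
  shows lie_bracket_add_right: "lie_bracket G u (v + w) = lie_bracket G u v + lie_bracket G u w"
    and lie_bracket_scale_right: "lie_bracket G u (z *s v) = z *s lie_bracket G u v"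
proof -
  have ev: "\<forall>\<^sub>F p in nhds coord_e. coord_inv G p \<in> carrier G"
    using eventually_img_e by eventually_elim (rule coord_inv_carrier)
  have "((\<lambda>p. Ad G (coord_inv G p) v + Ad G (coord_inv G p) w) has_derivative
     (\<lambda>u. lie_bracket G u v + lie_bracket G u w)) (at coord_e)"
    by (intro has_derivative_add lie_bracket_has_derivative)
  then have "((\<lambda>p. Ad G (coord_inv G p) (v + w)) has_derivative
     (\<lambda>u. lie_bracket G u v + lie_bracket G u w)) (at coord_e)"
    by (rule has_derivative_transform_within_open[OF _ open_img_e coord_e_in])
       (simp add: Ad_linear coord_inv_carrier)
  from has_derivative_unique[OF this lie_bracket_has_derivative]
  show "lie_bracket G u (v + w) = lie_bracket G u v + lie_bracket G u w" by metis
  have "bounded_linear (\<lambda>w :: complex^'n. z *s w)"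
    by (intro linear_conv_bounded_linear[THEN iffD1] linearI) (simp_all add: vec_eq_iff algebra_simps)
  then have "((\<lambda>p. z *s Ad G (coord_inv G p) v) has_derivative (\<lambda>u. z *s lie_bracket G u v)) (at coord_e)"
    by (rule bounded_linear.has_derivative[OF _ lie_bracket_has_derivative])
  then have "((\<lambda>p. Ad G (coord_inv G p) (z *s v)) has_derivative (\<lambda>u. z *s lie_bracket G u v)) (at coord_e)"
    by (rule has_derivative_transform_within_open[OF _ open_img_e coord_e_in])
       (simp add: Ad_scale coord_inv_carrier)
  from has_derivative_unique[OF this lie_bracket_has_derivative]
  show "lie_bracket G u (z *s v) = z *s lie_bracket G u v" by metis
qed

text \<open>Differentiate \<open>Ad (g p g\<^sup>-\<^sup>1) (Ad g v) = Ad g (Ad p v)\<close> with respect to \<open>p\<close> at the identity.\<close>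

lemma Ad_lie_bracket:
  assumes "g \<in> carrier G"
  shows "Ad G g (lie_bracket G u v) = lie_bracket G (Ad G g u) (Ad G g v)"
proof -
  have "((\<lambda>p. Ad G (g \<otimes> coord_inv G p \<otimes> inv g) (Ad G g v)) has_derivative
     (\<lambda>u. lie_bracket G (Ad G g u) (Ad G g v))) (at coord_e)"
    using log_deriv_Ad[OF log_deriv_conj[OF assms log_deriv_coord_inv], of "Ad G g v"] assms
    by (simp add: coord_inv_coord_e r_inv Ad_one)
  then have "((\<lambda>p. Ad G g (Ad G (coord_inv G p) v)) has_derivative
     (\<lambda>u. lie_bracket G (Ad G g u) (Ad G g v))) (at coord_e)"
    by (rule has_derivative_transform_within_open[OF _ open_img_e coord_e_in])
       (use assms in \<open>simp add: Ad_mult coord_inv_carrier Ad_inv\<close>)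
  moreover have "((\<lambda>p. Ad G g (Ad G (coord_inv G p) v)) has_derivative
     (\<lambda>u. Ad G g (lie_bracket G u v))) (at coord_e)"
    by (rule bounded_linear.has_derivative[OF bounded_linear_Ad[OF assms] lie_bracket_has_derivative])
  ultimately show ?thesis using has_derivative_unique by metis
qed

lemma log_deriv_inv:
  assumes F: "log_deriv G F D x"
  shows "log_deriv G (\<lambda>y. inv F y) (\<lambda>h. - Ad G (F x) (D h)) x"
proof -
  have Fx: "F x \<in> carrier G" using F by (simp add: log_deriv_def)
  define \<alpha> where "\<alpha> y = coord G (inv F x \<otimes> F y)" for y
  note e = log_deriv_expand[OF F, folded \<alpha>_def]
  define K where "K p = F x \<otimes> inv (coord_inv G p) \<otimes> inv F x" for p
  have K: "smooth_into G img_e K" unfolding K_def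
    by (intro smooth_into_mult smooth_into_const smooth_into_inv smooth_into_coord_inv open_img_e inv_closed Fx)
  have K1: "K coord_e = \<one>" using Fx by (simp add: K_def coord_inv_coord_e r_inv)
  note L = smooth_into_dom_e(2)[OF K open_img_e coord_e_in K1]
  have "\<exists>D'. log_deriv G (\<lambda>y. inv F y) D' x"
  proof (rule exI, rule log_derivI[where K = K and T = img_e and \<alpha> = \<alpha>])
    show "inv F x \<in> carrier G" using Fx by simp
    show "\<forall>\<^sub>F y in nhds x. inv F y \<in> carrier G \<and> inv (inv F x) \<otimes> inv F y = K (\<alpha> y)"
      using e(3)
    proof eventually_elim
      case (elim y)
      have c: "coord_inv G (\<alpha> y) \<in> carrier G" using elim coord_inv_carrier by blast
      have "inv F y = inv (F x \<otimes> coord_inv G (\<alpha> y))" using elim by simp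
      then show ?case using elim c Fx by (simp add: K_def inv_mult_group m_assoc)
    qed
    show "(\<alpha> has_derivative D) (at x)" by (rule e)
    show "smooth_into G img_e K" "open img_e" "\<alpha> x \<in> img_e" using K open_img_e coord_e_in e(2) by simp_all
    show "((\<lambda>z. coord G (K z)) has_derivative frechet_derivative (\<lambda>y. coord G (K y)) (at coord_e)) (at (\<alpha> x))"
      using L e(2) by simp
  qed
  then obtain D' where D': "log_deriv G (\<lambda>y. inv F y) D' x" by blast
  \<comment> \<open>The value of \<open>D'\<close> follows from the product rule, as the product of \<open>F\<close> and its inverse is constant.\<close>
  have "log_deriv G (\<lambda>y. F y \<otimes> inv F y) (\<lambda>h. Ad G (inv (inv F x)) (D h) + D' h) x"
    by (rule log_deriv_mult[OF F D'])
  moreover have "\<forall>\<^sub>F y in nhds x. F y \<otimes> inv F y = \<one>"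
    using e(3) by eventually_elim (elim conjE, rule r_inv)
  ultimately have "log_deriv G (\<lambda>y. \<one>) (\<lambda>h. Ad G (inv (inv F x)) (D h) + D' h) x"
    by (rule log_deriv_cong)
  from log_deriv_unique[OF this log_deriv_const[OF one_closed]]
  have "D' h = - Ad G (F x) (D h)" for h
    using Fx by (metis add_eq_0_iff inv_inv)
  then show ?thesis using D' by presburger
qed

text \<open>This is the source of the Lax equation: the orbit of \<open>v\<close> under \<open>Ad (F\<^sup>-\<^sup>1)\<close> moves by the bracket
  with the logarithmic derivative of \<open>F\<close>.\<close>

lemma log_deriv_Ad_inv:
  assumes F: "log_deriv G F D x"
  shows "((\<lambda>y. Ad G (inv F y) v) has_derivative (\<lambda>h. - lie_bracket G (D h) (Ad G (inv F x) v))) (at x)"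
proof -
  have Fx: "F x \<in> carrier G" using F by (simp add: log_deriv_def)
  have "Ad G (inv F x) (lie_bracket G (- Ad G (F x) w) v) = - lie_bracket G w (Ad G (inv F x) v)" for w
    using Fx linear_neg[OF bounded_linear.linear[OF lie_bracket_linear_left]]
    by (simp add: Ad_lie_bracket Ad_linear Ad_inv)
  then show ?thesis using log_deriv_Ad[OF log_deriv_inv[OF F], of v] by simp
qed

lemma log_deriv_zero_chart:
  assumes F: "log_deriv G F (\<lambda>_. 0) x" and V: "(V, \<psi>) \<in> lie_atlas G" "F x \<in> V"
  shows "((\<lambda>y. \<psi> (F y)) has_derivative (\<lambda>_. 0)) (at x)"
proof -
  have Fx: "F x \<in> carrier G" using F by (simp add: log_deriv_def)
  define \<kappa> where "\<kappa> y = coord G (inv F x \<otimes> F y)" for y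
  note e = log_deriv_expand[OF F, folded \<kappa>_def]
  define K where "K p = F x \<otimes> coord_inv G p" for p
  have K: "smooth_into G img_e K" unfolding K_def
    by (intro smooth_into_mult smooth_into_const smooth_into_coord_inv open_img_e Fx)
  have "coord_e \<in> {p\<in>img_e. K p \<in> V}"
    using coord_e_in V Fx by (simp add: K_def coord_inv_coord_e)
  from smooth_on_has_derivative[OF smooth_into_chart[OF K V(1)] this]
  have L: "((\<lambda>p. \<psi> (K p)) has_derivative frechet_derivative (\<lambda>p. \<psi> (K p)) (at coord_e)) (at (\<kappa> x))"
    by (simp add: e(2))
  have "((\<lambda>y. \<psi> (K (\<kappa> y))) has_derivative (\<lambda>_. 0)) (at x)"
    using has_derivative_compose[OF e(1) L] linear_0[OF has_derivative_linear[OF L]] by simp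
  moreover have ev: "\<forall>\<^sub>F y in nhds x. \<psi> (K (\<kappa> y)) = \<psi> (F y)"
    using e(3) by eventually_elim (simp add: K_def)
  ultimately show ?thesis
    by (rule has_derivative_transform_nhds)
qed

text \<open>A homomorphism maps increments to increments.\<close>

lemma log_deriv_hom:
  assumes \<theta>: "\<theta> \<in> hom G G" "smooth_self_map G \<theta>" and F: "log_deriv G F D x"
  shows "log_deriv G (\<lambda>y. \<theta> (F y)) (\<lambda>h. diff_at_one G \<theta> (D h)) x"
proof -
  interpret \<theta>: group_hom G G \<theta>
    using \<theta>(1) by unfold_locales
  have Fx: "F x \<in> carrier G" using F by (simp add: log_deriv_def)
  define \<kappa> where "\<kappa> y = coord G (inv F x \<otimes> F y)" for y
  note e = log_deriv_expand[OF F, folded \<kappa>_def]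
  have K: "smooth_into G img_e (\<lambda>p. \<theta> (coord_inv G p))"
    by (rule smooth_into_self_map[OF \<theta>(2) open_img_e smooth_into_coord_inv])
  show ?thesis
  proof (rule log_derivI[where K = "\<lambda>p. \<theta> (coord_inv G p)" and T = img_e and \<alpha> = \<kappa>
        and A = D and D = "diff_at_one G \<theta>"])
    show "\<theta> (F x) \<in> carrier G" using Fx by simp
    show "\<forall>\<^sub>F y in nhds x. \<theta> (F y) \<in> carrier G \<and> inv \<theta> (F x) \<otimes> \<theta> (F y) = \<theta> (coord_inv G (\<kappa> y))"
      using e(3)
    proof eventually_elim
      case (elim y)
      have "inv \<theta> (F x) \<otimes> \<theta> (F y) = \<theta> (inv F x \<otimes> F y)" using Fx conjunct1[OF elim] by simp
      also have "\<dots> = \<theta> (coord_inv G (\<kappa> y))" using arg_cong[OF conjunct1[OF conjunct2[OF conjunct2[OF elim]]], of \<theta>] .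
      finally show ?case using conjunct1[OF elim] by simp
    qed
    show "(\<kappa> has_derivative D) (at x)" by (rule e)
    show "smooth_into G img_e (\<lambda>p. \<theta> (coord_inv G p))" "open img_e" "\<kappa> x \<in> img_e"
      using K open_img_e coord_e_in e(2) by simp_all
    show "((\<lambda>z. coord G (\<theta> (coord_inv G z))) has_derivative diff_at_one G \<theta>) (at (\<kappa> x))"
      unfolding e(2) diff_at_one_def
      by (rule smooth_into_dom_e(2)[OF K open_img_e coord_e_in]) (simp add: coord_inv_coord_e)
  qed
qed

lemma diff_at_one_linear:
  assumes \<theta>: "\<theta> \<in> hom G G" "smooth_self_map G \<theta>"
  shows "bounded_linear (diff_at_one G \<theta>)"
  using log_deriv_hom[OF \<theta> log_deriv_coord_inv] unfolding log_deriv_def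
  by (blast intro: has_derivative_bounded_linear)

lemma diff_at_one_Ad:
  assumes \<theta>: "\<theta> \<in> hom G G" "smooth_self_map G \<theta>" and g: "g \<in> carrier G"
  shows "diff_at_one G \<theta> (Ad G g v) = Ad G (\<theta> g) (diff_at_one G \<theta> v)"
proof -
  interpret \<theta>: group_hom G G \<theta>
    using \<theta>(1) by unfold_locales
  have "log_deriv G (\<lambda>p. \<theta> (g \<otimes> coord_inv G p \<otimes> inv g)) (\<lambda>h. diff_at_one G \<theta> (Ad G g h)) coord_e"
    by (intro log_deriv_hom[OF \<theta>] log_deriv_conj[OF g] log_deriv_coord_inv)
  moreover have "\<forall>\<^sub>F p in nhds coord_e. \<theta> (g \<otimes> coord_inv G p \<otimes> inv g) = \<theta> g \<otimes> \<theta> (coord_inv G p) \<otimes> inv \<theta> g"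
    using eventually_img_e by eventually_elim (use g in \<open>simp add: coord_inv_carrier\<close>)
  ultimately have "log_deriv G (\<lambda>p. \<theta> g \<otimes> \<theta> (coord_inv G p) \<otimes> inv \<theta> g) (\<lambda>h. diff_at_one G \<theta> (Ad G g h)) coord_e"
    by (rule log_deriv_cong)
  moreover have "log_deriv G (\<lambda>p. \<theta> g \<otimes> \<theta> (coord_inv G p) \<otimes> inv \<theta> g) (\<lambda>h. Ad G (\<theta> g) (diff_at_one G \<theta> h)) coord_e"
    by (intro log_deriv_conj log_deriv_hom[OF \<theta>] log_deriv_coord_inv) (simp add: g)
  ultimately show ?thesis using log_deriv_unique by metis
qed

lemma diff_at_one_lie_bracket:
  assumes \<theta>: "\<theta> \<in> hom G G" "smooth_self_map G \<theta>"
  shows "diff_at_one G \<theta> (lie_bracket G u v) = lie_bracket G (diff_at_one G \<theta> u) (diff_at_one G \<theta> v)"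
proof -
  interpret \<theta>: group_hom G G \<theta>
    using \<theta>(1) by unfold_locales
  have "((\<lambda>p. Ad G (\<theta> (coord_inv G p)) (diff_at_one G \<theta> v)) has_derivative
      (\<lambda>u. lie_bracket G (diff_at_one G \<theta> u) (diff_at_one G \<theta> v))) (at coord_e)"
    using log_deriv_Ad[OF log_deriv_hom[OF \<theta> log_deriv_coord_inv], of "diff_at_one G \<theta> v"]
    by (simp add: coord_inv_coord_e Ad_one)
  then have "((\<lambda>p. diff_at_one G \<theta> (Ad G (coord_inv G p) v)) has_derivative
      (\<lambda>u. lie_bracket G (diff_at_one G \<theta> u) (diff_at_one G \<theta> v))) (at coord_e)"
    by (rule has_derivative_transform_within_open[OF _ open_img_e coord_e_in])
       (simp add: diff_at_one_Ad[OF \<theta>] coord_inv_carrier)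
  moreover have "((\<lambda>p. diff_at_one G \<theta> (Ad G (coord_inv G p) v)) has_derivative
      (\<lambda>u. diff_at_one G \<theta> (lie_bracket G u v))) (at coord_e)"
    by (rule bounded_linear.has_derivative[OF diff_at_one_linear[OF \<theta>] lie_bracket_has_derivative])
  ultimately show ?thesis using has_derivative_unique by metis
qed

end

section \<open>Local solutions of ordinary differential equations\<close>

lemma smooth_on_Lipschitz_cball:
  fixes X :: "'a::euclidean_space \<Rightarrow> 'b::real_normed_vector"
  assumes X: "smooth_on S X" and r: "cball p r \<subseteq> S"
  obtains L where "L \<ge> 0" "\<And>x y. x \<in> cball p r \<Longrightarrow> y \<in> cball p r \<Longrightarrow> norm (X x - X y) \<le> L * norm (x - y)"
proof -
  let ?D = "\<lambda>x. frechet_derivative X (at x)"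
  have "\<exists>C. \<forall>x\<in>cball p r. norm (?D x b) \<le> C" for b
  proof -
    have "continuous_on (cball p r) (\<lambda>x. ?D x b)"
      using smooth_on_continuous_on[OF smooth_on_frechet_derivative[OF X]] r continuous_on_subset by blast
    then have "bounded ((\<lambda>x. ?D x b) ` cball p r)"
      using compact_continuous_image compact_cball compact_imp_bounded by blast
    then show ?thesis by (auto simp: bounded_iff)
  qed
  then obtain C where C: "norm (?D x b) \<le> C b" if "x \<in> cball p r" for x b by metis
  define L where "L = (\<Sum>b\<in>Basis. \<bar>C b\<bar>)"
  have D: "(X has_derivative ?D x) (at x)" if "x \<in> cball p r" for x
    using smooth_on_has_derivative[OF X] that r by blast
  have "norm (?D x v) \<le> norm v * L" if x: "x \<in> cball p r" for x v
  proof -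
    have "?D x v = ?D x (\<Sum>b\<in>Basis. (v \<bullet> b) *\<^sub>R b)" by (simp add: euclidean_representation)
    also have "\<dots> = (\<Sum>b\<in>Basis. (v \<bullet> b) *\<^sub>R ?D x b)"
      using has_derivative_linear[OF D[OF x]] by (simp add: linear_sum linear_cmul)
    also have "norm \<dots> \<le> (\<Sum>b\<in>Basis. norm v * \<bar>C b\<bar>)"
    proof (rule sum_norm_le)
      fix b :: 'a assume b: "b \<in> Basis"
      have "norm (?D x b) \<le> \<bar>C b\<bar>" using C[OF x, of b] by linarith
      then show "norm ((v \<bullet> b) *\<^sub>R ?D x b) \<le> norm v * \<bar>C b\<bar>"
        using Basis_le_norm[OF b, of v] by (simp add: mult_mono)
    qed
    finally show ?thesis by (simp add: L_def sum_distrib_left)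
  qed
  then have o: "onorm (?D x) \<le> L" if "x \<in> cball p r" for x
    using that by (intro onorm_le) (simp add: mult.commute)
  have L: "L \<ge> 0" unfolding L_def by (intro sum_nonneg) simp
  have "norm (X x - X y) \<le> L * norm (x - y)" if "x \<in> cball p r" "y \<in> cball p r" for x y
    by (rule differentiable_bound[OF convex_cball has_derivative_at_withinI[OF D] o that])
  then show ?thesis using that L by blast
qed

text \<open>Picard iteration. The integral operator maps the complete space of bounded continuous curves to
  itself, and the bound on \<open>\<delta>\<close> makes it contract distances by the factor \<open>1/2\<close>: the two integrals
  from \<open>-\<delta>\<close> each run over a time of at most \<open>2 \<delta>\<close>, which accounts for \<open>4 \<delta> L\<close>.\<close>

lemma ODE_global_Lipschitz_solution:
  fixes X :: "'a::euclidean_space \<Rightarrow> 'a"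
  assumes L: "L \<ge> 0" "\<And>x y. norm (X x - X y) \<le> L * norm (x - y)"
    and M: "\<And>x. norm (X x) \<le> M" and \<delta>: "\<delta> > 0" "8 * \<delta> * L \<le> 1"
  obtains y where "y 0 = p" "\<And>t. \<bar>t\<bar> < \<delta> \<Longrightarrow> (y has_vector_derivative X (y t)) (at t)"
    "\<And>t. norm (y t - p) \<le> 4 * \<delta> * M"
proof -
  have M0: "M \<ge> 0" using M[of p] norm_ge_zero order_trans by blast
  \<comment> \<open>Clamping the time makes the integral operator act on bounded functions on the whole line.\<close>
  define cl where "cl t = max (-\<delta>) (min \<delta> t)" for t
  have cl: "cl t \<in> {-\<delta>..\<delta>}" for t using \<delta> by (auto simp: cl_def)
  have ccl: "continuous_on UNIV cl" unfolding cl_def by (intro continuous_intros)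
  have cX: "continuous_on UNIV X"
    by (rule lipschitz_on_continuous_on[OF lipschitz_onI[OF _ L(1)]]) (simp add: dist_norm L(2))
  define I where "I z s = integral {-\<delta>..s} (\<lambda>u. X (apply_bcontfun z u))" for z :: "real \<Rightarrow>\<^sub>C 'a" and s
  have cXz: "continuous_on A (\<lambda>u. X (apply_bcontfun z u))" for z :: "real \<Rightarrow>\<^sub>C 'a" and A
    by (rule continuous_on_compose2[OF cX continuous_on_apply_bcontfun]) simp
  have int: "(\<lambda>u. X (apply_bcontfun z u)) integrable_on {a..b}" for z :: "real \<Rightarrow>\<^sub>C 'a" and a b
    by (rule integrable_continuous_real[OF cXz])
  have cI: "continuous_on {-\<delta>..\<delta>} (I z)" for z
    unfolding I_def by (rule indefinite_integral_continuous_1[OF int])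
  have bI: "norm (I z s) \<le> 2 * \<delta> * M" if s: "s \<in> {-\<delta>..\<delta>}" for z s
  proof -
    have "norm (I z s) \<le> M * (s - (-\<delta>))"
      unfolding I_def by (rule integral_bound) (use s M cXz in auto)
    also have "\<dots> \<le> M * (2 * \<delta>)" using s M0 by (intro mult_left_mono) auto
    finally show ?thesis by (simp add: mult_ac)
  qed
  define T where "T z t = p + I z (cl t) - I z 0" for z t
  have bT: "norm (T z t - p) \<le> 4 * \<delta> * M" for z t
  proof -
    have "norm (T z t - p) \<le> norm (I z (cl t)) + norm (I z 0)"
      unfolding T_def by (simp add: norm_triangle_ineq4)
    also have "\<dots> \<le> 4 * \<delta> * M" using bI[OF cl, of z t] bI[of 0 z] \<delta> by simp
    finally show ?thesis .
  qed
  have T: "T z \<in> bcontfun" for z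
  proof (rule bcontfun_normI)
    show "continuous_on UNIV (T z)"
      unfolding T_def
      by (intro continuous_intros continuous_on_compose2[OF cI ccl]) (use cl in auto)
    show "norm (T z t) \<le> norm p + 4 * \<delta> * M" for t
      using bT[of z t] norm_triangle_sub[of "T z t" p] by linarith
  qed
  have ap: "apply_bcontfun (Bcontfun (T z)) t = T z t" for z t
    by (simp add: Bcontfun_inverse[OF T])
  have "dist (Bcontfun (T y)) (Bcontfun (T z)) \<le> 1/2 * dist y z" for y z
  proof (rule dist_bound)
    fix t
    have d: "norm (I y s - I z s) \<le> 2 * \<delta> * (L * dist y z)" if s: "s \<in> {-\<delta>..\<delta>}" for s
    proof -
      have "norm (I y s - I z s) = norm (integral {-\<delta>..s} (\<lambda>u. X (apply_bcontfun y u) - X (apply_bcontfun z u)))"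
        unfolding I_def by (simp add: integral_diff[OF int int])
      also have "\<dots> \<le> (L * dist y z) * (s - (-\<delta>))"
      proof (rule integral_bound)
        show "-\<delta> \<le> s" using s by simp
        show "continuous_on {- \<delta>..s} (\<lambda>u. X (apply_bcontfun y u) - X (apply_bcontfun z u))"
          by (intro continuous_on_diff cXz)
        fix u
        have "norm (X (apply_bcontfun y u) - X (apply_bcontfun z u)) \<le> L * norm (apply_bcontfun y u - apply_bcontfun z u)"
          by (rule L)
        also have "\<dots> \<le> L * dist y z"
          using dist_bounded[of y u z] L(1) by (intro mult_left_mono) (simp_all add: dist_norm)
        finally show "norm (X (apply_bcontfun y u) - X (apply_bcontfun z u)) \<le> L * dist y z" .
      qed
      also have "\<dots> \<le> (L * dist y z) * (2 * \<delta>)" using s L(1) by (intro mult_left_mono) auto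
      finally show ?thesis by (simp add: mult_ac)
    qed
    have "dist (T y t) (T z t) = norm ((I y (cl t) - I z (cl t)) - (I y 0 - I z 0))"
      unfolding T_def dist_norm by (simp add: algebra_simps)
    also have "\<dots> \<le> norm (I y (cl t) - I z (cl t)) + norm (I y 0 - I z 0)" by (rule norm_triangle_ineq4)
    also have "\<dots> \<le> 4 * \<delta> * (L * dist y z)" using d[OF cl, of t] d[of 0] \<delta> by simp
    also have "\<dots> = 1/2 * ((8 * \<delta> * L) * dist y z)" by simp
    also have "\<dots> \<le> 1/2 * (1 * dist y z)"
      by (intro mult_left_mono mult_right_mono \<delta>(2)) simp_all
    finally show "dist (apply_bcontfun (Bcontfun (T y)) t) (apply_bcontfun (Bcontfun (T z)) t) \<le> 1/2 * dist y z"
      by (simp add: ap)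
  qed
  then have "\<exists>!z. Bcontfun (T z) = z"
    by (intro banach_fix_type[where c = "1/2"]) auto
  then obtain z where z: "Bcontfun (T z) = z" by blast
  define y where "y = apply_bcontfun z"
  have yT: "y t = T z t" for t using ap[of z t] by (simp add: z y_def)
  have "y 0 = p" using \<delta> by (simp add: yT T_def cl_def)
  moreover have "(y has_vector_derivative X (y t)) (at t)" if t: "\<bar>t\<bar> < \<delta>" for t
  proof -
    have "(I z has_vector_derivative X (y t)) (at t within {-\<delta>..\<delta>})"
      unfolding I_def y_def by (rule integral_has_vector_derivative[OF cXz]) (use t in auto)
    then have "(I z has_vector_derivative X (y t)) (at t)"
      using t at_within_interior[of t "{-\<delta>..\<delta>}"] by (simp add: abs_less_iff)
    then have "((\<lambda>s. p + I z s - I z 0) has_vector_derivative X (y t)) (at t)"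
      by (auto intro!: derivative_eq_intros)
    then show ?thesis
      by (rule has_vector_derivative_transform_within_open[where S = "{-\<delta><..<\<delta>}"])
         (use t in \<open>auto simp: yT T_def cl_def\<close>)
  qed
  moreover have "norm (y t - p) \<le> 4 * \<delta> * M" for t by (simp add: yT bT)
  ultimately show ?thesis by (rule that)
qed

text \<open>Smoothness comes by bootstrapping: if \<open>y\<close> is of class \<open>Ck\<close> then so is its derivative \<open>X \<circ> y\<close>.\<close>

lemma ODE_local_solution:
  fixes X :: "'a::euclidean_space \<Rightarrow> 'a"
  assumes X: "smooth_on S X" and S: "open S" and p: "p \<in> S"
  obtains \<delta> y where "\<delta> > 0" "y 0 = p" "\<And>t. \<bar>t\<bar> < \<delta> \<Longrightarrow> y t \<in> S"
    "\<And>t. \<bar>t\<bar> < \<delta> \<Longrightarrow> (y has_vector_derivative X (y t)) (at t)"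
    "smooth_on {-\<delta><..<\<delta>} y"
proof -
  obtain r where r: "r > 0" "cball p r \<subseteq> S" using S p open_contains_cball by blast
  obtain L where L: "L \<ge> 0" "\<And>x y. x \<in> cball p r \<Longrightarrow> y \<in> cball p r \<Longrightarrow> norm (X x - X y) \<le> L * norm (x - y)"
    by (rule smooth_on_Lipschitz_cball[OF X r(2)]) blast
  have "bounded (X ` cball p r)"
    by (intro compact_imp_bounded compact_continuous_image compact_cball
        continuous_on_subset[OF smooth_on_continuous_on[OF X] r(2)])
  then obtain M where M: "\<And>x. x \<in> cball p r \<Longrightarrow> norm (X x) \<le> M"
    unfolding bounded_iff by blast
  have M0: "M \<ge> 0" using M[of p] r(1) norm_ge_zero[of "X p"] by (smt (verit) centre_in_cball)
  \<comment> \<open>Composing with the nearest point projection onto a ball makes the field globally Lipschitz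
      and bounded without changing it near \<open>p\<close>.\<close>
  define P where "P = closest_point (cball p r)"
  have ne: "cball p r \<noteq> {}" using r by auto
  have P: "P x \<in> cball p r" for x
    unfolding P_def by (rule closest_point_in_set[OF closed_cball ne])
  have PL: "norm (P x - P y) \<le> norm (x - y)" for x y
    using closest_point_lipschitz[OF convex_cball closed_cball ne, of x y] by (simp add: P_def dist_norm)
  have L': "norm (X (P x) - X (P y)) \<le> L * norm (x - y)" for x y
    using L(2)[OF P P, of x y] mult_left_mono[OF PL L(1), of x y] by linarith
  define \<delta> where "\<delta> = min (1 / (8 * (L + 1))) (r / (4 * (M + 1)))"
  have \<delta>: "\<delta> > 0" unfolding \<delta>_def using L M0 r by simp
  have "\<delta> * (8 * (L + 1)) \<le> 1"
    using L by (simp add: \<delta>_def pos_le_divide_eq[symmetric])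
  then have \<delta>L: "8 * \<delta> * L \<le> 1" using \<delta> by (simp add: algebra_simps)
  have "\<delta> * (4 * (M + 1)) \<le> r"
    using M0 by (simp add: \<delta>_def pos_le_divide_eq[symmetric])
  then have \<delta>M: "4 * \<delta> * M \<le> r" using \<delta> by (simp add: algebra_simps)
  obtain y where y: "y 0 = p" "\<And>t. \<bar>t\<bar> < \<delta> \<Longrightarrow> (y has_vector_derivative X (P (y t))) (at t)"
    "\<And>t. norm (y t - p) \<le> 4 * \<delta> * M"
    by (rule ODE_global_Lipschitz_solution[where X = "\<lambda>x. X (P x)" and p = p, OF L(1) L' M[OF P] \<delta> \<delta>L]) blast
  have yc: "y t \<in> cball p r" for t
    using y(3)[of t] \<delta>M by (simp add: dist_norm norm_minus_commute)
  have Py: "P (y t) = y t" for t unfolding P_def by (rule closest_point_self[OF yc])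
  have d: "(y has_vector_derivative X (y t)) (at t)" if "\<bar>t\<bar> < \<delta>" for t
    using y(2)[OF that] by (simp add: Py)
  have yS: "y t \<in> S" for t using yc r by blast
  have "Ck_on k y {-\<delta><..<\<delta>}" for k
  proof (induction k)
    case 0
    have "isCont y t" if "t \<in> {-\<delta><..<\<delta>}" for t
      using has_vector_derivative_continuous[OF d, of t] that by auto
    then show ?case by (simp add: continuous_at_imp_continuous_on)
  next
    case (Suc k)
    have "Ck_on k X S" using X by (simp add: smooth_on_def)
    from Ck_on_compose[OF open_greaterThanLessThan S yS Suc this]
    have "Ck_on k (\<lambda>t. h *\<^sub>R X (y t)) {-\<delta><..<\<delta>}" for h
      by (rule Ck_on_bounded_linear[OF open_greaterThanLessThan bounded_linear_scaleR_right])
    moreover have "(y has_derivative (\<lambda>h. h *\<^sub>R X (y t))) (at t)" if "t \<in> {-\<delta><..<\<delta>}" for t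
      using d[of t] that by (simp add: has_vector_derivative_def abs_less_iff)
    ultimately show ?case
      by (intro Ck_on_SucI[where D = "\<lambda>t h. h *\<^sub>R X (y t)"] open_greaterThanLessThan)
  qed
  then have "smooth_on {-\<delta><..<\<delta>} y" by (simp add: smooth_on_def)
  then show ?thesis using that[OF \<delta> y(1) yS d] by blast
qed

section \<open>One-parameter subgroups and the exponential map\<close>

context lie_grp
begin

lemma smooth_into_local:
  assumes S: "open S" and "\<And>x. x \<in> S \<Longrightarrow> \<exists>T H. open T \<and> x \<in> T \<and> T \<subseteq> S \<and> smooth_into G T H \<and> (\<forall>y\<in>T. F y = H y)"
  shows "smooth_into G S F"
proof (rule smooth_intoI_local[OF S])
  fix x assume x: "x \<in> S"
  obtain T H where T: "open T" "x \<in> T" "T \<subseteq> S" "smooth_into G T H" and FH: "\<And>y. y \<in> T \<Longrightarrow> F y = H y"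
    using assms(2)[OF x] by blast
  obtain V \<psi> where V: "(V, \<psi>) \<in> lie_atlas G" "H x \<in> V"
    using chart_exists[OF smooth_into_carrier[OF T(4,2)]] .
  define T' where "T' = {y\<in>T. H y \<in> V}"
  have T': "open T'" unfolding T'_def by (rule smooth_into_open_preimage[OF T(4,1) chart_openin[OF V(1)]])
  have "smooth_on T' (\<lambda>y. \<psi> (H y))" unfolding T'_def by (rule smooth_into_chart[OF T(4) V(1)])
  then have "smooth_on T' (\<lambda>y. \<psi> (F y))"
    by (rule smooth_on_cong_open[OF T', rotated]) (simp add: T'_def FH)
  then show "\<exists>V \<psi> T. (V, \<psi>) \<in> lie_atlas G \<and> open T \<and> x \<in> T \<and> T \<subseteq> S \<and> F ` T \<subseteq> V \<and> smooth_on T (\<lambda>y. \<psi> (F y))"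
    using V T T' FH by (intro exI[of _ V] exI[of _ \<psi>] exI[of _ T']) (auto simp: T'_def)
qed

lemma log_deriv_eventually_chart:
  assumes F: "log_deriv G F D x" and V: "(V, \<psi>) \<in> lie_atlas G" "F x \<in> V"
  shows "\<forall>\<^sub>F y in nhds x. F y \<in> V"
proof -
  have Fx: "F x \<in> carrier G" using F by (simp add: log_deriv_def)
  define \<kappa> where "\<kappa> y = coord G (inv F x \<otimes> F y)" for y
  note e = log_deriv_expand[OF F, folded \<kappa>_def]
  define K where "K p = F x \<otimes> coord_inv G p" for p
  have K: "smooth_into G img_e K" unfolding K_def
    by (intro smooth_into_mult smooth_into_const smooth_into_coord_inv open_img_e Fx)
  have o: "open {p\<in>img_e. K p \<in> V}"
    by (rule smooth_into_open_preimage[OF K open_img_e chart_openin[OF V(1)]])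
  have "\<kappa> x \<in> {p\<in>img_e. K p \<in> V}"
    using coord_e_in V Fx by (simp add: K_def coord_inv_coord_e e(2))
  note ev = eventually_nhds_in_open[OF o this]
  have "isCont \<kappa> x" using e(1) by (rule has_derivative_continuous)
  then have "filterlim \<kappa> (nhds (\<kappa> x)) (nhds x)"
    by (simp add: continuous_at tendsto_at_iff_tendsto_nhds)
  from eventually_compose_filterlim[OF ev this] e(3)
  show ?thesis by eventually_elim (auto simp: K_def)
qed

text \<open>The quotient of \<open>F\<close> and \<open>H\<close> has logarithmic derivative zero, hence zero derivative in every chart,
  and is locally constant. This uniqueness statement replaces the one for differential equations.\<close>

lemma log_deriv_determines:
  fixes F H :: "'a::real_normed_vector \<Rightarrow> 'g"
  assumes S: "open S" "connected S" and F: "\<And>x. x \<in> S \<Longrightarrow> log_deriv G F (D x) x"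
    and H: "\<And>x. x \<in> S \<Longrightarrow> log_deriv G H (D x) x" and x0: "x0 \<in> S" "F x0 = H x0" and x: "x \<in> S"
  shows "F x = H x"
proof -
  define k where "k y = F y \<otimes> inv H y" for y
  have k0: "log_deriv G k (\<lambda>_. 0) y" if y: "y \<in> S" for y
  proof -
    have Hy: "H y \<in> carrier G" using H[OF y] by (simp add: log_deriv_def)
    have "log_deriv G k (\<lambda>h. Ad G (inv (inv H y)) (D y h) + - Ad G (H y) (D y h)) y"
      unfolding k_def by (rule log_deriv_mult[OF F[OF y] log_deriv_inv[OF H[OF y]]])
    then show ?thesis using Hy by simp
  qed
  have "k constant_on S"
  proof (rule locally_constant_imp_constant[OF S(2)])
    fix y assume y: "y \<in> S"
    have ky: "k y \<in> carrier G" using k0[OF y] by (simp add: log_deriv_def)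
    obtain V \<psi> where V: "(V, \<psi>) \<in> lie_atlas G" "k y \<in> V" using chart_exists[OF ky] .
    obtain r where r: "r > 0" "\<And>z. dist z y < r \<Longrightarrow> k z \<in> V"
      using log_deriv_eventually_chart[OF k0[OF y] V] unfolding eventually_nhds_metric by blast
    obtain r' where r': "r' > 0" "ball y r' \<subseteq> S" using S(1) y open_contains_ball by blast
    define B where "B = ball y (min r r')"
    have B: "open B" "y \<in> B" "B \<subseteq> S" "convex B" using r r' by (auto simp: B_def)
    have kV: "k z \<in> V" if "z \<in> B" for z using r(2)[of z] that by (simp add: B_def dist_commute)
    have "((\<lambda>y. \<psi> (k y)) has_derivative (\<lambda>_. 0)) (at z within B)" if "z \<in> B" for z
      using log_deriv_zero_chart[OF k0 V(1) kV[OF that]] that B(3) has_derivative_at_withinI by blast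
    from has_derivative_zero_constant[OF B(4) this]
    obtain c where "\<And>z. z \<in> B \<Longrightarrow> \<psi> (k z) = c" by blast
    then have "k z = k y" if "z \<in> B" for z
      using inj_onD[OF chart_inj[OF V(1)] _ kV[OF that] kV[OF B(2)]] that B(2) by simp
    moreover have "openin (top_of_set S) B"
      using B(1,3) S(1) by (simp add: openin_open_eq)
    ultimately show "\<exists>T. openin (top_of_set S) T \<and> y \<in> T \<and> (\<forall>z\<in>T. k z = k y)"
      using B(2) by blast
  qed
  then have "k x = k x0" using x x0(1) unfolding constant_on_def by metis
  also have "\<dots> = \<one>" using F[OF x0(1)] x0(2) by (simp add: k_def log_deriv_def r_inv)
  finally have 1: "F x \<otimes> inv H x = \<one>" by (simp add: k_def)
  have "F x \<in> carrier G" "H x \<in> carrier G" using F[OF x] H[OF x] by (simp_all add: log_deriv_def)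
  then show ?thesis using 1 inv_equality[of "F x" "inv H x"] by simp
qed

text \<open>An integral curve through the identity of the left invariant vector field with value \<open>v\<close>.\<close>

lemma local_exp_curve:
  obtains \<delta> g where "\<delta> > 0" "smooth_into G {-\<delta><..<\<delta>} g" "g 0 = \<one>"
    "\<And>t. \<bar>t\<bar> < \<delta> \<Longrightarrow> log_deriv G g (\<lambda>h. h *\<^sub>R v) t"
proof -
  let ?T = "img_e \<times> img_e"
  have T: "open ?T" by (intro open_Times open_img_e)
  define K where "K z = coord_inv G (fst z) \<otimes> coord_inv G (snd z)" for z
  have "smooth_into G ?T (\<lambda>z. coord_inv G (fst z))" "smooth_into G ?T (\<lambda>z. coord_inv G (snd z))"
    by (rule smooth_into_compose[OF smooth_into_coord_inv T open_img_e],
        auto intro!: smooth_on_linear T bounded_linear_fst bounded_linear_snd)+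
  then have K: "smooth_into G ?T K"
    unfolding K_def by (intro smooth_into_mult T)
  have Kdom: "K (p, coord_e) \<in> dom_e" if "p \<in> img_e" for p
    using coord_inv_dom_e[OF that] coord_inv_carrier[OF that] by (simp add: K_def coord_inv_coord_e)
  \<comment> \<open>In coordinates, \<open>DK p v\<close> is the left invariant vector field with value \<open>v\<close> at the identity.\<close>
  define DK where "DK p = frechet_derivative (\<lambda>q. coord G (K (p, q))) (at coord_e)" for p
  have X: "smooth_on img_e (\<lambda>p. DK p v)"
    unfolding DK_def by (rule smooth_fibre_derivative(2)[OF K open_img_e Kdom])
  obtain \<delta> y where y: "\<delta> > 0" "y 0 = coord_e" "\<And>t. \<bar>t\<bar> < \<delta> \<Longrightarrow> y t \<in> img_e"
    "\<And>t. \<bar>t\<bar> < \<delta> \<Longrightarrow> (y has_vector_derivative DK (y t) v) (at t)"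
    "smooth_on {-\<delta><..<\<delta>} y"
    by (rule ODE_local_solution[OF X open_img_e coord_e_in]) blast
  define g where "g t = coord_inv G (y t)" for t
  have "smooth_into G {-\<delta><..<\<delta>} g"
    unfolding g_def using y(3) by (intro smooth_into_compose[OF smooth_into_coord_inv _ open_img_e y(5)]) auto
  moreover have "g 0 = \<one>" by (simp add: g_def y coord_inv_coord_e)
  moreover have "log_deriv G g (\<lambda>h. h *\<^sub>R v) t" if t: "\<bar>t\<bar> < \<delta>" for t
  proof -
    have gt: "g t \<in> carrier G" unfolding g_def by (rule coord_inv_carrier[OF y(3)[OF t]])
    define \<Lambda> where "\<Lambda> q = inv g t \<otimes> coord_inv G q" for q
    have \<Lambda>: "smooth_into G img_e \<Lambda>" unfolding \<Lambda>_def
      by (intro smooth_into_mult smooth_into_const smooth_into_coord_inv open_img_e inv_closed gt)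
    have \<Lambda>1: "\<Lambda> (y t) = \<one>" using gt unfolding \<Lambda>_def g_def[symmetric] by (rule l_inv)
    define L where "L = frechet_derivative (\<lambda>y. coord G (\<Lambda> y)) (at (y t))"
    have L: "((\<lambda>y. coord G (\<Lambda> y)) has_derivative L) (at (y t))"
      unfolding L_def by (rule smooth_into_dom_e(2)[OF \<Lambda> open_img_e y(3)[OF t] \<Lambda>1])
    \<comment> \<open>\<open>\<Lambda>\<close> undoes left multiplication by \<open>g t\<close>, so it sends the value of the field at \<open>g t\<close> back to \<open>v\<close>.\<close>
    have "((\<lambda>q. coord G (K (y t, q))) has_derivative DK (y t)) (at coord_e)"
      unfolding DK_def by (rule smooth_fibre_derivative(1)[OF K open_img_e Kdom y(3)[OF t]])
    moreover have "coord G (K (y t, coord_e)) = y t"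
      using gt by (simp add: K_def coord_inv_coord_e g_def coord_coord_inv[OF y(3)[OF t]])
    ultimately have "((\<lambda>q. coord G (\<Lambda> (coord G (K (y t, q))))) has_derivative
        (\<lambda>u. L (DK (y t) u))) (at coord_e)"
      using has_derivative_compose[where g = "\<lambda>y. coord G (\<Lambda> y)" and g' = L] L by fastforce
    moreover have "\<forall>\<^sub>F q in nhds coord_e. coord G (\<Lambda> (coord G (K (y t, q)))) = q"
    proof -
      have "smooth_into G img_e (\<lambda>q. g t \<otimes> coord_inv G q)"
        by (intro smooth_into_mult smooth_into_const smooth_into_coord_inv open_img_e gt)
      from smooth_into_open_preimage[OF this open_img_e chart_openin[OF chart_at_one]]
      have "open {q\<in>img_e. g t \<otimes> coord_inv G q \<in> dom_e}" .
      moreover have "coord_e \<in> {q\<in>img_e. g t \<otimes> coord_inv G q \<in> dom_e}"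
        using coord_e_in gt coord_inv_dom_e[OF y(3)[OF t]] by (simp add: coord_inv_coord_e g_def)
      ultimately have "\<forall>\<^sub>F q in nhds coord_e. q \<in> {q\<in>img_e. g t \<otimes> coord_inv G q \<in> dom_e}"
        by (rule eventually_nhds_in_open)
      then show ?thesis
        by eventually_elim (use gt in \<open>auto simp: K_def \<Lambda>_def g_def[symmetric] coord_inv_coord m_assoc[symmetric] l_inv coord_inv_carrier coord_coord_inv coord_inv_dom_e
             dom_e_carrier[THEN subsetD]\<close>)
    qed
    ultimately have "((\<lambda>q. q) has_derivative
        (\<lambda>u. L (DK (y t) u))) (at coord_e)"
      by (rule has_derivative_transform_nhds)
    from has_derivative_unique[OF this has_derivative_ident]
    have LX: "L (DK (y t) v) = v" by metis
    have "log_deriv G g (\<lambda>h. L (h *\<^sub>R DK (y t) v)) t"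
    proof (rule log_derivI[where K = \<Lambda> and T = img_e and \<alpha> = y and D = L
          and A = "\<lambda>h. h *\<^sub>R DK (y t) v"])
      show "g t \<in> carrier G" by (rule gt)
      have "t \<in> {-\<delta><..<\<delta>}" using t by auto
      from eventually_nhds_in_open[OF open_greaterThanLessThan this]
      show "\<forall>\<^sub>F s in nhds t. g s \<in> carrier G \<and> inv g t \<otimes> g s = \<Lambda> (y s)"
      proof eventually_elim
        case (elim s)
        then have "g s \<in> carrier G" unfolding g_def by (intro coord_inv_carrier y(3)) auto
        then show ?case by (simp add: \<Lambda>_def g_def)
      qed
      show "(y has_derivative (\<lambda>h. h *\<^sub>R DK (y t) v)) (at t)"
        using y(4)[OF t] by (simp add: has_vector_derivative_def)
    qed (use \<Lambda> open_img_e y(3)[OF t] L in simp_all)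
    moreover have "L (h *\<^sub>R DK (y t) v) = h *\<^sub>R v" for h
      using linear_cmul[OF has_derivative_linear[OF L]] LX by simp
    ultimately show ?thesis by simp
  qed
  ultimately show ?thesis using that y(1) by blast
qed


text \<open>One-parameter subgroups, described by their logarithmic derivative rather than by the homomorphism
  property, so that \<open>log_deriv_determines\<close> applies to them directly.\<close>

definition exp_curve :: "complex^'n \<Rightarrow> (real \<Rightarrow> 'g) \<Rightarrow> bool" where
  "exp_curve v \<gamma> \<longleftrightarrow> \<gamma> 0 = \<one> \<and> (\<forall>t. log_deriv G \<gamma> (\<lambda>h. h *\<^sub>R v) t)"

lemma exp_curve_unique: "exp_curve v \<gamma> \<Longrightarrow> exp_curve v \<gamma>' \<Longrightarrow> \<gamma> t = \<gamma>' t"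
  by (rule log_deriv_determines[where S = UNIV and D = "\<lambda>_ h. h *\<^sub>R v" and ?x0.0 = 0])
     (simp_all add: exp_curve_def)

lemma log_deriv_shift:
  assumes "log_deriv G \<gamma> (\<lambda>h. h *\<^sub>R v) (s + t)"
  shows "log_deriv G (\<lambda>t. \<gamma> (s + t)) (\<lambda>h :: real. h *\<^sub>R v) t"
proof -
  have "((\<lambda>t. s + t) has_derivative (\<lambda>h. h)) (at t)"
    by (auto intro!: derivative_eq_intros)
  from log_deriv_compose[where f = "\<lambda>t. s + t", OF assms this] show ?thesis .
qed

text \<open>By uniqueness the local curve \<open>g\<close> is additive near \<open>0\<close>, so that \<open>g (t / N) [^] N\<close> does not depend on
  the large number \<open>N\<close> and extends \<open>g\<close> to a homomorphism on the whole line.\<close>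

lemma global_exp_curve:
  obtains \<gamma> where "exp_curve v \<gamma>" "smooth_into G UNIV \<gamma>" "\<And>s t. \<gamma> (s + t) = \<gamma> s \<otimes> \<gamma> t"
proof -
  obtain \<delta> g where \<delta>: "\<delta> > 0" and g: "smooth_into G {-\<delta><..<\<delta>} g" "g 0 = \<one>"
    "\<And>t. \<bar>t\<bar> < \<delta> \<Longrightarrow> log_deriv G g (\<lambda>h. h *\<^sub>R v) t"
    by (rule local_exp_curve[of v]) blast
  define \<eta> where "\<eta> = \<delta> / 2"
  have \<eta>: "\<eta> > 0" "2 * \<eta> = \<delta>" using \<delta> by (simp_all add: \<eta>_def)
  have gc: "g t \<in> carrier G" if "\<bar>t\<bar> < \<delta>" for t using g(3)[OF that] by (simp add: log_deriv_def)
  \<comment> \<open>For fixed \<open>s\<close> both sides are curves in \<open>t\<close> with logarithmic derivative \<open>v\<close>.\<close>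
  have gadd: "g (s + t) = g s \<otimes> g t" if s: "\<bar>s\<bar> < \<eta>" and t: "\<bar>t\<bar> < \<eta>" for s t
  proof (rule log_deriv_determines[where S = "{-\<eta><..<\<eta>}" and D = "\<lambda>_ h. h *\<^sub>R v" and ?x0.0 = 0 and x = t
        and F = "\<lambda>t. g (s + t)" and H = "\<lambda>t. g s \<otimes> g t"])
    fix u assume u: "u \<in> {-\<eta><..<\<eta>}"
    show "log_deriv G (\<lambda>t. g (s + t)) (\<lambda>h. h *\<^sub>R v) u"
      using s u \<eta> by (intro log_deriv_shift g(3)) auto
    show "log_deriv G (\<lambda>t. g s \<otimes> g t) (\<lambda>h. h *\<^sub>R v) u"
      using s u \<eta> by (intro log_deriv_mult_left g(3) gc) auto
  qed (use s t \<eta> gc[of s] g(2) in auto)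
  have gpow: "g (real k * u) = g u [^] k" if "\<bar>real k * u\<bar> < \<eta>" for k u
    using that
  proof (induction k)
    case 0
    then show ?case by (simp add: g(2))
  next
    case (Suc k)
    show ?case
    proof (cases "k = 0")
      case True
      then show ?thesis using Suc.prems gc[of u] \<eta> by simp
    next
      case False
      have "\<bar>real k * u\<bar> \<le> \<bar>real (Suc k) * u\<bar>"
        by (simp add: abs_mult mult_right_mono)
      then have k: "\<bar>real k * u\<bar> < \<eta>" using Suc.prems by linarith
      have "1 * \<bar>u\<bar> \<le> real (Suc k) * \<bar>u\<bar>" by (intro mult_right_mono) auto
      then have u: "\<bar>u\<bar> < \<eta>" using Suc.prems by (simp add: abs_mult)
      have "g (real (Suc k) * u) = g (real k * u + u)" by (simp add: algebra_simps)
      also have "\<dots> = g u [^] k \<otimes> g u" by (simp add: gadd[OF k u] Suc.IH[OF k])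
      finally show ?thesis by simp
    qed
  qed
  define \<gamma> where "\<gamma> t = (let N = (SOME N. N > 0 \<and> \<bar>t / real N\<bar> < \<eta>) in g (t / real N) [^] N)" for t
  \<comment> \<open>Any two admissible subdivisions have a common refinement.\<close>
  have \<gamma>: "\<gamma> t = g (t / real N) [^] N" if N: "N > 0" "\<bar>t / real N\<bar> < \<eta>" for t N
  proof -
    define M where "M = (SOME N. N > 0 \<and> \<bar>t / real N\<bar> < \<eta>)"
    have M: "M > 0" "\<bar>t / real M\<bar> < \<eta>"
      using someI[of "\<lambda>N. N > 0 \<and> \<bar>t / real N\<bar> < \<eta>" N] N unfolding M_def by blast+
    have aux: "g (t / real N) [^] N = g (t / real (M * N)) [^] (M * N)" if "N > 0" "M > 0" "\<bar>t / real N\<bar> < \<eta>" for M N :: nat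
    proof -
      have e: "real M * (t / real (M * N)) = t / real N" using that by simp
      have "1 * \<bar>t / real (M * N)\<bar> \<le> real M * \<bar>t / real (M * N)\<bar>" using that by (intro mult_right_mono) auto
      also have "\<dots> = \<bar>t / real N\<bar>" using that by (simp add: abs_mult)
      finally have c: "g (t / real (M * N)) \<in> carrier G" using gc that(3) \<eta> by simp
      have "g (t / real N) = g (t / real (M * N)) [^] M"
        using gpow[of M "t / real (M * N)"] that(3) unfolding e by simp
      then show ?thesis using c by (simp add: nat_pow_pow)
    qed
    have "\<gamma> t = g (t / real M) [^] M" by (simp add: \<gamma>_def M_def Let_def)
    also have "\<dots> = g (t / real N) [^] N"
      using aux[OF N(1) M(1) N(2)] aux[OF M(1) N(1) M(2)] by (simp add: mult.commute)
    finally show ?thesis .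
  qed
  have ex: "\<exists>N0>0. \<forall>N\<ge>N0. \<bar>t / real N\<bar> < \<eta>" for t
  proof -
    obtain N0 :: nat where N0: "\<bar>t\<bar> / \<eta> < real N0" using reals_Archimedean2 by blast
    have "\<bar>t / real N\<bar> < \<eta>" if "N \<ge> Suc N0" for N
    proof -
      have "\<bar>t\<bar> / \<eta> < real N" using N0 that by linarith
      then have "\<bar>t\<bar> < \<eta> * real N" using \<eta> by (simp add: pos_divide_less_eq mult.commute)
      then show ?thesis using that by (simp add: pos_divide_less_eq)
    qed
    then show ?thesis by (intro exI[of _ "Suc N0"]) auto
  qed
  have \<gamma>add: "\<gamma> (s + t) = \<gamma> s \<otimes> \<gamma> t" for s t
  proof -
    obtain N1 N2 N3 where N: "N1 > 0" "\<And>N. N \<ge> N1 \<Longrightarrow> \<bar>s / real N\<bar> < \<eta>"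
      "\<And>N. N \<ge> N2 \<Longrightarrow> \<bar>t / real N\<bar> < \<eta>" "\<And>N. N \<ge> N3 \<Longrightarrow> \<bar>(s + t) / real N\<bar> < \<eta>"
      using ex[of s] ex[of t] ex[of "s + t"] by blast
    define N where "N = N1 + N2 + N3"
    have "N1 \<le> N" "N2 \<le> N" "N3 \<le> N" by (simp_all add: N_def)
    then have N': "N > 0" "\<bar>s / real N\<bar> < \<eta>" "\<bar>t / real N\<bar> < \<eta>" "\<bar>(s + t) / real N\<bar> < \<eta>"
      using N by (auto simp del: abs_divide)
    have c: "g (s / real N) \<in> carrier G" "g (t / real N) \<in> carrier G" using gc N' \<eta> by auto
    have a: "g ((s + t) / real N) = g (s / real N) \<otimes> g (t / real N)"
      using gadd[OF N'(2,3)] by (simp add: add_divide_distrib)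
    have "g (s / real N) \<otimes> g (t / real N) = g (t / real N) \<otimes> g (s / real N)"
      using gadd[OF N'(2,3)] gadd[OF N'(3,2)] by (simp add: add.commute)
    from pow_mult_distrib[OF this c, of N]
    show ?thesis using \<gamma>[OF N'(1,2)] \<gamma>[OF N'(1,3)] \<gamma>[OF N'(1,4)] a by simp
  qed
  have \<gamma>g: "\<gamma> t = g t" if "\<bar>t\<bar> < \<eta>" for t
    using \<gamma>[of 1 t] that gc[of t] \<eta> by simp
  have \<gamma>c: "\<gamma> t \<in> carrier G" for t
  proof -
    obtain N0 where "N0 > 0" "\<bar>t / real N0\<bar> < \<eta>" using ex[of t] by blast
    then show ?thesis using \<gamma>[of N0 t] gc[of "t / real N0"] \<eta> by simp
  qed
  have near: "\<gamma> s = \<gamma> t \<otimes> g (s - t)" if "\<bar>s - t\<bar> < \<eta>" for s t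
    using \<gamma>add[of t "s - t"] \<gamma>g[OF that] by simp
  have "smooth_into G UNIV \<gamma>"
  proof (rule smooth_into_local[OF open_UNIV])
    fix t :: real
    let ?T = "{t - \<eta><..<t + \<eta>}"
    have sub: "(\<lambda>s. s - t) ` ?T \<subseteq> {-\<delta><..<\<delta>}" using \<eta> by auto
    have "smooth_on ?T (\<lambda>s. s + (- t))"
      by (intro smooth_on_add smooth_on_ident smooth_on_const) auto
    then have "smooth_into G ?T (\<lambda>s. g (s - t))"
      using smooth_into_compose[where f = "\<lambda>s. s - t" and S = ?T, OF g(1)] sub by simp
    then have "smooth_into G ?T (\<lambda>s. \<gamma> t \<otimes> g (s - t))"
      by (intro smooth_into_mult smooth_into_const \<gamma>c) auto
    then show "\<exists>T H. open T \<and> t \<in> T \<and> T \<subseteq> UNIV \<and> smooth_into G T H \<and> (\<forall>y\<in>T. \<gamma> y = H y)"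
      using \<eta> near by (intro exI[of _ ?T] exI[of _ "\<lambda>s. \<gamma> t \<otimes> g (s - t)"]) (auto simp: abs_less_iff)
  qed
  moreover have "log_deriv G \<gamma> (\<lambda>h. h *\<^sub>R v) t" for t
  proof -
    have "log_deriv G (\<lambda>s. g (- t + s)) (\<lambda>h. h *\<^sub>R v) t"
      by (rule log_deriv_shift, rule g(3)) (use \<delta> in simp)
    then have "log_deriv G (\<lambda>s. \<gamma> t \<otimes> g (- t + s)) (\<lambda>h. h *\<^sub>R v) t"
      by (rule log_deriv_mult_left[OF \<gamma>c])
    moreover have "t \<in> {t - \<eta><..<t + \<eta>}" using \<eta> by simp
    from eventually_nhds_in_open[OF open_greaterThanLessThan this]
    have "\<forall>\<^sub>F s in nhds t. \<gamma> t \<otimes> g (- t + s) = \<gamma> s"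
    proof eventually_elim
      case (elim s)
      then show ?case using near[of s t] by (simp add: abs_less_iff)
    qed
    ultimately show ?thesis by (rule log_deriv_cong)
  qed
  moreover have "\<gamma> 0 = \<one>" using \<gamma>g[of 0] \<eta> g(2) by simp
  ultimately show ?thesis using that \<gamma>add unfolding exp_curve_def by blast
qed

lemma one_parameter_subgroup_exp_curve:
  assumes \<gamma>: "one_parameter_subgroup G \<gamma>" and v: "((\<lambda>s. coord G (\<gamma> s)) has_vector_derivative v) (at 0)"
  shows "exp_curve v \<gamma>"
proof -
  have sm: "smooth_into G UNIV \<gamma>" and add: "\<And>s t. \<gamma> (s + t) = \<gamma> s \<otimes> \<gamma> t"
    using \<gamma> by (auto simp: one_parameter_subgroup_def)
  have c: "\<gamma> t \<in> carrier G" for t by (rule smooth_into_carrier[OF sm UNIV_I])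
  have 0: "\<gamma> 0 = \<one>" using add[of 0 0] c[of 0] by simp
  obtain D where D: "log_deriv G \<gamma> D 0"
    using smooth_into_log_deriv[OF sm open_UNIV UNIV_I] by blast
  have "((\<lambda>s. coord G (\<gamma> s)) has_derivative D) (at 0)"
    using D c by (simp add: log_deriv_def 0)
  then have "D = (\<lambda>h. h *\<^sub>R v)"
    using v has_derivative_unique unfolding has_vector_derivative_def by blast
  then have D: "log_deriv G \<gamma> (\<lambda>h. h *\<^sub>R v) 0" using D by simp
  have "log_deriv G \<gamma> (\<lambda>h. h *\<^sub>R v) t" for t
  proof -
    have "log_deriv G (\<lambda>s. \<gamma> t \<otimes> \<gamma> (- t + s)) (\<lambda>h. h *\<^sub>R v) t"
      by (rule log_deriv_mult_left[OF c], rule log_deriv_shift) (simp add: D)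
    then show ?thesis using add[of t, symmetric] by simp
  qed
  then show ?thesis using 0 by (simp add: exp_curve_def)
qed

text \<open>The definite description in \<open>lie_exp\<close> is justified: it picks the only curve there is.\<close>

lemma exp_curve_one:
  assumes \<gamma>: "exp_curve v \<gamma>"
  shows "lie_exp G v = \<gamma> 1"
proof -
  obtain \<gamma>' where \<gamma>': "exp_curve v \<gamma>'" "smooth_into G UNIV \<gamma>'" "\<And>s t. \<gamma>' (s + t) = \<gamma>' s \<otimes> \<gamma>' t"
    by (rule global_exp_curve[of v]) blast
  have c: "\<gamma>' t \<in> carrier G" for t by (rule smooth_into_carrier[OF \<gamma>'(2) UNIV_I])
  have 1: "one_parameter_subgroup G \<gamma>'" using \<gamma>' by (simp add: one_parameter_subgroup_def)
  have 2: "((\<lambda>s. coord G (\<gamma>' s)) has_vector_derivative v) (at 0)"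
  proof -
    have "\<gamma>' 0 = \<one>" "log_deriv G \<gamma>' (\<lambda>h. h *\<^sub>R v) 0" using \<gamma>'(1) by (simp_all add: exp_curve_def)
    then show ?thesis by (simp add: log_deriv_def has_vector_derivative_def c)
  qed
  have "(THE \<gamma>. one_parameter_subgroup G \<gamma> \<and> ((\<lambda>s. coord G (\<gamma> s)) has_vector_derivative v) (at 0)) = \<gamma>'"
  proof (rule the_equality)
    show "one_parameter_subgroup G \<gamma>' \<and> ((\<lambda>s. coord G (\<gamma>' s)) has_vector_derivative v) (at 0)"
      using 1 2 by blast
    fix \<alpha> assume "one_parameter_subgroup G \<alpha> \<and> ((\<lambda>s. coord G (\<alpha> s)) has_vector_derivative v) (at 0)"
    then have "exp_curve v \<alpha>" by (blast intro: one_parameter_subgroup_exp_curve)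
    then show "\<alpha> = \<gamma>'" using exp_curve_unique[OF _ \<gamma>'(1)] by blast
  qed
  then show ?thesis using exp_curve_unique[OF \<gamma>'(1) \<gamma>] by (simp add: lie_exp_def)
qed

lemma exp_curve_scale:
  assumes "exp_curve v \<gamma>"
  shows "exp_curve (s *\<^sub>R v) (\<lambda>t. \<gamma> (s * t))"
proof -
  have "log_deriv G (\<lambda>t. \<gamma> (s * t)) (\<lambda>h. (s * h) *\<^sub>R v) t" for t
    by (rule log_deriv_compose[where f = "\<lambda>t. s * t" and A = "\<lambda>h. s * h" and D = "\<lambda>h. h *\<^sub>R v"])
       (use assms in \<open>auto simp: exp_curve_def intro!: derivative_eq_intros\<close>)
  then show ?thesis using assms by (simp add: exp_curve_def mult.commute)
qed

lemma exp_curve_lie_exp: "exp_curve v (\<lambda>s. lie_exp G (s *\<^sub>R v))"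
proof -
  obtain \<gamma> where \<gamma>: "exp_curve v \<gamma>" by (rule global_exp_curve[of v]) blast
  have "lie_exp G (s *\<^sub>R v) = \<gamma> s" for s
    using exp_curve_one[OF exp_curve_scale[OF \<gamma>, of s]] by simp
  then show ?thesis using \<gamma> by presburger
qed

lemma lie_exp_eqI: "exp_curve v \<gamma> \<Longrightarrow> lie_exp G (s *\<^sub>R v) = \<gamma> s"
  by (rule exp_curve_unique[OF exp_curve_lie_exp])

lemma lie_exp_log_deriv: "log_deriv G (\<lambda>s. lie_exp G (s *\<^sub>R v)) (\<lambda>h. h *\<^sub>R v) t"
  using exp_curve_lie_exp by (simp add: exp_curve_def)

lemma lie_exp_zero: "lie_exp G 0 = \<one>"
  using exp_curve_lie_exp[of 0] by (simp add: exp_curve_def)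

lemma lie_exp_carrier: "lie_exp G v \<in> carrier G"
  using log_deriv_carrier[OF lie_exp_log_deriv[of v 1]] by simp

lemma lie_exp_add_scale: "lie_exp G ((s + t) *\<^sub>R v) = lie_exp G (s *\<^sub>R v) \<otimes> lie_exp G (t *\<^sub>R v)"
proof -
  obtain \<gamma> where \<gamma>: "exp_curve v \<gamma>" "\<And>s t. \<gamma> (s + t) = \<gamma> s \<otimes> \<gamma> t" by (rule global_exp_curve[of v]) blast
  then show ?thesis by (simp only: lie_exp_eqI[OF \<gamma>(1)])
qed

text \<open>\<open>exp (s u)\<close> commutes with \<open>exp (r u)\<close>. Differentiating in \<open>r\<close> shows that \<open>Ad (exp (s u))\<close> fixes \<open>u\<close>;
  differentiating that in \<open>s\<close> gives the bracket. Antisymmetry follows by polarization.\<close>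

lemma lie_bracket_self: "lie_bracket G u u = 0"
proof -
  let ?e = "\<lambda>s. lie_exp G (s *\<^sub>R u)"
  have "Ad G (?e s) u = u" for s
  proof -
    have "log_deriv G (\<lambda>r. ?e s \<otimes> ?e r \<otimes> inv (?e s)) (\<lambda>h. Ad G (?e s) (h *\<^sub>R u)) 0"
      by (rule log_deriv_conj[OF lie_exp_carrier lie_exp_log_deriv])
    moreover have "?e s \<otimes> ?e r \<otimes> inv (?e s) = ?e r" for r
    proof -
      have "?e s \<otimes> ?e r = ?e r \<otimes> ?e s"
        by (simp add: lie_exp_add_scale[symmetric] add.commute)
      then show ?thesis by (simp add: m_assoc lie_exp_carrier r_inv)
    qed
    ultimately have "log_deriv G ?e (\<lambda>h. Ad G (?e s) (h *\<^sub>R u)) 0" by simp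
    from fun_cong[OF log_deriv_unique[OF this lie_exp_log_deriv], of 1] show ?thesis by simp
  qed
  then have "((\<lambda>s. u) has_derivative (\<lambda>h. Ad G (?e 0) (lie_bracket G (h *\<^sub>R u) u))) (at 0)"
    using log_deriv_Ad[OF lie_exp_log_deriv[of u 0], of u] by simp
  from fun_cong[OF has_derivative_unique[OF this has_derivative_const], of 1]
  show ?thesis by (simp add: lie_exp_zero Ad_one)
qed

lemma lie_bracket_left:
  shows lie_bracket_add_left: "lie_bracket G (u + w) v = lie_bracket G u v + lie_bracket G w v"
    and lie_bracket_scaleR_left: "lie_bracket G (s *\<^sub>R u) v = s *\<^sub>R lie_bracket G u v"
    and lie_bracket_zero_left: "lie_bracket G 0 v = 0"
proof -
  have l: "linear (\<lambda>u. lie_bracket G u v)"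
    by (rule bounded_linear.linear[OF lie_bracket_linear_left])
  show "lie_bracket G (u + w) v = lie_bracket G u v + lie_bracket G w v" by (rule linear_add[OF l])
  show "lie_bracket G (s *\<^sub>R u) v = s *\<^sub>R lie_bracket G u v" by (rule linear_cmul[OF l])
  show "lie_bracket G 0 v = 0" by (rule linear_0[OF l])
qed

lemma lie_bracket_antisym: "lie_bracket G u v = - lie_bracket G v u"
proof -
  have "lie_bracket G (u + v) (u + v) = lie_bracket G u v + lie_bracket G v u"
    by (simp only: lie_bracket_add_left lie_bracket_add_right) (simp add: lie_bracket_self)
  then show ?thesis by (simp only: lie_bracket_self) (simp add: eq_neg_iff_add_eq_0)
qed

text \<open>Linearity over the complex numbers is clear in the second argument, where it is that of \<open>Ad\<close>;
  antisymmetry carries it over to the first.\<close>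

lemma lie_bracket_scale_left: "lie_bracket G (z *s u) v = z *s lie_bracket G u v"
proof -
  have "lie_bracket G (z *s u) v = - (z *s lie_bracket G v u)"
    by (subst lie_bracket_antisym) (simp add: lie_bracket_scale_right)
  also have "\<dots> = z *s lie_bracket G u v"
    by (subst (2) lie_bracket_antisym) (simp add: vec_eq_iff)
  finally show ?thesis .
qed

lemma Ad_lie_exp_fixed:
  assumes "lie_bracket G u v = 0"
  shows "Ad G (lie_exp G (s *\<^sub>R u)) v = v"
proof -
  have "((\<lambda>s. Ad G (lie_exp G (s *\<^sub>R u)) v) has_derivative (\<lambda>_. 0)) (at s within UNIV)" for s
    using log_deriv_Ad[OF lie_exp_log_deriv[of u s], of v] assms
    by (simp add: lie_bracket_scaleR_left Ad_linear lie_exp_carrier)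
  then have "\<exists>c. \<forall>s\<in>UNIV. Ad G (lie_exp G (s *\<^sub>R u)) v = c"
    by (intro has_derivative_zero_constant[OF convex_UNIV])
  then obtain c where c: "\<forall>s\<in>UNIV. Ad G (lie_exp G (s *\<^sub>R u)) v = c" by (elim exE)
  have "Ad G (lie_exp G (s *\<^sub>R u)) v = Ad G (lie_exp G (0 *\<^sub>R u)) v"
    using bspec[OF c UNIV_I[of s]] bspec[OF c UNIV_I[of 0]] by (rule trans[OF _ sym])
  then show ?thesis by (simp add: lie_exp_zero Ad_one)
qed

text \<open>As \<open>Ad (exp (s v))\<close> fixes \<open>u\<close>, the product of the two curves has logarithmic derivative \<open>u + v\<close>.\<close>

lemma lie_exp_add_commuting:
  assumes uv: "lie_bracket G u v = 0"
  shows "lie_exp G (u + v) = lie_exp G u \<otimes> lie_exp G v"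
proof -
  have vu: "lie_bracket G v u = 0" using lie_bracket_antisym[of v u] uv by simp
  let ?a = "\<lambda>s. lie_exp G (s *\<^sub>R u)" and ?b = "\<lambda>s. lie_exp G (s *\<^sub>R v)"
  have "log_deriv G (\<lambda>s. ?a s \<otimes> ?b s) (\<lambda>h. h *\<^sub>R (u + v)) s" for s
  proof -
    have "Ad G (inv (?b s)) u = u"
      using Ad_inv(2)[OF lie_exp_carrier, of "s *\<^sub>R v" u] by (simp add: Ad_lie_exp_fixed[OF vu])
    then show ?thesis
      using log_deriv_mult[OF lie_exp_log_deriv[of u s] lie_exp_log_deriv[of v s]]
      by (simp add: Ad_linear lie_exp_carrier scaleR_add_right)
  qed
  then have "exp_curve (u + v) (\<lambda>s. ?a s \<otimes> ?b s)"
    by (simp add: exp_curve_def lie_exp_zero)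
  from exp_curve_one[OF this] show ?thesis by simp
qed

text \<open>\<open>\<theta>\<close> maps the curve \<open>exp (s v)\<close> to \<open>exp (s d\<theta>(v))\<close>, and a one-parameter subgroup determines its
  velocity.\<close>

lemma lie_algebra_of_fixed_points:
  assumes \<theta>: "\<theta> \<in> hom G G" "smooth_self_map G \<theta>"
  shows "lie_algebra_of G {g\<in>carrier G. \<theta> g = g} = {v. diff_at_one G \<theta> v = v}"
proof -
  interpret \<theta>: group_hom G G \<theta>
    using \<theta>(1) by unfold_locales
  have lin: "diff_at_one G \<theta> (h *\<^sub>R v) = h *\<^sub>R diff_at_one G \<theta> v" for h v
    using bounded_linear.linear[OF diff_at_one_linear[OF \<theta>]] by (simp add: linear_cmul)
  have ld: "log_deriv G (\<lambda>s. \<theta> (lie_exp G (s *\<^sub>R v))) (\<lambda>h. h *\<^sub>R diff_at_one G \<theta> v) t" for t v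
    using log_deriv_hom[OF \<theta> lie_exp_log_deriv, of v t] by (simp add: lin)
  show ?thesis
  proof (intro Set.set_eqI iffI)
    fix v assume "v \<in> lie_algebra_of G {g\<in>carrier G. \<theta> g = g}"
    then have "\<theta> (lie_exp G (s *\<^sub>R v)) = lie_exp G (s *\<^sub>R v)" for s by (simp add: lie_algebra_of_def)
    then have "log_deriv G (\<lambda>s. lie_exp G (s *\<^sub>R v)) (\<lambda>h. h *\<^sub>R diff_at_one G \<theta> v) 0"
      using ld[of v 0] by simp
    from fun_cong[OF log_deriv_unique[OF this lie_exp_log_deriv], of 1]
    show "v \<in> {v. diff_at_one G \<theta> v = v}" by simp
  next
    fix v assume "v \<in> {v. diff_at_one G \<theta> v = v}"
    then have "exp_curve v (\<lambda>s. \<theta> (lie_exp G (s *\<^sub>R v)))"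
      using ld[of v] by (simp add: exp_curve_def lie_exp_zero)
    from lie_exp_eqI[OF this] show "v \<in> lie_algebra_of G {g\<in>carrier G. \<theta> g = g}"
      by (simp add: lie_algebra_of_def lie_exp_carrier)
  qed
qed

end

section \<open>Holomorphic functions depending on a parameter\<close>

lemma has_vector_derivative_at_0I:
  fixes f :: "real \<Rightarrow> 'a::real_normed_vector"
  assumes "((\<lambda>s. (f s - f 0) /\<^sub>R s) \<longlongrightarrow> d) (at 0)"
  shows "(f has_vector_derivative d) (at 0)"
proof -
  have "((\<lambda>s. norm ((f s - f 0) /\<^sub>R s - d)) \<longlongrightarrow> 0) (at 0)"
    using assms by (intro tendsto_norm_zero) (simp add: LIM_zero)
  moreover have "\<forall>\<^sub>F s in at 0. norm ((f s - f 0) /\<^sub>R s - d) = norm (f s - f 0 - (s - 0) *\<^sub>R d) / norm (s - 0)"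
  proof -
    have "norm ((f s - f 0) /\<^sub>R s - d) = norm (f s - f 0 - (s - 0) *\<^sub>R d) / norm (s - 0)" if "s \<noteq> 0" for s
    proof -
      have "(f s - f 0) /\<^sub>R s - d = (f s - f 0 - (s - 0) *\<^sub>R d) /\<^sub>R s"
        using that by (simp add: scaleR_diff_right)
      then show ?thesis by (simp add: divide_inverse mult.commute)
    qed
    then show ?thesis by (simp add: eventually_at_filter)
  qed
  ultimately have "((\<lambda>s. norm (f s - f 0 - (s - 0) *\<^sub>R d) / norm (s - 0)) \<longlongrightarrow> 0) (at 0)"
    by (rule Lim_transform_eventually)
  then show ?thesis
    by (simp add: has_vector_derivative_def has_derivative_iff_norm bounded_linear_scaleR_left)
qed

text \<open>The difference quotients in \<open>s\<close> converge uniformly on compact discs, so Weierstrass's theorem on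
  uniform limits of holomorphic functions gives both claims at once.\<close>

lemma holomorphic_parameter_derivative:
  fixes h h' :: "real \<Rightarrow> complex \<Rightarrow> complex"
  assumes \<delta>: "\<delta> > 0" and S: "open S"
    and holo: "\<And>s. \<bar>s\<bar> < \<delta> \<Longrightarrow> h s holomorphic_on S"
    and D: "\<And>s w. \<bar>s\<bar> < \<delta> \<Longrightarrow> w \<in> S \<Longrightarrow> ((\<lambda>s. h s w) has_vector_derivative h' s w) (at s)"
    and cont: "continuous_on ({-\<delta><..<\<delta>} \<times> S) (\<lambda>(s, w). h' s w)"
  shows "h' 0 holomorphic_on S"
    and "z \<in> S \<Longrightarrow> ((\<lambda>s. (deriv ^^ n) (h s) z) has_vector_derivative (deriv ^^ n) (h' 0) z) (at 0)"
proof -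
  \<comment> \<open>For \<open>s = 0\<close> the division by zero makes \<open>q\<close> vanish, which is still holomorphic.\<close>
  define q where "q s w = (1 / of_real s) * (h s w - h 0 w)" for s :: real and w
  have ul: "uniform_limit (cball z r) q (h' 0) (at 0)" if r: "cball z r \<subseteq> S" for z r
  proof (rule uniform_limitI)
    fix e :: real assume e: "e > 0"
    let ?K = "{-\<delta>/2..\<delta>/2} \<times> cball z r"
    have "compact ?K" by (intro compact_Times compact_Icc compact_cball)
    moreover have "continuous_on ?K (\<lambda>(s, w). h' s w)"
      by (rule continuous_on_subset[OF cont]) (use r \<delta> in auto)
    ultimately have "uniformly_continuous_on ?K (\<lambda>(s, w). h' s w)"
      by (rule compact_uniformly_continuous[rotated])
    then obtain d where d: "d > 0"
      "\<And>x y. x \<in> ?K \<Longrightarrow> y \<in> ?K \<Longrightarrow> dist y x < d \<Longrightarrow> dist ((\<lambda>(s, w). h' s w) y) ((\<lambda>(s, w). h' s w) x) < e / 2"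
      unfolding uniformly_continuous_on_def using e half_gt_zero by metis
    define d' where "d' = min d (\<delta> / 2)"
    have d': "d' > 0" using d(1) \<delta> by (simp add: d'_def)
    have "dist (q s w) (h' 0 w) < e" if s: "s \<noteq> 0" "dist s 0 < d'" and w: "w \<in> cball z r" for s w
    proof -
      have sd: "\<bar>s\<bar> < d" "\<bar>s\<bar> < \<delta> / 2" using s by (simp_all add: d'_def)
      have seg: "u \<in> closed_segment 0 s \<Longrightarrow> \<bar>u\<bar> \<le> \<bar>s\<bar>" for u
        by (auto simp: closed_segment_eq_real_ivl split: if_splits)
      have "norm (h s w - h 0 w - (s - 0) *\<^sub>R h' 0 w) \<le> norm (s - 0) * (e / 2)"
      proof (rule vector_differentiable_bound_linearization[where S = "closed_segment 0 s" and f = "\<lambda>s. h s w" and f' = "\<lambda>s. h' s w"])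
        show "((\<lambda>s. h s w) has_vector_derivative h' u w) (at u within closed_segment 0 s)" if "u \<in> closed_segment 0 s" for u
          by (rule has_vector_derivative_at_within[OF D]) (use seg[OF that] sd(2) \<delta> r w in auto)
        show "norm (h' u w - h' 0 w) \<le> e / 2" if "u \<in> closed_segment 0 s" for u
        proof -
          have "\<bar>u\<bar> \<le> \<bar>s\<bar>" by (rule seg[OF that])
          then have "\<bar>u\<bar> \<le> \<delta> / 2" "\<bar>u\<bar> < d" using sd by linarith+
          then have "dist ((\<lambda>(s, w). h' s w) (u, w)) ((\<lambda>(s, w). h' s w) (0, w)) < e / 2"
            using \<delta> w by (intro d(2)) (auto simp: dist_Pair_Pair)
          then show ?thesis by (simp add: dist_norm)
        qed
      qed auto
      then have "norm (h s w - h 0 w - s *\<^sub>R h' 0 w) / \<bar>s\<bar> \<le> e / 2"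
        using s(1) by (simp add: pos_divide_le_eq mult.commute)
      moreover have "q s w - h' 0 w = (1 / of_real s) * (h s w - h 0 w - s *\<^sub>R h' 0 w)"
        using s(1) by (simp add: q_def scaleR_conv_of_real field_simps)
      then have "norm (q s w - h' 0 w) = norm (h s w - h 0 w - s *\<^sub>R h' 0 w) / \<bar>s\<bar>"
        by (simp add: norm_mult norm_divide)
      ultimately have "norm (q s w - h' 0 w) \<le> e / 2" by linarith
      then show ?thesis using e by (simp add: dist_norm)
    qed
    then show "\<forall>\<^sub>F s in at 0. \<forall>w\<in>cball z r. dist (q s w) (h' 0 w) < e"
      unfolding eventually_at by (intro exI[of _ d'] conjI ballI impI d') (elim conjE)
  qed
  have qh: "q s holomorphic_on S" if "\<bar>s\<bar> < \<delta>" for s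
    unfolding q_def using holo[OF that] holo[of 0] \<delta> by (intro holomorphic_intros) auto
  have ev: "\<forall>\<^sub>F s in at (0::real). \<bar>s\<bar> < \<delta>"
    unfolding eventually_at using \<delta> by (intro exI[of _ \<delta>]) auto
  have loc: "\<exists>r>0. cball z r \<subseteq> S \<and> h' 0 holomorphic_on ball z r" if z: "z \<in> S" for z
  proof -
    obtain r where r: "r > 0" "cball z r \<subseteq> S" using bspec[OF open_contains_cball[THEN iffD1, OF S] z] by (elim exE conjE)
    have "\<forall>\<^sub>F s in at 0. continuous_on (cball z r) (q s) \<and> q s holomorphic_on ball z r"
      using ev
    proof eventually_elim
      case (elim s)
      have "q s holomorphic_on cball z r" using holomorphic_on_subset[OF qh[OF elim] r(2)] .
      then show ?case
        by (intro conjI holomorphic_on_imp_continuous_on holomorphic_on_subset[OF _ ball_subset_cball])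
    qed
    then have "h' 0 holomorphic_on ball z r"
      by (rule holomorphic_uniform_limit[OF _ ul[OF r(2)]]) simp
    then show ?thesis using r by (intro exI conjI)
  qed
  show "h' 0 holomorphic_on S"
    unfolding holomorphic_on_def
  proof
    fix z assume z: "z \<in> S"
    obtain r where "r > 0" "h' 0 holomorphic_on ball z r" using loc[OF z] by (elim exE conjE)
    then have "h' 0 field_differentiable at z"
      using holomorphic_on_imp_differentiable_at[of "h' 0" "ball z r" z] by simp
    then show "h' 0 field_differentiable at z within S" by (rule field_differentiable_at_within)
  qed
  show "((\<lambda>s. (deriv ^^ n) (h s) z) has_vector_derivative (deriv ^^ n) (h' 0) z) (at 0)" if z: "z \<in> S"
  proof -
    obtain r where r: "r > 0" "cball z r \<subseteq> S" using bspec[OF open_contains_cball[THEN iffD1, OF S] z] by (elim exE conjE)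
    have bS: "ball z r \<subseteq> S" by (rule subset_trans[OF ball_subset_cball r(2)])
    have "((\<lambda>s. (deriv ^^ n) (q s) z) \<longlongrightarrow> (deriv ^^ n) (h' 0) z) (at 0)"
    proof (rule higher_deriv_complex_uniform_limit)
      show "uniform_limit (ball z r) q (h' 0) (at 0)"
        by (rule uniform_limit_on_subset[OF ul[OF r(2)] ball_subset_cball])
      show "\<forall>\<^sub>F s in at 0. q s holomorphic_on ball z r"
        using ev by eventually_elim (rule holomorphic_on_subset[OF qh bS])
    qed (use r in auto)
    moreover have "\<forall>\<^sub>F s in at 0. (deriv ^^ n) (q s) z = ((deriv ^^ n) (h s) z - (deriv ^^ n) (h 0) z) /\<^sub>R s"
      using ev
    proof eventually_elim
      case (elim s)
      have h0: "h 0 holomorphic_on S" using holo \<delta> by simp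
      have "(deriv ^^ n) (q s) z = (1 / of_real s) * (deriv ^^ n) (\<lambda>w. h s w - h 0 w) z"
        unfolding q_def by (rule higher_deriv_cmult[OF holomorphic_on_diff[OF holo[OF elim] h0] z S])
      also have "\<dots> = (1 / of_real s) * ((deriv ^^ n) (h s) z - (deriv ^^ n) (h 0) z)"
        by (subst higher_deriv_diff[OF holo[OF elim] h0 S z]) simp
      finally show ?case by (simp add: scaleR_conv_of_real divide_inverse)
    qed
    ultimately have "((\<lambda>s. ((deriv ^^ n) (h s) z - (deriv ^^ n) (h 0) z) /\<^sub>R s) \<longlongrightarrow> (deriv ^^ n) (h' 0) z) (at 0)"
      by (rule Lim_transform_eventually)
    then show ?thesis by (rule has_vector_derivative_at_0I)
  qed
qed

text \<open>For a function that is holomorphic in \<open>w\<close>, the complex derivative is the directional derivative in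
  the direction \<open>(0, 1)\<close>.\<close>

lemma smooth_partial_complex_derivative:
  fixes h :: "'a::real_normed_vector \<times> complex \<Rightarrow> complex"
  assumes W: "open W" and S: "open S" and h: "smooth_on (W \<times> S) h"
    and holo: "\<And>p. p \<in> W \<Longrightarrow> (\<lambda>w. h (p, w)) holomorphic_on S"
  shows "smooth_on (W \<times> S) (\<lambda>z. (deriv ^^ n) (\<lambda>w. h (fst z, w)) (snd z))"
proof (induction n)
  case 0
  then show ?case using h by simp
next
  case (Suc n)
  let ?g = "\<lambda>z. (deriv ^^ n) (\<lambda>w. h (fst z, w)) (snd z)"
  have WS: "open (W \<times> S)" by (intro open_Times W S)
  have "frechet_derivative ?g (at z) (0, 1) = (deriv ^^ Suc n) (\<lambda>w. h (fst z, w)) (snd z)" if z: "z \<in> W \<times> S" for z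
  proof -
    obtain p w where pw: "z = (p, w)" "p \<in> W" "w \<in> S" using z by auto
    have "((\<lambda>u. ?g (p, u)) has_derivative (\<lambda>v. frechet_derivative ?g (at z) (0, v))) (at w)"
    proof -
      have "((\<lambda>u. (p, u)) has_derivative (\<lambda>v. (0, v))) (at w)" by (auto intro!: derivative_eq_intros)
      from has_derivative_compose[OF this smooth_on_has_derivative[OF Suc z, unfolded pw(1)]]
      show ?thesis by (simp only: pw(1))
    qed
    moreover have "(deriv ^^ n) (\<lambda>w. h (p, w)) holomorphic_on S"
      by (rule holomorphic_higher_deriv[OF holo[OF pw(2)] S])
    then have "((deriv ^^ n) (\<lambda>w. h (p, w)) has_field_derivative (deriv ^^ Suc n) (\<lambda>w. h (p, w)) w) (at w)"
      using holomorphic_derivI[OF _ S pw(3)] by simp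
    then have "((\<lambda>u. ?g (p, u)) has_derivative (\<lambda>v. (deriv ^^ Suc n) (\<lambda>w. h (p, w)) w * v)) (at w)"
      by (simp add: has_field_derivative_def)
    ultimately have "(\<lambda>v. frechet_derivative ?g (at z) (0, v)) = (\<lambda>v. (deriv ^^ Suc n) (\<lambda>w. h (p, w)) w * v)"
      by (rule has_derivative_unique)
    from fun_cong[OF this, of 1] show ?thesis by (simp add: pw(1))
  qed
  then show ?case
    by (rule smooth_on_cong_open[OF WS _ smooth_on_frechet_derivative[OF Suc]])
qed

lemma directional_derivative_holomorphic:
  fixes h :: "'a::euclidean_space \<times> complex \<Rightarrow> complex"
  assumes W: "open W" and S: "open S" and h: "smooth_on (W \<times> S) h"
    and holo: "\<And>p. p \<in> W \<Longrightarrow> (\<lambda>w. h (p, w)) holomorphic_on S" and p: "p \<in> W"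
    and d: "\<And>w. w \<in> S \<Longrightarrow> ((\<lambda>s. h (p + s *\<^sub>R e, w)) has_vector_derivative d w) (at 0)"
  shows "d holomorphic_on S"
    and "z \<in> S \<Longrightarrow> ((\<lambda>s. (deriv ^^ n) (\<lambda>w. h (p + s *\<^sub>R e, w)) z) has_vector_derivative (deriv ^^ n) d z) (at 0)"
proof -
  have WS: "open (W \<times> S)" by (intro open_Times W S)
  have c: "continuous_on UNIV (\<lambda>s::real. p + s *\<^sub>R e)" by (intro continuous_intros)
  have "open ((\<lambda>s::real. p + s *\<^sub>R e) -` W)" using open_vimage[OF W c] .
  moreover have "0 \<in> (\<lambda>s::real. p + s *\<^sub>R e) -` W" using p by simp
  ultimately obtain \<delta> where \<delta>: "\<delta> > 0" "ball 0 \<delta> \<subseteq> (\<lambda>s::real. p + s *\<^sub>R e) -` W"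
    using open_contains_ball by metis
  have inW: "p + s *\<^sub>R e \<in> W" if "\<bar>s\<bar> < \<delta>" for s
  proof -
    have "s \<in> ball 0 \<delta>" using that by (simp add: dist_norm)
    then show ?thesis using \<delta>(2) by blast
  qed
  define h' where "h' s w = frechet_derivative h (at (p + s *\<^sub>R e, w)) (e, 0)" for s w
  have D: "((\<lambda>s. h (p + s *\<^sub>R e, w)) has_vector_derivative h' s w) (at s)" if s: "\<bar>s\<bar> < \<delta>" and w: "w \<in> S" for s w
  proof -
    have "(p + s *\<^sub>R e, w) \<in> W \<times> S" using inW[OF s] w by simp
    note hd = smooth_on_has_derivative[OF h this]
    have "((\<lambda>s. (p + s *\<^sub>R e, w)) has_derivative (\<lambda>u. (u *\<^sub>R e, 0))) (at s)"
      by (auto intro!: derivative_eq_intros)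
    from has_derivative_compose[OF this hd]
    have "((\<lambda>s. h (p + s *\<^sub>R e, w)) has_derivative (\<lambda>u. frechet_derivative h (at (p + s *\<^sub>R e, w)) (u *\<^sub>R e, 0))) (at s)" .
    moreover have "frechet_derivative h (at (p + s *\<^sub>R e, w)) (u *\<^sub>R e, 0) = u *\<^sub>R h' s w" for u
      using linear_cmul[OF has_derivative_linear[OF hd], of u "(e, 0)"] by (simp add: h'_def)
    ultimately show ?thesis by (simp add: has_vector_derivative_def)
  qed
  have cont: "continuous_on ({-\<delta><..<\<delta>} \<times> S) (\<lambda>(s, w). h' s w)"
  proof -
    have "continuous_on (W \<times> S) (\<lambda>z. frechet_derivative h (at z) (e, 0))"
      by (intro smooth_on_continuous_on smooth_on_frechet_derivative h)
    moreover have "continuous_on ({-\<delta><..<\<delta>} \<times> S) (\<lambda>(s, w). (p + s *\<^sub>R e, w))"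
      unfolding case_prod_unfold by (intro continuous_intros)
    moreover have "(\<lambda>(s, w). (p + s *\<^sub>R e, w)) ` ({-\<delta><..<\<delta>} \<times> S) \<subseteq> W \<times> S"
      using inW by (auto simp: abs_less_iff)
    ultimately have "continuous_on ({-\<delta><..<\<delta>} \<times> S)
        (\<lambda>x. frechet_derivative h (at ((\<lambda>(s, w). (p + s *\<^sub>R e, w)) x)) (e, 0))"
      by (rule continuous_on_compose2)
    then show ?thesis by (simp add: h'_def case_prod_unfold)
  qed
  have eq: "d w = h' 0 w" if "w \<in> S" for w
    using vector_derivative_unique_at[OF d[OF that] D[of 0 w]] \<delta>(1) that by simp
  have hh: "(\<lambda>w. h (p + s *\<^sub>R e, w)) holomorphic_on S" if "\<bar>s\<bar> < \<delta>" for s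
    by (rule holo[OF inW[OF that]])
  have main1: "h' 0 holomorphic_on S"
    by (rule holomorphic_parameter_derivative(1)[OF \<delta>(1) S hh D cont])
  have main2: "((\<lambda>s. (deriv ^^ n) (\<lambda>w. h (p + s *\<^sub>R e, w)) z) has_vector_derivative (deriv ^^ n) (h' 0) z) (at 0)" if "z \<in> S"
    by (rule holomorphic_parameter_derivative(2)[OF \<delta>(1) S hh D cont that])
  show d_holo: "d holomorphic_on S"
    using main1 by (rule holomorphic_transform) (rule eq[symmetric])
  show "((\<lambda>s. (deriv ^^ n) (\<lambda>w. h (p + s *\<^sub>R e, w)) z) has_vector_derivative (deriv ^^ n) d z) (at 0)" if z: "z \<in> S"
  proof -
    have "(deriv ^^ n) d z = (deriv ^^ n) (h' 0) z"
      by (rule higher_deriv_transform_within_open[OF d_holo main1 S z eq])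
    then show ?thesis using main2[OF z] by simp
  qed
qed

text \<open>Comparison of the coefficients of order \<open>Suc n\<close> in the power series of the two sides.\<close>

lemma taylor_coefficient_recursion:
  fixes H :: "'i \<Rightarrow> complex \<Rightarrow> complex"
  assumes \<epsilon>: "\<epsilon> > 0" and D: "D holomorphic_on ball 0 \<epsilon>" and H: "\<And>j. j \<in> J \<Longrightarrow> H j holomorphic_on ball 0 \<epsilon>"
    and eq: "\<And>w. w \<in> ball 0 \<epsilon> \<Longrightarrow> w * D w = (\<Sum>j\<in>J. c j * H j w) + w * (\<Sum>j\<in>J. d j * H j w)"
  shows "(deriv ^^ n) D 0 / fact n =
     (\<Sum>j\<in>J. c j * ((deriv ^^ Suc n) (H j) 0 / fact (Suc n))) + (\<Sum>j\<in>J. d j * ((deriv ^^ n) (H j) 0 / fact n))"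
proof -
  have 0: "open (ball (0::complex) \<epsilon>)" "0 \<in> ball (0::complex) \<epsilon>" using \<epsilon> by auto
  have fD: "D has_fps_expansion fps_expansion D 0"
    by (rule has_fps_expansion_fps_expansion[OF 0 D])
  have fH: "H j has_fps_expansion fps_expansion (H j) 0" if "j \<in> J" for j
    by (rule has_fps_expansion_fps_expansion[OF 0 H[OF that]])
  have f1: "(\<lambda>w. w * D w) has_fps_expansion (fps_X * fps_expansion D 0)"
    by (intro fps_expansion_intros fD)
  have f2: "(\<lambda>w. (\<Sum>j\<in>J. c j * H j w) + w * (\<Sum>j\<in>J. d j * H j w)) has_fps_expansion
     ((\<Sum>j\<in>J. fps_const (c j) * fps_expansion (H j) 0) + fps_X * (\<Sum>j\<in>J. fps_const (d j) * fps_expansion (H j) 0))"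
    by (intro has_fps_expansion_add has_fps_expansion_mult has_fps_expansion_sum has_fps_expansion_fps_X
        has_fps_expansion_const fH)
  have "eventually (\<lambda>w. w * D w = (\<Sum>j\<in>J. c j * H j w) + w * (\<Sum>j\<in>J. d j * H j w)) (nhds 0)"
    using eventually_nhds_in_open[OF 0] by eventually_elim (rule eq)
  from has_fps_expansion_cong[OF this refl] f1
  have f3: "(\<lambda>w. (\<Sum>j\<in>J. c j * H j w) + w * (\<Sum>j\<in>J. d j * H j w)) has_fps_expansion (fps_X * fps_expansion D 0)"
    by simp
  from arg_cong[OF fps_expansion_unique_complex[OF f3 f2], of "\<lambda>F. fps_nth F (Suc n)"]
  show ?thesis by (simp add: fps_sum_nth fps_expansion_def)
qed

section \<open>Families of loops in the adjoint representation\<close>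

lemma vec_lambda_sum_axis: "(\<chi> i. g i) = (\<Sum>i\<in>UNIV. axis i (g i :: complex))"
  by (simp add: vec_eq_iff axis_def)

lemma bounded_linear_axis: "bounded_linear (\<lambda>z::complex. axis i z)"
  by (intro linear_conv_bounded_linear[THEN iffD1] linearI) (simp_all add: vec_eq_iff axis_def)

lemma has_vector_derivative_vec_lambda:
  assumes "\<And>i. ((\<lambda>s. g s i) has_vector_derivative (d i :: complex)) (at x)"
  shows "((\<lambda>s. \<chi> i. g s i) has_vector_derivative (\<chi> i. d i)) (at x)"
  unfolding vec_lambda_sum_axis
  by (intro has_vector_derivative_sum bounded_linear.has_vector_derivative[OF bounded_linear_axis] assms)

lemma smooth_on_vec_lambda:
  assumes "open S" "\<And>i. smooth_on S (\<lambda>x. g x i :: complex)"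
  shows "smooth_on S (\<lambda>x. \<chi> i. g x i)"
  unfolding vec_lambda_sum_axis
  by (intro smooth_on_sum smooth_on_bounded_linear[OF _ bounded_linear_axis] assms)

lemma complex_linear_expansion:
  fixes f :: "complex^'n \<Rightarrow> complex^'n"
  assumes add: "\<And>u v. f (u + v) = f u + f v" and scale: "\<And>z v. f (z *s v) = z *s f v"
  shows "f v $ i = (\<Sum>j\<in>UNIV. v $ j * f (axis j 1) $ i)"
proof -
  have f0: "f 0 = 0" using scale[of 0 0] by simp
  have "f (\<Sum>j\<in>J. v $ j *s axis j 1) = (\<Sum>j\<in>J. v $ j *s f (axis j 1))" if "finite J" for J
    using that by (induction rule: finite_induct) (simp_all add: add scale f0)
  from this[of UNIV] show ?thesis by (simp add: basis_expansion)
qed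

text \<open>The Taylor coefficients at \<open>0\<close> can be computed along the real axis, and the closed subspace of
  fixed vectors of \<open>T\<close> contains the derivatives of every curve that it contains. It yields the reality of
  the coefficients \<open>Q_coeff\<close>.\<close>

lemma real_curve_derivatives_fixed:
  fixes F :: "complex \<Rightarrow> complex^'n"
  assumes \<epsilon>: "\<epsilon> > 0" and T: "bounded_linear T"
    and holo: "\<And>i. (\<lambda>w. F w $ i) holomorphic_on ball 0 \<epsilon>"
    and inv_T: "\<And>t. \<bar>t\<bar> < \<epsilon> \<Longrightarrow> T (F (of_real t)) = F (of_real t)"
  shows "T (\<chi> i. (deriv ^^ n) (\<lambda>w. F w $ i) 0) = (\<chi> i. (deriv ^^ n) (\<lambda>w. F w $ i) 0)"
proof -
  define Fn where "Fn n w = (\<chi> i. (deriv ^^ n) (\<lambda>w. F w $ i) w)" for n w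
  have d: "((\<lambda>t. Fn n (of_real t)) has_vector_derivative Fn (Suc n) (of_real t)) (at t)" if "\<bar>t\<bar> < \<epsilon>" for n t
    unfolding Fn_def
  proof (rule has_vector_derivative_vec_lambda)
    fix i
    have "(deriv ^^ n) (\<lambda>w. F w $ i) holomorphic_on ball 0 \<epsilon>"
      by (rule holomorphic_higher_deriv[OF holo open_ball])
    from holomorphic_derivI[OF this open_ball, of "of_real t"] that
    have "((deriv ^^ n) (\<lambda>w. F w $ i) has_field_derivative (deriv ^^ Suc n) (\<lambda>w. F w $ i) (of_real t)) (at (of_real t))"
      by simp
    from field_vector_diff_chain_at[OF has_vector_derivative_of_real[OF DERIV_ident] this]
    show "((\<lambda>t. (deriv ^^ n) (\<lambda>w. F w $ i) (of_real t)) has_vector_derivative (deriv ^^ Suc n) (\<lambda>w. F w $ i) (of_real t)) (at t)"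
      by (simp add: o_def)
  qed
  have "T (Fn n (of_real t)) = Fn n (of_real t)" if "\<bar>t\<bar> < \<epsilon>" for t
    using that
  proof (induction n arbitrary: t)
    case 0
    have "Fn 0 w = F w" for w by (simp add: Fn_def vec_eq_iff)
    then show ?case using inv_T 0 by simp
  next
    case (Suc n)
    have "((\<lambda>t. T (Fn n (of_real t))) has_vector_derivative T (Fn (Suc n) (of_real t))) (at t)"
      by (rule bounded_linear.has_vector_derivative[OF T d[OF Suc.prems]])
    moreover have "t \<in> {-\<epsilon><..<\<epsilon>}" using Suc.prems by auto
    then have "((\<lambda>t. T (Fn n (of_real t))) has_vector_derivative Fn (Suc n) (of_real t)) (at t)"
    proof (rule has_vector_derivative_transform_within_open[OF d[OF Suc.prems] open_greaterThanLessThan])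
      fix y assume "y \<in> {-\<epsilon><..<\<epsilon>}"
      then have "\<bar>y\<bar> < \<epsilon>" by (simp add: abs_less_iff)
      from Suc.IH[OF this] show "Fn n (of_real y) = T (Fn n (of_real y))" by (rule sym)
    qed
    ultimately show ?case by (rule vector_derivative_unique_at)
  qed
  from this[of 0] show ?thesis using \<epsilon> by (simp add: Fn_def)
qed

context lie_grp
begin

lemma holomorphic_into_imp_holomorphic_map_into:
  assumes sm: "smooth_into G S F" and S: "open S" and holo: "holomorphic_into G S F"
  shows "holomorphic_map_into G ((*) \<i>) S F"
  unfolding holomorphic_map_into_def
proof (safe)
  show "smooth_into G S F" by (rule sm)
  fix V \<psi> x v assume A: "(V, \<psi>) \<in> lie_atlas G" and x: "x \<in> S" "F x \<in> V"
  define T where "T = {z\<in>S. F z \<in> V}"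
  have T: "open T" "x \<in> T" using smooth_into_open_preimage[OF sm S chart_openin[OF A]] x by (simp_all add: T_def)
  define L where "L = frechet_derivative (\<lambda>y. \<psi> (F y)) (at x)"
  have L: "((\<lambda>y. \<psi> (F y)) has_derivative L) (at x)"
    unfolding L_def by (rule smooth_on_has_derivative[OF smooth_into_chart[OF sm A] T(2)[unfolded T_def]])
  have hol: "(\<lambda>z. \<psi> (F z) $ i) holomorphic_on T" for i
  proof -
    have "\<forall>c\<in>lie_atlas G. \<forall>i. (\<lambda>z. snd c (F z) $ i) holomorphic_on {z\<in>S. F z \<in> fst c}"
      using holo unfolding holomorphic_into_def case_prod_unfold by (elim conjE)
    from bspec[OF this A] show ?thesis by (simp add: T_def)
  qed
  have Li: "L h $ i = deriv (\<lambda>z. \<psi> (F z) $ i) x * h" for h i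
  proof -
    have "((\<lambda>y. \<psi> (F y) $ i) has_derivative (\<lambda>h. L h $ i)) (at x)"
      by (rule bounded_linear.has_derivative[OF bounded_linear_vec_nth L])
    moreover have "((\<lambda>y. \<psi> (F y) $ i) has_derivative (*) (deriv (\<lambda>z. \<psi> (F z) $ i) x)) (at x)"
      using holomorphic_derivI[OF hol T] by (simp add: has_field_derivative_def)
    ultimately have "(\<lambda>h. L h $ i) = (*) (deriv (\<lambda>z. \<psi> (F z) $ i) x)"
      by (rule has_derivative_unique)
    from fun_cong[OF this, of h] show ?thesis .
  qed
  show "frechet_derivative (\<lambda>y. \<psi> (F y)) (at x) (\<i> * v) = \<i> *s frechet_derivative (\<lambda>y. \<psi> (F y)) (at x) v"
    unfolding L_def[symmetric] by (simp add: vec_eq_iff Li)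
qed

text \<open>For a holomorphic loop the logarithmic derivative is complex linear, so it is given by a vector.\<close>

lemma complex_log_deriv:
  assumes "holomorphic_map_into G ((*) \<i>) S F" "open S" "x \<in> S"
  obtains \<nu> where "log_deriv G F (\<lambda>h. h *s \<nu>) x"
proof -
  have sm: "smooth_into G S F" using assms(1) by (simp add: holomorphic_map_into_def)
  obtain D where D: "log_deriv G F D x" using smooth_into_log_deriv[OF sm assms(2,3)] by blast
  have lin: "linear D" using D has_derivative_linear unfolding log_deriv_def by blast
  have "D h = h *s D 1" for h
  proof -
    have "h = Re h *\<^sub>R 1 + Im h *\<^sub>R (\<i> * 1)" by (simp add: complex_eq_iff)
    then have "D h = D (Re h *\<^sub>R 1 + Im h *\<^sub>R (\<i> * 1))" by (rule arg_cong)
    also have "\<dots> = Re h *\<^sub>R D 1 + Im h *\<^sub>R (\<i> *s D 1)"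
      by (simp only: linear_add[OF lin] linear_cmul[OF lin] holomorphic_map_into_log_deriv[OF assms D])
    also have "\<dots> = h *s D 1" by (simp add: vec_eq_iff complex_eq_iff)
    finally show ?thesis .
  qed
  then have "D = (\<lambda>h. h *s D 1)" by blast
  then show ?thesis using that D by metis
qed

lemma Ad_holomorphic:
  assumes "holomorphic_map_into G ((*) \<i>) S F" "open S"
  shows "(\<lambda>w. Ad G (F w) v $ i) holomorphic_on S"
    and "(\<lambda>w. Ad G (inv F w) v $ i) holomorphic_on S"
proof -
  have sm: "smooth_into G S F" using assms(1) by (simp add: holomorphic_map_into_def)
  have 1: "(\<lambda>w. Ad G (F w) v $ i) field_differentiable at x" if x: "x \<in> S" for x
  proof -
    obtain \<nu> where \<nu>: "log_deriv G F (\<lambda>h. h *s \<nu>) x" by (rule complex_log_deriv[OF assms x])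
    have "((\<lambda>w. Ad G (F w) v $ i) has_derivative (\<lambda>h. Ad G (F x) (lie_bracket G (h *s \<nu>) v) $ i)) (at x)"
      by (rule bounded_linear.has_derivative[OF bounded_linear_vec_nth log_deriv_Ad[OF \<nu>]])
    moreover have "Ad G (F x) (lie_bracket G (h *s \<nu>) v) $ i = Ad G (F x) (lie_bracket G \<nu> v) $ i * h" for h
      by (simp add: lie_bracket_scale_left Ad_scale smooth_into_carrier[OF sm x])
    ultimately have "((\<lambda>w. Ad G (F w) v $ i) has_field_derivative Ad G (F x) (lie_bracket G \<nu> v) $ i) (at x)"
      by (simp add: has_field_derivative_def)
    then show ?thesis unfolding field_differentiable_def by blast
  qed
  have 2: "(\<lambda>w. Ad G (inv F w) v $ i) field_differentiable at x" if x: "x \<in> S" for x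
  proof -
    obtain \<nu> where \<nu>: "log_deriv G F (\<lambda>h. h *s \<nu>) x" by (rule complex_log_deriv[OF assms x])
    have "((\<lambda>w. Ad G (inv F w) v $ i) has_derivative (\<lambda>h. (- lie_bracket G (h *s \<nu>) (Ad G (inv F x) v)) $ i)) (at x)"
      by (rule bounded_linear.has_derivative[OF bounded_linear_vec_nth log_deriv_Ad_inv[OF \<nu>]])
    moreover have "(\<lambda>h. (- lie_bracket G (h *s \<nu>) (Ad G (inv F x) v)) $ i) = (*) ((- lie_bracket G \<nu> (Ad G (inv F x) v)) $ i)"
      by (rule ext) (simp add: lie_bracket_scale_left)
    ultimately have "((\<lambda>w. Ad G (inv F w) v $ i) has_field_derivative (- lie_bracket G \<nu> (Ad G (inv F x) v)) $ i) (at x)"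
      by (simp only: has_field_derivative_def)
    then show ?thesis unfolding field_differentiable_def by blast
  qed
  show "(\<lambda>w. Ad G (F w) v $ i) holomorphic_on S"
    unfolding holomorphic_on_def by (rule ballI, rule field_differentiable_at_within, rule 1)
  show "(\<lambda>w. Ad G (inv F w) v $ i) holomorphic_on S"
    unfolding holomorphic_on_def by (rule ballI, rule field_differentiable_at_within, rule 2)
qed

lemma Ad_expansion:
  "g \<in> carrier G \<Longrightarrow> Ad G g v $ i = (\<Sum>j\<in>UNIV. v $ j * Ad G g (axis j 1) $ i)"
  by (rule complex_linear_expansion) (simp_all add: Ad_linear Ad_scale)

lemma lie_bracket_expansion_left:
  "lie_bracket G u v $ i = (\<Sum>j\<in>UNIV. u $ j * lie_bracket G (axis j 1) v $ i)"
  by (rule complex_linear_expansion[where f = "\<lambda>u. lie_bracket G u v"])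
     (simp_all add: lie_bracket_add_left lie_bracket_scale_left)

lemma lie_bracket_expansion_right:
  "lie_bracket G u v $ i = (\<Sum>j\<in>UNIV. v $ j * lie_bracket G u (axis j 1) $ i)"
  by (rule complex_linear_expansion) (simp_all add: lie_bracket_add_right lie_bracket_scale_right)

lemma line_log_deriv:
  fixes F :: "'a::euclidean_space \<times> complex \<Rightarrow> 'g"
  assumes F: "smooth_into G (W \<times> S) F" and "open W" "open S" "p \<in> W" "w \<in> S"
  shows "\<exists>\<nu>. log_deriv G (\<lambda>s. F (p + s *\<^sub>R e, w)) (\<lambda>h. h *\<^sub>R \<nu>) 0"
proof -
  obtain D where D: "log_deriv G F D (p + 0 *\<^sub>R e, w)"
    using smooth_into_log_deriv[OF F open_Times[OF assms(2,3)], of "(p + 0 *\<^sub>R e, w)"] assms(4,5) by auto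
  have lin: "linear D" using D has_derivative_linear unfolding log_deriv_def by blast
  have "((\<lambda>s. (p + s *\<^sub>R e, w)) has_derivative (\<lambda>h. (h *\<^sub>R e, 0))) (at 0)"
    by (auto intro!: derivative_eq_intros)
  from log_deriv_compose[where f = "\<lambda>s. (p + s *\<^sub>R e, w)", OF D this]
  have "log_deriv G (\<lambda>s. F (p + s *\<^sub>R e, w)) (\<lambda>h. D (h *\<^sub>R e, 0)) 0" .
  moreover have "D (h *\<^sub>R e, 0) = h *\<^sub>R D (e, 0)" for h
    using linear_cmul[OF lin, of h "(e, 0)"] by simp
  ultimately show ?thesis by (intro exI[of _ "D (e, 0)"]) simp
qed

text \<open>\<open>\<nu>\<close> is the logarithmic derivative of a family of loops \<open>F(p, \<cdot>)\<close> in the direction \<open>e\<close>. Its bracket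
  with \<open>v\<close> is obtained by applying \<open>Ad (F\<^sup>-\<^sup>1)\<close> to the derivative of \<open>Ad F v\<close>; this passes through matrix
  entries, which are holomorphic functions of \<open>w\<close>, and shows holomorphy without differentiating \<open>\<nu>\<close>.\<close>

lemma log_deriv_parameter:
  fixes F :: "'a::euclidean_space \<times> complex \<Rightarrow> 'g"
  assumes F: "smooth_into G (W \<times> S) F" and W: "open W" and S: "open S"
    and holo: "\<And>p. p \<in> W \<Longrightarrow> holomorphic_map_into G ((*) \<i>) S (\<lambda>w. F (p, w))" and p: "p \<in> W"
    and \<nu>: "\<And>w. w \<in> S \<Longrightarrow> log_deriv G (\<lambda>s. F (p + s *\<^sub>R e, w)) (\<lambda>h. h *\<^sub>R \<nu> w) 0"
  shows "(\<lambda>w. lie_bracket G (\<nu> w) v $ i) holomorphic_on S"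
    and "(\<lambda>w. - lie_bracket G (\<nu> w) (Ad G (inv F (p, w)) c) $ i) holomorphic_on S"
    and "z \<in> S \<Longrightarrow> ((\<lambda>s. (deriv ^^ n) (\<lambda>w. Ad G (inv F (p + s *\<^sub>R e, w)) c $ i) z) has_vector_derivative
       (deriv ^^ n) (\<lambda>w. - lie_bracket G (\<nu> w) (Ad G (inv F (p, w)) c) $ i) z) (at 0)"
proof -
  have WS: "open (W \<times> S)" by (intro open_Times W S)
  have c: "F (p, w) \<in> carrier G" if "w \<in> S" for w using smooth_into_carrier[OF F] p that by blast
  have nth: "smooth_on (W \<times> S) (\<lambda>z. A z $ j)" if "smooth_on (W \<times> S) A" for A :: "'a \<times> complex \<Rightarrow> complex^'n" and j
    by (rule smooth_on_bounded_linear[OF WS bounded_linear_vec_nth that])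
  have "(\<lambda>w. Ad G (F (p, w)) (lie_bracket G (\<nu> w) v) $ j) holomorphic_on S" for j
  proof (rule directional_derivative_holomorphic(1)[where h = "\<lambda>z. Ad G (F z) v $ j", OF W S])
    show "smooth_on (W \<times> S) (\<lambda>z. Ad G (F z) v $ j)" by (rule nth[OF Ad_smooth[OF F WS]])
    show "(\<lambda>w. Ad G (F (q, w)) v $ j) holomorphic_on S" if "q \<in> W" for q
      by (rule Ad_holomorphic(1)[OF holo[OF that] S])
    show "p \<in> W" by (rule p)
    show "((\<lambda>s. Ad G (F (p + s *\<^sub>R e, w)) v $ j) has_vector_derivative
        Ad G (F (p, w)) (lie_bracket G (\<nu> w) v) $ j) (at 0)" if w: "w \<in> S" for w
      using bounded_linear.has_derivative[OF bounded_linear_vec_nth log_deriv_Ad[OF \<nu>[OF w], of v], of j] c[OF w]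
      by (simp add: has_vector_derivative_def lie_bracket_scaleR_left Ad_linear)
  qed
  then have "(\<lambda>w. \<Sum>j\<in>UNIV. Ad G (F (p, w)) (lie_bracket G (\<nu> w) v) $ j * Ad G (inv F (p, w)) (axis j 1) $ i) holomorphic_on S"
    by (intro holomorphic_intros Ad_holomorphic(2)[OF holo[OF p] S])
  then show "(\<lambda>w. lie_bracket G (\<nu> w) v $ i) holomorphic_on S"
  proof (rule holomorphic_transform)
    fix w assume "w \<in> S"
    then show "(\<Sum>j\<in>UNIV. Ad G (F (p, w)) (lie_bracket G (\<nu> w) v) $ j * Ad G (inv F (p, w)) (axis j 1) $ i)
       = lie_bracket G (\<nu> w) v $ i"
      using Ad_expansion[of "inv F (p, w)" "Ad G (F (p, w)) (lie_bracket G (\<nu> w) v)" i] c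
      by (simp add: Ad_inv)
  qed
  have sm: "smooth_on (W \<times> S) (\<lambda>z. Ad G (inv F z) c $ i)"
    by (rule nth[OF Ad_smooth[OF smooth_into_inv[OF WS F] WS]])
  have hol: "(\<lambda>w. Ad G (inv F (q, w)) c $ i) holomorphic_on S" if "q \<in> W" for q
    by (rule Ad_holomorphic(2)[OF holo[OF that] S])
  have der: "((\<lambda>s. Ad G (inv F (p + s *\<^sub>R e, w)) c $ i) has_vector_derivative
        - lie_bracket G (\<nu> w) (Ad G (inv F (p, w)) c) $ i) (at 0)" if w: "w \<in> S" for w
    using bounded_linear.has_derivative[OF bounded_linear_vec_nth log_deriv_Ad_inv[OF \<nu>[OF w], of c], of i]
    by (simp add: has_vector_derivative_def lie_bracket_scaleR_left)
  show "(\<lambda>w. - lie_bracket G (\<nu> w) (Ad G (inv F (p, w)) c) $ i) holomorphic_on S"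
    by (rule directional_derivative_holomorphic(1)[where h = "\<lambda>z. Ad G (inv F z) c $ i", OF W S sm hol p der])
  show "z \<in> S \<Longrightarrow> ((\<lambda>s. (deriv ^^ n) (\<lambda>w. Ad G (inv F (p + s *\<^sub>R e, w)) c $ i) z) has_vector_derivative
       (deriv ^^ n) (\<lambda>w. - lie_bracket G (\<nu> w) (Ad G (inv F (p, w)) c) $ i) z) (at 0)"
    by (rule directional_derivative_holomorphic(2)[where h = "\<lambda>z. Ad G (inv F z) c $ i", OF W S sm hol p der])
qed

end

section \<open>The frame equation and its Taylor coefficients\<close>

lemma punctured_nbhd_inverse:
  assumes "\<epsilon> > 0" "w \<in> ball 0 \<epsilon>" "w \<noteq> 0"
  shows "inverse w \<in> punctured_nbhd \<epsilon>"
proof -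
  have "inverse \<epsilon> < inverse (cmod w)" using assms by (intro less_imp_inverse_less) simp_all
  then show ?thesis by (simp add: punctured_nbhd_def norm_divide inverse_eq_divide)
qed

text \<open>The factorization \<open>f\<^sup>-\<^sup>1 e\<^sup>A = E m\<^sup>-\<^sup>1\<close> for commuting generators \<open>a i\<close> and \<open>b\<close>. Near infinity the spectral
  parameter is \<open>1/w\<close> with \<open>w\<close> in \<open>disc\<close>.\<close>

locale lie_factorization = lie_grp G for G :: "('g, 'n::finite) lie_data" (structure) +
  fixes \<tau> \<sigma> :: "'g \<Rightarrow> 'g" and \<epsilon> :: real and f :: "complex \<Rightarrow> 'g"
    and a :: "'r::finite \<Rightarrow> complex^'n" and b :: "complex^'n" and j :: nat
    and W :: "((real^'r) \<times> real) set" and E m :: "(real^'r) \<times> real \<Rightarrow> complex \<Rightarrow> 'g"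
  assumes eps: "\<epsilon> > 0" and f_minus: "f \<in> loops_minus G \<epsilon>" and open_W: "open W"
    and factorization: "smooth_factorization G \<tau> \<sigma> \<epsilon> f (vacuum_frame G a b j) W E m"
    and commute_a: "\<And>i k. lie_bracket G (a i) (a k) = 0" and commute_b: "\<And>k. lie_bracket G b (a k) = 0"
begin

text \<open>\<open>M\<close> and \<open>EE\<close> are \<open>m\<close> and \<open>E\<close> as functions on a product, \<open>m\<close> in the coordinate at infinity, and \<open>H p v\<close> is
  the generating function whose Taylor coefficients are \<open>Q_coeff G (m p) v\<close>.\<close>

definition M :: "((real^'r) \<times> real) \<times> complex \<Rightarrow> 'g" where "M z = at_inf G (m (fst z)) (snd z)"
definition EE :: "((real^'r) \<times> real) \<times> complex \<Rightarrow> 'g" where "EE z = E (fst z) (snd z)"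
abbreviation disc :: "complex set" where "disc \<equiv> ball 0 \<epsilon>"
abbreviation dir :: "'r \<Rightarrow> (real^'r) \<times> real" where "dir k \<equiv> (axis k 1, 0)"
abbreviation H :: "(real^'r) \<times> real \<Rightarrow> complex^'n \<Rightarrow> complex \<Rightarrow> complex^'n" where
  "H p v w \<equiv> Ad G (inv (M (p, w))) v"

lemma factorizationD:
  assumes "p \<in> W"
  shows "E p \<in> loops_plus G \<epsilon>" "m p \<in> loops_minus G \<epsilon>" "m p \<in> real_loops \<tau> \<sigma> \<epsilon>"
    and "l \<in> punctured_nbhd \<epsilon> \<Longrightarrow> inv f l \<otimes> vacuum_frame G a b j p l = E p l \<otimes> inv (m p l)"
  using factorization assms unfolding smooth_factorization_def by blast+

lemma M_smooth: "smooth_into G (W \<times> disc) M"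
  using factorization by (simp add: smooth_factorization_def case_prod_unfold M_def[abs_def])

lemma EE_smooth: "smooth_into G (W \<times> UNIV) EE"
  using factorization by (simp add: smooth_factorization_def case_prod_unfold EE_def[abs_def])

lemma smooth_into_slice:
  fixes S :: "complex set"
  assumes "smooth_into G (W \<times> S) F" "open S" "p \<in> W"
  shows "smooth_into G S (\<lambda>w. F (p, w))"
proof (rule smooth_into_compose[OF assms(1,2) open_Times[OF open_W assms(2)]])
  show "smooth_on S (Pair p)" by (intro smooth_on_Pair smooth_on_const smooth_on_ident assms(2))
  show "Pair p ` S \<subseteq> W \<times> S" using assms(3) by auto
qed

lemma M_holomorphic:
  assumes "p \<in> W"
  shows "holomorphic_map_into G ((*) \<i>) disc (\<lambda>w. M (p, w))"
  using smooth_into_slice[OF M_smooth open_ball assms] factorizationD(2)[OF assms]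
  by (intro holomorphic_into_imp_holomorphic_map_into) (simp_all add: loops_minus_def M_def)

lemma EE_holomorphic:
  assumes "p \<in> W"
  shows "holomorphic_map_into G ((*) \<i>) UNIV (\<lambda>w. EE (p, w))"
  using smooth_into_slice[OF EE_smooth open_UNIV assms] factorizationD(1)[OF assms]
  by (intro holomorphic_into_imp_holomorphic_map_into) (simp_all add: loops_plus_def EE_def)

text \<open>The logarithmic derivatives \<open>m\<^sup>-\<^sup>1 \<partial>\<^sub>k m\<close> and \<open>E\<^sup>-\<^sup>1 \<partial>\<^sub>k E\<close> with respect to the coordinate \<open>x\<^sub>k\<close>.\<close>

definition nu_m :: "(real^'r) \<times> real \<Rightarrow> 'r \<Rightarrow> complex \<Rightarrow> complex^'n" where
  "nu_m p k w = (SOME \<nu>. log_deriv G (\<lambda>s. M (p + s *\<^sub>R dir k, w)) (\<lambda>h. h *\<^sub>R \<nu>) 0)"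

definition nu_E :: "(real^'r) \<times> real \<Rightarrow> 'r \<Rightarrow> complex \<Rightarrow> complex^'n" where
  "nu_E p k l = (SOME \<nu>. log_deriv G (\<lambda>s. EE (p + s *\<^sub>R dir k, l)) (\<lambda>h. h *\<^sub>R \<nu>) 0)"

lemma nu_m: "p \<in> W \<Longrightarrow> w \<in> disc \<Longrightarrow> log_deriv G (\<lambda>s. M (p + s *\<^sub>R dir k, w)) (\<lambda>h. h *\<^sub>R nu_m p k w) 0"
  unfolding nu_m_def by (rule someI_ex[OF line_log_deriv[OF M_smooth open_W open_ball]])

lemma nu_E: "p \<in> W \<Longrightarrow> log_deriv G (\<lambda>s. EE (p + s *\<^sub>R dir k, l)) (\<lambda>h. h *\<^sub>R nu_E p k l) 0"
  unfolding nu_E_def by (rule someI_ex[OF line_log_deriv[OF EE_smooth open_W open_UNIV]]) simp_all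

lemma M_carrier: "p \<in> W \<Longrightarrow> w \<in> disc \<Longrightarrow> M (p, w) \<in> carrier G"
  using smooth_into_carrier[OF M_smooth, of "(p, w)"] by simp

lemma EE_carrier: "p \<in> W \<Longrightarrow> EE (p, l) \<in> carrier G"
  using smooth_into_carrier[OF EE_smooth, of "(p, l)"] by simp

lemma f_carrier: "l \<in> punctured_nbhd \<epsilon> \<Longrightarrow> f l \<in> carrier G"
  using f_minus unfolding loops_minus_def loops_def holomorphic_into_def continuous_map_def
  by (auto simp: topspace_eq)

lemma nu_m_zero: "p \<in> W \<Longrightarrow> nu_m p k 0 = 0"
proof -
  assume p: "p \<in> W"
  have "log_deriv G (\<lambda>s::real. \<one>) (\<lambda>h. h *\<^sub>R nu_m p k 0) 0"
    using nu_m[OF p, of 0 k] eps by (simp add: M_def at_inf_def)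
  from fun_cong[OF log_deriv_unique[OF this log_deriv_const[OF one_closed]], of 1] show ?thesis by simp
qed

lemma H_zero: "H p v 0 = v"
  by (simp add: M_def at_inf_def Ad_one)

lemma Q_coeff_eq: "Q_coeff G (m p) c n $ i = (deriv ^^ n) (\<lambda>w. H p c w $ i) 0 / fact n"
  by (simp add: Q_coeff_def M_def)

lemma Q_coeff_chi: "Q_coeff G (m p) c n = (\<chi> i. (deriv ^^ n) (\<lambda>w. H p c w $ i) 0 / fact n)"
  by (simp add: vec_eq_iff Q_coeff_eq)

lemma H_holomorphic: "p \<in> W \<Longrightarrow> (\<lambda>w. H p v w $ i) holomorphic_on disc"
  by (rule Ad_holomorphic(2)[OF M_holomorphic open_ball])

text \<open>All exponents lie in the complex span of the commuting elements \<open>a i\<close> and \<open>b\<close>.\<close>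

lemma vacuum_frame_shift:
  "vacuum_frame G a b j (p + s *\<^sub>R dir k) l
    = vacuum_frame G a b j p l \<otimes> lie_exp G (s *\<^sub>R (l *s a k))"
proof -
  obtain x t where p: "p = (x, t)" by (cases p)
  have q: "p + s *\<^sub>R dir k = (x + s *\<^sub>R axis k 1, t)" by (simp add: p)
  let ?V = "l *s (\<Sum>i\<in>UNIV. x $ i *\<^sub>R a i) + (l ^ j * complex_of_real t) *s b"
  have "(\<Sum>i\<in>UNIV. (x + s *\<^sub>R axis k 1) $ i *\<^sub>R a i) = (\<Sum>i\<in>UNIV. x $ i *\<^sub>R a i) + s *\<^sub>R a k"
  proof -
    have "(\<Sum>i\<in>UNIV. (s *\<^sub>R axis k 1) $ i *\<^sub>R a i) = (\<Sum>i\<in>UNIV. if i = k then s *\<^sub>R a i else 0)"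
      by (rule sum.cong) (auto simp: axis_def)
    then show ?thesis by (simp add: scaleR_add_left sum.distrib)
  qed
  then have e: "l *s (\<Sum>i\<in>UNIV. (x + s *\<^sub>R axis k 1) $ i *\<^sub>R a i) + (l ^ j * complex_of_real t) *s b
     = ?V + s *\<^sub>R (l *s a k)"
    by (simp add: vec_eq_iff algebra_simps)
  have lin: "linear (\<lambda>u. lie_bracket G u v)" for v
    by (rule bounded_linear.linear[OF lie_bracket_linear_left])
  have "lie_bracket G (\<Sum>i\<in>UNIV. x $ i *\<^sub>R a i) (a k) = 0"
    by (simp add: linear_sum[OF lin] linear_cmul[OF lin] commute_a)
  then have V0: "lie_bracket G ?V (a k) = 0"
    by (simp add: lie_bracket_add_left lie_bracket_scale_left commute_b)
  have "lie_bracket G ?V (s *\<^sub>R (l *s a k)) = 0"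
  proof -
    have "s *\<^sub>R (l *s a k) = (of_real s * l) *s a k"
      by (simp add: vec_eq_iff scaleR_conv_of_real[symmetric])
    then show ?thesis by (simp only: lie_bracket_scale_right V0) (simp add: vec_eq_iff)
  qed
  note ex = lie_exp_add_commuting[OF this]
  show ?thesis unfolding q unfolding p vacuum_frame_def prod.case e by (rule ex)
qed

lemma eventually_in_W: "p \<in> W \<Longrightarrow> \<forall>\<^sub>F s::real in nhds 0. p + s *\<^sub>R e \<in> W"
proof -
  assume p: "p \<in> W"
  have "open ((\<lambda>s::real. p + s *\<^sub>R e) -` W)"
    by (rule open_vimage[OF open_W]) (intro continuous_intros)
  moreover have "0 \<in> (\<lambda>s::real. p + s *\<^sub>R e) -` W" using p by simp
  ultimately have "\<forall>\<^sub>F s::real in nhds 0. s \<in> (\<lambda>s::real. p + s *\<^sub>R e) -` W" by (rule eventually_nhds_in_open)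
  then show ?thesis by simp
qed

text \<open>Take the logarithmic derivative of \<open>E = f\<^sup>-\<^sup>1 e\<^sup>A m\<close>; the constant left factor \<open>f\<^sup>-\<^sup>1 e\<^sup>A(x)\<close> drops out.\<close>

lemma nu_relation:
  assumes p: "p \<in> W" and w: "w \<in> disc" "w \<noteq> 0"
  shows "nu_E p k (inverse w) = inverse w *s H p (a k) w + nu_m p k w"
proof -
  define l where "l = inverse w"
  have l: "l \<in> punctured_nbhd \<epsilon>" unfolding l_def by (rule punctured_nbhd_inverse[OF eps w])
  have M: "M (q, w) = m q l" for q using w by (simp add: M_def at_inf_def l_def)
  have mc: "m q l \<in> carrier G" if "q \<in> W" for q using M_carrier[OF that w(1)] by (simp only: M)
  define g0 where "g0 = inv f l \<otimes> vacuum_frame G a b j p l"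
  have vc: "vacuum_frame G a b j q l \<in> carrier G" for q
    by (cases q) (simp add: vacuum_frame_def lie_exp_carrier)
  have g0: "g0 \<in> carrier G" unfolding g0_def by (intro m_closed inv_closed f_carrier l vc)
  have solve: "E q l = inv f l \<otimes> vacuum_frame G a b j q l \<otimes> m q l" if q: "q \<in> W" for q
  proof -
    have "E q l \<otimes> inv (m q l) \<otimes> m q l = E q l"
      using EE_carrier[OF q, of l] mc[OF q] by (simp add: m_assoc l_inv EE_def)
    then show ?thesis using factorizationD(4)[OF q l] by simp
  qed
  have "log_deriv G (\<lambda>s. (g0 \<otimes> lie_exp G (s *\<^sub>R (l *s a k))) \<otimes> M (p + s *\<^sub>R dir k, w))
      (\<lambda>h. Ad G (inv (M (p + 0 *\<^sub>R dir k, w))) (h *\<^sub>R (l *s a k)) + h *\<^sub>R nu_m p k w) 0"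
    by (intro log_deriv_mult log_deriv_mult_left g0 lie_exp_log_deriv nu_m p w)
  moreover have "\<forall>\<^sub>F s in nhds 0. (g0 \<otimes> lie_exp G (s *\<^sub>R (l *s a k))) \<otimes> M (p + s *\<^sub>R dir k, w)
     = EE (p + s *\<^sub>R dir k, l)"
    using eventually_in_W[OF p, of "dir k"]
  proof eventually_elim
    case (elim s)
    have "EE (p + s *\<^sub>R dir k, l) = inv f l \<otimes> (vacuum_frame G a b j p l \<otimes> lie_exp G (s *\<^sub>R (l *s a k))) \<otimes> m (p + s *\<^sub>R dir k) l"
      using solve[OF elim] vacuum_frame_shift[of p s k l] by (simp add: EE_def)
    also have "\<dots> = g0 \<otimes> lie_exp G (s *\<^sub>R (l *s a k)) \<otimes> m (p + s *\<^sub>R dir k) l"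
      unfolding g0_def using f_carrier[OF l] vc[of p] lie_exp_carrier mc[OF elim] by (simp add: m_assoc)
    finally show ?case by (simp only: M)
  qed
  ultimately have "log_deriv G (\<lambda>s. EE (p + s *\<^sub>R dir k, l))
      (\<lambda>h. Ad G (inv (M (p + 0 *\<^sub>R dir k, w))) (h *\<^sub>R (l *s a k)) + h *\<^sub>R nu_m p k w) 0"
    by (rule log_deriv_cong)
  from fun_cong[OF log_deriv_unique[OF this nu_E[OF p]], of 1]
  have "Ad G (inv (M (p, w))) (l *s a k) + nu_m p k w = nu_E p k l"
    by (simp only: scaleR_zero_left scaleR_one add_0_right)
  then show ?thesis
    using M_carrier[OF p w(1)] by (simp add: Ad_scale l_def[symmetric])
qed

lemma lie_bracket_H: "p \<in> W \<Longrightarrow> w \<in> disc \<Longrightarrow> lie_bracket G (H p u w) (H p v w) = H p (lie_bracket G u v) w"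
  using M_carrier by (simp add: Ad_lie_bracket)

lemma Q_coeff_one: "Q_coeff G (m p) c 1 $ i = deriv (\<lambda>w. H p c w $ i) 0"
  by (simp add: Q_coeff_eq)

text \<open>Liouville's theorem. \<open>E\<^sup>-\<^sup>1 \<partial>\<^sub>k E\<close> is entire in the spectral parameter, and near infinity it equals
  \<open>\<lambda> Ad (m\<^sup>-\<^sup>1) a\<^sub>k\<close> up to a term that vanishes at infinity. So it is the polynomial part of the latter,
  \<open>\<lambda> a\<^sub>k\<close> plus the first coefficient. The statement is about brackets because these are what
  \<open>log_deriv_parameter\<close> shows to be holomorphic.\<close>

lemma nu_E_bracket:
  assumes p: "p \<in> W"
  shows "lie_bracket G (nu_E p k l) v = l *s lie_bracket G (a k) v + lie_bracket G (Q_coeff G (m p) (a k) 1) v"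
proof (subst vec_eq_iff, rule allI)
  fix i
  let ?u = "Q_coeff G (m p) (a k) 1"
  define A where "A w = lie_bracket G (H p (a k) w) v $ i" for w
  define P where "P w = lie_bracket G (nu_m p k w) v $ i" for w
  \<comment> \<open>An entire function; in the coordinate \<open>w\<close> at infinity it is a difference quotient of \<open>A\<close> minus its limit,
      plus \<open>P w\<close>, which vanishes at \<open>w = 0\<close>.\<close>
  define \<phi> where "\<phi> l = lie_bracket G (nu_E p k l) v $ i - l * lie_bracket G (a k) v $ i - lie_bracket G ?u v $ i" for l
  have 0: "0 \<in> disc" using eps by simp
  have "(A has_field_derivative lie_bracket G ?u v $ i) (at 0)"
  proof -
    have "((\<lambda>w. H p (a k) w $ q) has_field_derivative ?u $ q) (at 0)" for q
      unfolding Q_coeff_one by (rule holomorphic_derivI[OF H_holomorphic[OF p] open_ball 0])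
    then have "((\<lambda>w. \<Sum>q\<in>UNIV. H p (a k) w $ q * lie_bracket G (axis q 1) v $ i) has_field_derivative
        (\<Sum>q\<in>UNIV. ?u $ q * lie_bracket G (axis q 1) v $ i)) (at 0)"
      by (intro DERIV_sum DERIV_cmult_right)
    then show ?thesis unfolding A_def lie_bracket_expansion_left[symmetric] .
  qed
  then have "((\<lambda>w. (A w - A 0) / (w - 0)) \<longlongrightarrow> lie_bracket G ?u v $ i) (at 0)"
    by (simp add: has_field_derivative_iff)
  moreover have "(P \<longlongrightarrow> P 0) (at 0)"
  proof -
    have "P holomorphic_on disc" unfolding P_def
      by (rule log_deriv_parameter(1)[OF M_smooth open_W open_ball M_holomorphic p nu_m[OF p]])
    then have "continuous_on disc P" by (rule holomorphic_on_imp_continuous_on)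
    then have "isCont P 0" using 0 open_ball continuous_on_eq_continuous_at by blast
    then show ?thesis by (rule isContD)
  qed
  moreover have "P 0 = 0" by (simp add: P_def nu_m_zero[OF p] lie_bracket_zero_left)
  ultimately have "((\<lambda>w. (A w - A 0) / (w - 0) - lie_bracket G ?u v $ i + P w) \<longlongrightarrow>
      lie_bracket G ?u v $ i - lie_bracket G ?u v $ i + 0) (at 0)"
    by (intro tendsto_add tendsto_diff tendsto_const) simp_all
  moreover have "\<forall>\<^sub>F w in at 0. (A w - A 0) / (w - 0) - lie_bracket G ?u v $ i + P w = \<phi> (inverse w)"
  proof -
    have "\<forall>\<^sub>F w in at 0. w \<in> disc \<and> w \<noteq> 0"
      using eventually_at_in_open[OF open_ball 0] by eventually_elim auto
    then show ?thesis
    proof eventually_elim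
      case (elim w)
      then have "lie_bracket G (nu_E p k (inverse w)) v = inverse w *s lie_bracket G (H p (a k) w) v + lie_bracket G (nu_m p k w) v"
        using nu_relation[OF p, of w k] by (simp add: lie_bracket_add_left lie_bracket_scale_left)
      then have "\<phi> (inverse w) = inverse w * A w + P w - inverse w * A 0 - lie_bracket G ?u v $ i"
        by (simp add: \<phi>_def A_def P_def H_zero)
      then show ?case by (simp add: divide_inverse algebra_simps)
    qed
  qed
  ultimately have "((\<lambda>w. \<phi> (inverse w)) \<longlongrightarrow> 0) (at 0)"
    using Lim_transform_eventually by fastforce
  moreover have "filterlim inverse (at 0) (at_infinity :: complex filter)"
    unfolding filterlim_inverse_at_iff by (rule filterlim_ident)
  ultimately have "((\<lambda>l. \<phi> (inverse (inverse l))) \<longlongrightarrow> 0) at_infinity"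
    by (rule filterlim_compose)
  then have "(\<phi> \<longlongrightarrow> 0) at_infinity" by simp
  moreover have "\<phi> holomorphic_on UNIV"
  proof -
    have "(\<lambda>l. lie_bracket G (nu_E p k l) v $ i) holomorphic_on UNIV"
      by (rule log_deriv_parameter(1)[OF EE_smooth open_W open_UNIV EE_holomorphic p nu_E[OF p]])
    then show ?thesis unfolding \<phi>_def by (intro holomorphic_intros)
  qed
  ultimately have "\<phi> l = 0" by (rule Liouville_weak_0[rotated])
  then show "lie_bracket G (nu_E p k l) v $ i = (l *s lie_bracket G (a k) v + lie_bracket G ?u v) $ i"
    by (simp add: \<phi>_def algebra_simps)
qed

text \<open>The coefficient of order one of \<open>[Ad (m\<^sup>-\<^sup>1) a\<^sub>i, Ad (m\<^sup>-\<^sup>1) a\<^sub>k] = Ad (m\<^sup>-\<^sup>1) [a\<^sub>i, a\<^sub>k] = 0\<close>.\<close>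

lemma Q_coeff_one_symmetric:
  assumes p: "p \<in> W"
  shows "lie_bracket G (Q_coeff G (m p) (a i) 1) (a k) = lie_bracket G (Q_coeff G (m p) (a k) 1) (a i)"
proof -
  let ?u = "\<lambda>i. Q_coeff G (m p) (a i) 1"
  have 0: "0 \<in> disc" using eps by simp
  have d: "((\<lambda>w. H p (a q) w $ r) has_field_derivative ?u q $ r) (at 0)" for q r
    unfolding Q_coeff_one by (rule holomorphic_derivI[OF H_holomorphic[OF p] open_ball 0])
  have "lie_bracket G (?u i) (a k) $ r + lie_bracket G (a i) (?u k) $ r = 0" for r
  proof -
    let ?B = "\<lambda>q s. lie_bracket G (axis q 1) (axis s 1) $ r"
    have ex: "lie_bracket G u v $ r = (\<Sum>q\<in>UNIV. \<Sum>s\<in>UNIV. u $ q * v $ s * ?B q s)" for u v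
    proof -
      have "lie_bracket G u v $ r = (\<Sum>q\<in>UNIV. u $ q * lie_bracket G (axis q 1) v $ r)"
        by (rule lie_bracket_expansion_left)
      also have "\<dots> = (\<Sum>q\<in>UNIV. u $ q * (\<Sum>s\<in>UNIV. v $ s * ?B q s))"
        by (simp only: lie_bracket_expansion_right[of _ v])
      finally show ?thesis by (simp add: sum_distrib_left mult.assoc)
    qed
    have "((\<lambda>w. \<Sum>q\<in>UNIV. \<Sum>s\<in>UNIV. H p (a i) w $ q * H p (a k) w $ s * ?B q s) has_field_derivative
       (\<Sum>q\<in>UNIV. \<Sum>s\<in>UNIV. (?u i $ q * H p (a k) 0 $ s + ?u k $ s * H p (a i) 0 $ q) * ?B q s)) (at 0)"
      by (intro DERIV_sum DERIV_cmult_right DERIV_mult d)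
    moreover have "(\<Sum>q\<in>UNIV. \<Sum>s\<in>UNIV. (?u i $ q * H p (a k) 0 $ s + ?u k $ s * H p (a i) 0 $ q) * ?B q s)
       = lie_bracket G (?u i) (a k) $ r + lie_bracket G (a i) (?u k) $ r"
      unfolding ex[of "?u i" "a k"] ex[of "a i" "?u k"] H_zero sum.distrib[symmetric]
      by (intro sum.cong refl) (simp add: algebra_simps)
    ultimately have "((\<lambda>w. lie_bracket G (H p (a i) w) (H p (a k) w) $ r) has_field_derivative
       (lie_bracket G (?u i) (a k) $ r + lie_bracket G (a i) (?u k) $ r)) (at 0)"
      by (simp only: ex[of "H p (a i) _" "H p (a k) _"])
    moreover have "((\<lambda>w. lie_bracket G (H p (a i) w) (H p (a k) w) $ r) has_field_derivative 0) (at 0)"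
    proof (rule has_field_derivative_transform_within_open[OF _ open_ball 0])
      show "((\<lambda>w. 0) has_field_derivative 0) (at 0)" by simp
      show "0 = lie_bracket G (H p (a i) w) (H p (a k) w) $ r" if "w \<in> disc" for w
        using M_carrier[OF p that] by (simp add: lie_bracket_H[OF p that] commute_a Ad_linear)
    qed
    ultimately show ?thesis by (rule DERIV_unique)
  qed
  then have "lie_bracket G (?u i) (a k) + lie_bracket G (a i) (?u k) = 0" by (simp add: vec_eq_iff)
  then show ?thesis using lie_bracket_antisym[of "a i" "?u k"] by simp
qed

text \<open>The Lax equation \<open>\<partial>\<^sub>k (Ad (m\<^sup>-\<^sup>1) c) = - [E\<^sup>-\<^sup>1 \<partial>\<^sub>k E, Ad (m\<^sup>-\<^sup>1) c]\<close>, coefficient by coefficient.\<close>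

lemma Q_coeff_derivative:
  assumes p: "p \<in> W" and c: "\<And>k. lie_bracket G (a k) c = 0"
  shows "((\<lambda>s. Q_coeff G (m (p + s *\<^sub>R dir k)) c n) has_vector_derivative
     - lie_bracket G (a k) (Q_coeff G (m p) c (Suc n))
     - lie_bracket G (Q_coeff G (m p) (a k) 1) (Q_coeff G (m p) c n)) (at 0)"
proof -
  let ?u = "Q_coeff G (m p) (a k) 1"
  define D where "D i w = - lie_bracket G (nu_m p k w) (H p c w) $ i" for i w
  have 0: "0 \<in> disc" using eps by simp
  have Dh: "D i holomorphic_on disc" for i unfolding D_def
    by (rule log_deriv_parameter(2)[OF M_smooth open_W open_ball M_holomorphic p nu_m[OF p]])
  have der: "((\<lambda>s. (deriv ^^ n) (\<lambda>w. H (p + s *\<^sub>R dir k) c w $ i) 0) has_vector_derivative (deriv ^^ n) (D i) 0) (at 0)" for i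
    unfolding D_def
    by (rule log_deriv_parameter(3)[OF M_smooth open_W open_ball M_holomorphic p nu_m[OF p] 0])
  \<comment> \<open>Replace \<open>nu_m\<close> by \<open>nu_E\<close>: the correction term is the bracket of \<open>H p (a k)\<close> and \<open>H p c\<close>,
      which vanishes because \<open>a k\<close> and \<open>c\<close> commute.\<close>
  have rel: "w * D i w = (\<Sum>q\<in>UNIV. - lie_bracket G (a k) (axis q 1) $ i * H p c w $ q)
      + w * (\<Sum>q\<in>UNIV. - lie_bracket G ?u (axis q 1) $ i * H p c w $ q)" if w: "w \<in> disc" for i w
  proof -
    have "w * D i w = - lie_bracket G (a k) (H p c w) $ i - w * lie_bracket G ?u (H p c w) $ i"
    proof (cases "w = 0")
      case True
      then show ?thesis using c[of k] by (simp add: H_zero)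
    next
      case False
      have "lie_bracket G (nu_m p k w) (H p c w) = lie_bracket G (nu_E p k (inverse w)) (H p c w)
          - inverse w *s lie_bracket G (H p (a k) w) (H p c w)"
        using nu_relation[OF p w False, of k] by (simp add: lie_bracket_add_left lie_bracket_scale_left)
      also have "lie_bracket G (H p (a k) w) (H p c w) = 0"
        using M_carrier[OF p w] by (simp add: lie_bracket_H[OF p w] c Ad_linear)
      finally have "lie_bracket G (nu_m p k w) (H p c w) = inverse w *s lie_bracket G (a k) (H p c w) + lie_bracket G ?u (H p c w)"
        by (simp add: nu_E_bracket[OF p])
      then show ?thesis using False by (simp add: D_def algebra_simps)
    qed
    then show ?thesis
      by (simp add: lie_bracket_expansion_right[of _ "H p c w"] sum_negf mult.commute)
  qed
  \<comment> \<open>The factor \<open>w\<close> on the left shifts the index: the coefficient of order \<open>n\<close> of \<open>D i\<close>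
      meets the one of order \<open>Suc n\<close> of \<open>H p c\<close>.\<close>
  have coef: "(deriv ^^ n) (D i) 0 / fact n =
     (- lie_bracket G (a k) (Q_coeff G (m p) c (Suc n)) - lie_bracket G ?u (Q_coeff G (m p) c n)) $ i" for i
  proof -
    have "(deriv ^^ n) (D i) 0 / fact n =
        (\<Sum>q\<in>UNIV. - lie_bracket G (a k) (axis q 1) $ i * ((deriv ^^ Suc n) (\<lambda>w. H p c w $ q) 0 / fact (Suc n)))
      + (\<Sum>q\<in>UNIV. - lie_bracket G ?u (axis q 1) $ i * ((deriv ^^ n) (\<lambda>w. H p c w $ q) 0 / fact n))"
      by (rule taylor_coefficient_recursion[OF eps Dh H_holomorphic[OF p] rel])
    also have "\<dots> = (\<Sum>q\<in>UNIV. - lie_bracket G (a k) (axis q 1) $ i * Q_coeff G (m p) c (Suc n) $ q)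
      + (\<Sum>q\<in>UNIV. - lie_bracket G ?u (axis q 1) $ i * Q_coeff G (m p) c n $ q)"
      by (simp only: Q_coeff_eq)
    also have "\<dots> = (- lie_bracket G (a k) (Q_coeff G (m p) c (Suc n)) - lie_bracket G ?u (Q_coeff G (m p) c n)) $ i"
      by (simp add: lie_bracket_expansion_right[of _ "Q_coeff G (m p) c (Suc n)"]
          lie_bracket_expansion_right[of _ "Q_coeff G (m p) c n"] sum_negf mult.commute)
    finally show ?thesis .
  qed
  have "((\<lambda>s. \<chi> i. (deriv ^^ n) (\<lambda>w. H (p + s *\<^sub>R dir k) c w $ i) 0 / fact n) has_vector_derivative
      (\<chi> i. (deriv ^^ n) (D i) 0 / fact n)) (at 0)"
    by (intro has_vector_derivative_vec_lambda has_vector_derivative_divide der)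
  then show ?thesis
    by (simp only: coef vec_lambda_eta Q_coeff_chi[symmetric])
qed

lemma Q_coeff_smooth: "smooth_on W (\<lambda>p. Q_coeff G (m p) c n)"
proof -
  have WS: "open (W \<times> disc)" by (intro open_Times open_W open_ball)
  have "smooth_on (W \<times> disc) (\<lambda>z. Ad G (inv M z) c $ i)" for i
    by (rule smooth_on_bounded_linear[OF WS bounded_linear_vec_nth Ad_smooth[OF smooth_into_inv[OF WS M_smooth] WS]])
  from smooth_partial_complex_derivative[OF open_W open_ball this]
  have sm: "smooth_on (W \<times> disc) (\<lambda>z. (deriv ^^ n) (\<lambda>w. H (fst z) c w $ i) (snd z))" for i
    using H_holomorphic by simp
  have "smooth_on W (\<lambda>p. (deriv ^^ n) (\<lambda>w. H p c w $ i) 0)" for i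
    using smooth_on_compose[where f = "\<lambda>p. (p, 0)", OF open_W WS _ _ sm[of i]]
      smooth_on_Pair[OF open_W smooth_on_ident[OF open_W] smooth_on_const[of W 0]] eps by simp
  then have "smooth_on W (\<lambda>p. (deriv ^^ n) (\<lambda>w. H p c w $ i) 0 / fact n)" for i
    by (intro smooth_on_bounded_linear[OF open_W bounded_linear_divide])
  then have "smooth_on W (\<lambda>p. \<chi> i. (deriv ^^ n) (\<lambda>w. H p c w $ i) 0 / fact n)"
    by (rule smooth_on_vec_lambda[OF open_W])
  then show ?thesis by (simp only: Q_coeff_chi)
qed

text \<open>The reality condition at real spectral parameters says that \<open>m\<close> takes values in the fixed points of
  \<open>\<tau>\<close> there.\<close>

lemma Q_coeff_real:
  assumes \<tau>: "\<tau> \<in> hom G G" "smooth_self_map G \<tau>" and p: "p \<in> W" and c: "diff_at_one G \<tau> c = c"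
  shows "diff_at_one G \<tau> (Q_coeff G (m p) c n) = Q_coeff G (m p) c n"
proof -
  interpret \<tau>: group_hom G G \<tau>
    using \<tau>(1) by unfold_locales
  have T: "bounded_linear (diff_at_one G \<tau>)" by (rule diff_at_one_linear[OF \<tau>])
  have "diff_at_one G \<tau> (H p c (of_real t)) = H p c (of_real t)" if t: "\<bar>t\<bar> < \<epsilon>" for t
  proof -
    have d: "of_real t \<in> disc" using t by simp
    have "\<tau> (M (p, of_real t)) = M (p, of_real t)"
    proof (cases "t = 0")
      case True
      then show ?thesis by (simp add: M_def at_inf_def)
    next
      case False
      have l: "inverse (of_real t) \<in> punctured_nbhd \<epsilon>"
        using punctured_nbhd_inverse[OF eps d] False by simp
      have "\<forall>l\<in>punctured_nbhd \<epsilon>. \<tau> (m p (cnj l)) = m p l"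
        using factorizationD(3)[OF p] by (simp add: real_loops_def)
      from bspec[OF this l] show ?thesis using False by (simp add: M_def at_inf_def)
    qed
    then show ?thesis
      using M_carrier[OF p d] by (simp add: diff_at_one_Ad[OF \<tau>] c)
  qed
  from real_curve_derivatives_fixed[where F = "H p c", OF eps T H_holomorphic[OF p] this, of n]
  have "diff_at_one G \<tau> (\<chi> i. (deriv ^^ n) (\<lambda>w. H p c w $ i) 0) = (\<chi> i. (deriv ^^ n) (\<lambda>w. H p c w $ i) 0)" .
  moreover have "Q_coeff G (m p) c n = (1 / fact n) *\<^sub>R (\<chi> i. (deriv ^^ n) (\<lambda>w. H p c w $ i) 0)"
    by (simp add: vec_eq_iff Q_coeff_eq scaleR_conv_of_real[where 'a = complex])
  ultimately show ?thesis
    using linear_cmul[OF bounded_linear.linear[OF T]] by metis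
qed

end

section \<open>Closed one-forms\<close>

lemma (in lie_grp) diff_at_one_involution:
  assumes \<theta>: "\<theta> \<in> hom G G" "smooth_self_map G \<theta>" and inv: "\<And>g. g \<in> carrier G \<Longrightarrow> \<theta> (\<theta> g) = g"
  shows "diff_at_one G \<theta> (diff_at_one G \<theta> v) = v"
proof -
  have "log_deriv G (\<lambda>p. \<theta> (\<theta> (coord_inv G p))) (\<lambda>h. diff_at_one G \<theta> (diff_at_one G \<theta> h)) coord_e"
    by (intro log_deriv_hom[OF \<theta>] log_deriv_coord_inv)
  moreover have "\<forall>\<^sub>F p in nhds coord_e. \<theta> (\<theta> (coord_inv G p)) = coord_inv G p"
    using eventually_img_e by eventually_elim (simp add: inv coord_inv_carrier)
  ultimately have "log_deriv G (coord_inv G) (\<lambda>h. diff_at_one G \<theta> (diff_at_one G \<theta> h)) coord_e"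
    by (rule log_deriv_cong)
  from fun_cong[OF log_deriv_unique[OF this log_deriv_coord_inv], of v] show ?thesis .
qed

text \<open>The exterior derivative is a combination of the differences of mixed partial derivatives.\<close>

lemma closed_one_formI:
  fixes g :: "'r::finite \<Rightarrow> real^'r \<Rightarrow> real"
  assumes S: "open S" and sm: "\<And>i. smooth_on S (g i)"
    and sym: "\<And>x i k. x \<in> S \<Longrightarrow> \<exists>d. ((\<lambda>s. g i (x + s *\<^sub>R axis k 1)) has_real_derivative d) (at 0) \<and>
        ((\<lambda>s. g k (x + s *\<^sub>R axis i 1)) has_real_derivative d) (at 0)"
  shows "closed_one_form S (\<lambda>x v. \<Sum>i\<in>UNIV. g i x * v $ i)"
  unfolding closed_one_form_def
proof (intro conjI ballI allI)
  show "linear (\<lambda>v. \<Sum>i\<in>UNIV. g i x * v $ i)" for x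
    by (intro linearI) (simp_all add: sum.distrib sum_distrib_left algebra_simps)
  show "smooth_on S (\<lambda>x. \<Sum>i\<in>UNIV. g i x * v $ i)" for v
    by (intro smooth_on_sum S smooth_on_bounded_linear[OF S bounded_linear_mult_left sm])
  fix x u v assume x: "x \<in> S"
  define D where "D i = frechet_derivative (g i) (at x)" for i
  have D: "(g i has_derivative D i) (at x)" for i
    unfolding D_def by (rule smooth_on_has_derivative[OF sm x])
  define d where "d i k = D i (axis k 1)" for i k
  have dir: "((\<lambda>s. g i (x + s *\<^sub>R axis k 1)) has_real_derivative d i k) (at 0)" for i k
  proof -
    have "((\<lambda>s. x + s *\<^sub>R axis k 1) has_derivative (\<lambda>h. h *\<^sub>R axis k 1)) (at (0::real))"
      by (auto intro!: derivative_eq_intros)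
    from has_derivative_compose[OF this, of "g i" "D i"] D
    have "((\<lambda>s. g i (x + s *\<^sub>R axis k 1)) has_derivative (\<lambda>h. D i (h *\<^sub>R axis k 1))) (at 0)" by simp
    then show ?thesis
      by (simp add: has_field_derivative_def d_def linear_cmul[OF has_derivative_linear[OF D]] mult.commute[of _ "D i _"])
  qed
  have ds: "d i k = d k i" for i k
    using sym[OF x, of i k] dir[of i k] dir[of k i] DERIV_unique by metis
  have Dexp: "D i w = (\<Sum>k\<in>UNIV. w $ k * d i k)" for i w
  proof -
    have "D i w = D i (\<Sum>k\<in>UNIV. w $ k *\<^sub>R axis k 1)"
      by (simp add: scalar_mult_eq_scaleR[symmetric] basis_expansion)
    also have "\<dots> = (\<Sum>k\<in>UNIV. w $ k * d i k)"
      by (simp add: linear_sum[OF has_derivative_linear[OF D]] linear_cmul[OF has_derivative_linear[OF D]] d_def)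
    finally show ?thesis .
  qed
  have fd: "frechet_derivative (\<lambda>y. \<Sum>i\<in>UNIV. g i y * w $ i) (at x) w' = (\<Sum>i\<in>UNIV. D i w' * w $ i)" for w w'
  proof -
    have "((\<lambda>y. \<Sum>i\<in>UNIV. g i y * w $ i) has_derivative (\<lambda>h. \<Sum>i\<in>UNIV. D i h * w $ i)) (at x)"
      by (intro has_derivative_sum has_derivative_mult_left D)
    from fun_cong[OF frechet_derivative_eqI[OF this], of w'] show ?thesis .
  qed
  have "(\<Sum>i\<in>UNIV. D i u * v $ i) = (\<Sum>i\<in>UNIV. \<Sum>k\<in>UNIV. u $ k * d i k * v $ i)"
    by (simp add: Dexp sum_distrib_right)
  also have "\<dots> = (\<Sum>k\<in>UNIV. \<Sum>i\<in>UNIV. u $ k * d i k * v $ i)" by (rule sum.swap)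
  also have "\<dots> = (\<Sum>k\<in>UNIV. \<Sum>i\<in>UNIV. v $ i * d k i * u $ k)"
    by (intro sum.cong refl) (simp add: ds)
  also have "\<dots> = (\<Sum>i\<in>UNIV. D i v * u $ i)"
    by (simp add: Dexp sum_distrib_right)
  finally show "ext_deriv (\<lambda>x v. \<Sum>i\<in>UNIV. g i x * v $ i) x u v = 0"
    by (simp add: ext_deriv_def fd)
qed

theorem theorem5p9:
  fixes G :: "('g, 'n::finite) lie_data"
    and \<tau> \<sigma> :: "'g \<Rightarrow> 'g"
    and B :: "complex^'n \<Rightarrow> complex^'n \<Rightarrow> real"
    and \<A> :: "(complex^'n) set"
    and a :: "'r::finite \<Rightarrow> complex^'n"
    and b c :: "complex^'n"
    and j n :: nat
    and \<epsilon> :: real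
    and f :: "complex \<Rightarrow> 'g"
    and W :: "((real^'r) \<times> real) set"
    and E m :: "(real^'r) \<times> real \<Rightarrow> complex \<Rightarrow> 'g"
  assumes "semisimple_complex_lie_group G"
    and "admissible_involutions G \<tau> \<sigma>"
    and "invariant_form G (alg_U G \<tau>) B"
    and "maximal_abelian G (alg_U1 G \<tau> \<sigma>) \<A>"
    and "inj a" and "independent (range a)" and "span (range a) = \<A>"
    and "\<And>i. regular_element G \<tau> \<sigma> (a i)"
    and "b \<in> \<A>" and "odd j" and "j > 1"
    and "\<epsilon> > 0"
    and "f \<in> loops_minus G \<epsilon> \<inter> real_loops \<tau> \<sigma> \<epsilon>"
    and "open W" and "(0, 0) \<in> W"
    and "smooth_factorization G \<tau> \<sigma> \<epsilon> f (vacuum_frame G a b j) W E m"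
    and "c \<in> \<A>" and "n > 0"
  shows "(\<forall>x t. (x, t) \<in> W \<longrightarrow> (\<forall>i k. i \<noteq> k \<longrightarrow>
            (\<exists>d. ((\<lambda>s. B (Q_coeff G (m (x + axis k s, t)) c n) (a i)) has_real_derivative d) (at 0) \<and>
                 ((\<lambda>s. B (Q_coeff G (m (x + axis i s, t)) c n) (a k)) has_real_derivative d) (at 0)))) \<and>
         (\<forall>t. closed_one_form {x. (x, t) \<in> W}
            (\<lambda>x v. \<Sum>i\<in>UNIV. B (Q_coeff G (m (x, t)) c n) (a i) * v $ i))"
proof -
  interpret lie_grp G
    using assms(1) by unfold_locales (simp add: semisimple_complex_lie_group_def)
  have aA: "a i \<in> \<A>" for i using assms(7) span_base[of "a i" "range a"] by auto
  have comm: "lie_bracket G u v = 0" if "u \<in> \<A>" "v \<in> \<A>" for u v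
    using assms(4) that by (simp add: maximal_abelian_def abelian_subspace_def)
  interpret F: lie_factorization G \<tau> \<sigma> \<epsilon> f a b j W E m
    using assms(9,12,13,14,16) aA comm by unfold_locales auto
  have \<tau>: "\<tau> \<in> hom G G" "smooth_self_map G \<tau>" and \<tau>\<tau>: "\<And>g. g \<in> carrier G \<Longrightarrow> \<tau> (\<tau> g) = g"
    using assms(2) by (auto simp: admissible_involutions_def lie_involution_def)
  let ?T = "diff_at_one G \<tau>"
  have T: "bounded_linear ?T" by (rule diff_at_one_linear[OF \<tau>])
  note Tlin = bounded_linear.linear[OF T]
  define V where "V = alg_U G \<tau>"
  have V: "v \<in> V \<longleftrightarrow> ?T v = v" for v
    unfolding V_def alg_U_def grp_U_def lie_algebra_of_fixed_points[OF \<tau>] by simp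
  have V_minus: "- u \<in> V" if "u \<in> V" for u
    using that by (simp add: V linear_neg[OF Tlin])
  have V_br: "lie_bracket G u v \<in> V" and V_diff: "u - v \<in> V" if "u \<in> V" "v \<in> V" for u v
    using that by (simp_all add: V linear_diff[OF Tlin] diff_at_one_lie_bracket[OF \<tau>])
  have AV: "v \<in> V" if "v \<in> \<A>" for v
    using assms(4) that unfolding maximal_abelian_def abelian_subspace_def alg_U1_def V_def by auto
  have aV: "a i \<in> V" for i by (rule AV[OF aA])
  have B_add: "B (u + v) w = B u w + B v w" and B_scale: "B (s *\<^sub>R u) w = s * B u w"
    and B_inv: "B (lie_bracket G w u) v + B u (lie_bracket G w v) = 0" if "u \<in> V" "v \<in> V" "w \<in> V" for u v w s
    using assms(3) that unfolding invariant_form_def V_def[symmetric] by blast+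
  have B_diff: "B (u - v) w = B u w - B v w" if "u \<in> V" "v \<in> V" "w \<in> V" for u v w
    using B_add[OF that(1) V_minus[OF that(2)] that(3)] B_scale[OF that(2,2,3), of "-1"] by simp
  have B_zero: "B u 0 = 0" if "u \<in> V" for u
  proof -
    have "\<forall>s. \<forall>u\<in>V. \<forall>v\<in>V. B (s *\<^sub>R u) v = s * B u v \<and> B u (s *\<^sub>R v) = s * B u v"
      using assms(3) unfolding invariant_form_def V_def[symmetric] by (elim conjE)
    then have "B u (0 *\<^sub>R u) = 0 * B u u" using that by blast
    then show ?thesis by simp
  qed
  \<comment> \<open>The form is linear on \<open>\<U>\<close> only; projecting along the other eigenspace of \<open>d\<tau>\<close> extends it to a linear function.\<close>
  define pr where "pr v = (1/2) *\<^sub>R (v + ?T v)" for v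
  have prV: "pr v \<in> V" for v
    by (simp add: pr_def V linear_cmul[OF Tlin] linear_add[OF Tlin] diff_at_one_involution[OF \<tau> \<tau>\<tau>] add.commute)
  have pr_id: "pr v = v" if "v \<in> V" for v
    using that unfolding V pr_def by (simp add: scaleR_add_right[symmetric] scaleR_2[symmetric])
  have pr_lin: "pr (u + v) = pr u + pr v" "pr (s *\<^sub>R u) = s *\<^sub>R pr u" for u v s
    by (simp_all add: pr_def linear_add[OF Tlin] linear_cmul[OF Tlin] algebra_simps)
  define L where "L i v = B (pr v) (a i)" for i v
  have L: "bounded_linear (L i)" for i
  proof (rule linear_conv_bounded_linear[THEN iffD1], rule linearI)
    show "L i (u + v) = L i u + L i v" for u v
      unfolding L_def pr_lin by (rule B_add[OF prV prV aV])
    show "L i (s *\<^sub>R u) = s *\<^sub>R L i u" for s u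
      unfolding L_def pr_lin using B_scale[OF prV prV aV] by simp
  qed
  have L_eq: "L i v = B v (a i)" if "v \<in> V" for i v by (simp add: L_def pr_id[OF that])
  let ?Q = "\<lambda>p n. Q_coeff G (m p) c n" and ?u = "\<lambda>p k. Q_coeff G (m p) (a k) 1"
  have QV: "Q_coeff G (m p) v n \<in> V" if "p \<in> W" "v \<in> V" for p v n
    using F.Q_coeff_real[OF \<tau> that(1)] that(2) by (simp add: V)
  have cV: "c \<in> V" by (rule AV[OF assms(17)])
  define Q' where "Q' p k = - lie_bracket G (a k) (?Q p (Suc n)) - lie_bracket G (?u p k) (?Q p n)" for p k
  have Q'V: "Q' p k \<in> V" if "p \<in> W" for p k
    unfolding Q'_def by (intro V_diff V_minus V_br QV that cV aV)
  have der: "((\<lambda>s. B (?Q (p + s *\<^sub>R F.dir k) n) (a i)) has_real_derivative B (Q' p k) (a i)) (at 0)" if p: "p \<in> W" for p i k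
  proof -
    have "((\<lambda>s. ?Q (p + s *\<^sub>R F.dir k) n) has_vector_derivative Q' p k) (at 0)"
      unfolding Q'_def by (rule F.Q_coeff_derivative[OF p comm[OF aA assms(17)]])
    from bounded_linear.has_vector_derivative[OF L this]
    have "((\<lambda>s. L i (?Q (p + s *\<^sub>R F.dir k) n)) has_derivative (\<lambda>h. h *\<^sub>R B (Q' p k) (a i))) (at 0)"
      by (simp add: has_vector_derivative_def L_eq[OF Q'V[OF p]])
    moreover have "\<forall>\<^sub>F s in nhds 0. L i (?Q (p + s *\<^sub>R F.dir k) n) = B (?Q (p + s *\<^sub>R F.dir k) n) (a i)"
      using F.eventually_in_W[OF p, of "F.dir k"] by eventually_elim (rule L_eq[OF QV[OF _ cV]])
    ultimately have "((\<lambda>s. B (?Q (p + s *\<^sub>R F.dir k) n) (a i)) has_derivative (\<lambda>h. h *\<^sub>R B (Q' p k) (a i))) (at 0)"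
      by (rule has_derivative_transform_nhds)
    then show ?thesis by (simp add: has_field_derivative_def mult.commute[of _ "B _ _"])
  qed
  \<comment> \<open>Invariance moves the first bracket of \<open>Q'\<close> to \<open>[a k, a i]\<close>, which vanishes.\<close>
  have val: "B (Q' p k) (a i) = B (?Q p n) (lie_bracket G (?u p k) (a i))" if p: "p \<in> W" for p i k
  proof -
    have "B (Q' p k) (a i) = - B (lie_bracket G (a k) (?Q p (Suc n))) (a i) - B (lie_bracket G (?u p k) (?Q p n)) (a i)"
    proof -
      have 1: "lie_bracket G (a k) (?Q p (Suc n)) \<in> V" and 2: "lie_bracket G (?u p k) (?Q p n) \<in> V"
        by (intro V_br QV p cV aV)+
      have "B (- lie_bracket G (a k) (?Q p (Suc n))) (a i) = - B (lie_bracket G (a k) (?Q p (Suc n))) (a i)"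
        using B_scale[OF 1 1 aV, of "-1" i] by simp
      then show ?thesis unfolding Q'_def using B_diff[OF V_minus[OF 1] 2 aV, of i] by simp
    qed
    also have "\<dots> = B (?Q p (Suc n)) (lie_bracket G (a k) (a i)) + B (?Q p n) (lie_bracket G (?u p k) (a i))"
      using B_inv[OF QV[OF p cV, of "Suc n"] aV[of i] aV[of k]]
        B_inv[OF QV[OF p cV, of n] aV[of i] QV[OF p aV[of k], of 1]] by linarith
    finally show ?thesis by (simp add: comm[OF aA aA] B_zero[OF QV[OF p cV]])
  qed
  have sym: "B (Q' p k) (a i) = B (Q' p i) (a k)" if p: "p \<in> W" for p i k
    unfolding val[OF p] by (simp only: F.Q_coeff_one_symmetric[OF p])
  have pt: "(x + s *\<^sub>R axis k 1, t) = (x, t) + s *\<^sub>R F.dir k"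
    and pt': "(x + axis k s, t) = (x, t) + s *\<^sub>R F.dir k" for x :: "real^'r" and s t k
    by (simp_all add: vec_eq_iff axis_def)
  have both: "\<exists>d. ((\<lambda>s. B (?Q ((x, t) + s *\<^sub>R F.dir k) n) (a i)) has_real_derivative d) (at 0) \<and>
        ((\<lambda>s. B (?Q ((x, t) + s *\<^sub>R F.dir i) n) (a k)) has_real_derivative d) (at 0)" if "(x, t) \<in> W" for x t i k
    using der[OF that, of k i] der[OF that, of i k] unfolding sym[OF that, of k i] by blast
  show ?thesis
  proof (intro conjI allI impI)
    fix x t and i k :: 'r assume "(x, t) \<in> W" "i \<noteq> k"
    from both[OF this(1), of k i]
    show "\<exists>d. ((\<lambda>s. B (Q_coeff G (m (x + axis k s, t)) c n) (a i)) has_real_derivative d) (at 0) \<and>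
                 ((\<lambda>s. B (Q_coeff G (m (x + axis i s, t)) c n) (a k)) has_real_derivative d) (at 0)"
      unfolding pt' .
  next
    fix t
    define S where "S = {x. (x, t) \<in> W}"
    have S: "open S"
    proof -
      have "open ((\<lambda>x. (x, t)) -` W)" by (rule open_vimage[OF F.open_W]) (intro continuous_intros)
      then show ?thesis by (simp add: S_def vimage_def)
    qed
    have sm: "smooth_on S (\<lambda>x. B (?Q (x, t) n) (a i))" for i
    proof -
      have "smooth_on S (\<lambda>x. (x, t))" by (intro smooth_on_Pair S smooth_on_ident smooth_on_const)
      then have "smooth_on S (\<lambda>x. ?Q (x, t) n)"
        using smooth_on_compose[where f = "\<lambda>x. (x, t)", OF S F.open_W _ _ F.Q_coeff_smooth] by (simp add: S_def)
      then have "smooth_on S (\<lambda>x. L i (?Q (x, t) n))" by (rule smooth_on_bounded_linear[OF S L])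
      then show ?thesis
        by (rule smooth_on_cong_open[OF S, rotated]) (simp add: S_def L_eq QV cV)
    qed
    show "closed_one_form {x. (x, t) \<in> W} (\<lambda>x v. \<Sum>i\<in>UNIV. B (Q_coeff G (m (x, t)) c n) (a i) * v $ i)"
      unfolding S_def[symmetric]
      by (rule closed_one_formI[OF S sm], unfold pt, rule both) (simp add: S_def)
  qed
qed

end
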